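(* Let $\Psi$ be the KL generating function of the context, let the (BRSC) assumption in the context be satisfied, and consider the safe oracle region (a subset of $\mathbb R_{\ge0}^{k^*}$ containing $u^{\mathrm{or}}$ and defined without knowledge of $u^{\mathrm{or}}$) $$\mathfrak S=\left\{u\in\mathbb R_{\ge0}^{k^*}:\ \sum_{j=1}^{k^*}\gamma_{\sigma^*[j]}\,g_1^{\mathrm{KL}}\left(\frac{c_{\sigma^*[j]}u_j^*+\xi}{c_{\sigma^*[j]}u_j+\xi}\right)\le\frac{F_{\sigma^*}(u^* )}{\xi C_K}\right\}.$$ Define $$\underline\Lambda:=\max\left\{\frac{f(\|\varepsilon\|_\infty,m(x^* ))}{1+K-2k^*},\ \max_{i\in{\sigma^*}^c}\left\{-\gamma_i\xi\log\left(1-\frac{\|a_i\|_2\sqrt{2\tilde Lf(\|\varepsilon\|_\infty,m(x^* ))}}{\min\{C_K,1\}\gamma_ic_i}\right)\right\}\right\}$$ for some $\tilde L\ge L$, where $L=\max_jy_j/b_j^2$, as well as $$\bar\Lambda:=\min_{i\in\sigma^*}\left\{-\gamma_i\xi\left(\log\left(1-e^{h_i(\|\varepsilon\|_\infty,m(x^* ))}\right)+1\right)\right\},$$ for the functions $h_i:\mathbb R_{\ge0}\times\mathbb R_{\ge0}\to\mathbb R_{\le0}$, $i\in\sigma^*$, given in the context (which differ depending on whether $C_K<1$ or $C_K\ge1$), which are increasing when $\|\varepsilon\|_\infty\to0$ or $m(x^* )\to+\infty$. Then, if $\lambda_0\in(\underline\Lambda,\bar\Lambda)$, $x^{\mathrm{or}}$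 is the unique global minimizer of $J_\Psi$ (and so of $J_0$) with $\sigma(x^{\mathrm{or}})=\sigma^*$, and any other critical point $x'$ of $J_\Psi$, $x'\ne x^{\mathrm{or}}$, satisfies $\|x'-x^{\mathrm{or}}\|_0>K$. Additionally, the $h_i$ increase towards (i) $(c_iu_i^*(\min\{C_K,1\}-1)-\xi)/(c_iu_i^*+\xi)$ when $\|\varepsilon\|_\infty\to0$ (where $u_i^*$ stands for $x_i^*$, $i\in\sigma^*$), (ii) $\min\{C_K,1\}-1$ when $m(x^* )\to\infty$.
   Context: Poisson setting. $\mathcal C=\mathbb R_{\ge0}$; $A=(a_{ji})\in\mathbb R_{\ge0}^{M\times N}$ with columns $a_1,\dots,a_N$, none entirely zero; $b\in\mathbb R_{>0}^M$; $y\in\mathbb Z_{\ge0}^M$; $\lambda_0>0$; $\|x\|_0$ is the number of nonzero entries and $\sigma(x)$ the support of $x$. $g_y^{\mathrm{KL}}(z)=z+y\log(y/z)-y$, $G_y^{\mathrm{KL}}(w)=\sum_{j=1}^Mg^{\mathrm{KL}}_{y_j}(w_j+b_j)$, $F(x)=G_y^{\mathrm{KL}}(Ax)$, $J_0(x)=F(x)+\lambda_0\|x\|_0$ on $\mathbb R_{\ge0}^N$. The constant $\tilde L\ge L$ comes from the bound $\|\nabla G_y^{\mathrm{KL}}(w)\|\le\sqrt{2\tilde LG_y^{\mathrm{KL}}(w)}$ for all $w\in\{Ax:x\in\mathbb R_{\ge0}^N\}$. KL generating function. $\Psi(x)=\sum_i\psi_i(x_i)$, $\psi_i(x)=\gamma_i\,g^{\mathrm{KL}}_\xi(c_ix+\xi)$,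 where $g_\xi^{\mathrm{KL}}(z)=z+\xi\log(\xi/z)-\xi$, $c_i=\min_{j\in\sigma(a_i)}a_{ji}$, $0<\xi\le\min_jb_j$, $\gamma_i>0$ and $\gamma_i>\sum_{j=1}^Ma_{ji}^2y_j/(c_i^2\xi)$. With $d_{\psi_i}(x,x')=\psi_i(x)-\psi_i(x')-\psi_i'(x')(x-x')$, $\alpha_i>0$ is the positive number with $d_{\psi_i}(0,\alpha_i)=\lambda_0$. Relaxation. $B_\Psi(x)=\sum_i\beta_{\psi_i}(x_i)$, $\beta_{\psi_i}(t)=\psi_i(0)-\psi_i(t)+\psi_i'(\alpha_i)t$ for $0\le t\le\alpha_i$, $\beta_{\psi_i}(t)=\lambda_0$ for $t>\alpha_i$; $J_\Psi(x)=F(x)+B_\Psi(x)$ on $\mathbb R_{\ge0}^N$. Both $J_0$ and $J_\Psi$ are minimized over $\mathbb R_{\ge0}^N$. The parameters are chosen so that the concavity condition holds: for every $x$ and $i$, $t\mapsto J_\Psi(x_1,\dots,x_{i-1},t,x_{i+1},\dots,x_N)$ is strictly concave on $(0,\alpha_i)$; known fact: $J_\Psi$ and $J_0$ then have the same global minimizers, and local minimizers of $J_\Psi$ are local minimizers of $J_0$. Critical points. With the convex functions $\mathfrak h_i:=\beta_{\psi_i}+\psi_i$, $x\in\mathbb R_{\ge0}^N$ is a critical point of $J_\Psi$ iff $z=\nabla\Psi(x)-\nabla F(x)$ satisfies $z_i\in\partial\mathfrak h_i(x_i)$ for all $i$, where the subdifferential is given by $\partial\mathfrak h_i(t)=\{\psi_i'(\alpha_i)\}$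 for $0\le t\le\alpha_i$ and $\partial\mathfrak h_i(t)=\{\psi_i'(t)\}$ for $t>\alpha_i$. Oracle. $x^*\in\mathbb R_{\ge0}^N$ is the ground truth, $\sigma^*=\sigma(x^* )$ with elements $\sigma^*[1],\dots,\sigma^*[k^*]$, $k^*=\#\sigma^*$, ${\sigma^*}^c$ its complement, $u^*=x^*_{\sigma^*}$; $A_{\sigma^*}$ (columns in $\sigma^*$) is assumed to have full rank; $F_{\sigma^*}(u)=G_y^{\mathrm{KL}}(A_{\sigma^*}u)$; $u^{\mathrm{or}}=\arg\min_{u\in\mathbb R_{\ge0}^{k^*}}F_{\sigma^*}(u)$ and the oracle solution $x^{\mathrm{or}}$ is $u^{\mathrm{or}}$ padded with zeros outside $\sigma^*$. (BRSC) assumption. $2k^*\le K\le N$; $\mathcal X\subset\mathbb R_{\ge0}^N$ is compact, contains $x^{\mathrm{or}}$ and $x^*$, and its construction does not depend on $x^{\mathrm{or}}$; $C_K>0$ is such that $D_F^{\mathrm{symm}}(x,x')\ge C_KD_\Psi^{\mathrm{symm}}(x,x')$ for all $x\in\mathcal X$, $x'\in\mathbb R_{\ge0}^N$ with $x'\ne x$ and $\|x-x'\|_0\le K$, where $D_H^{\mathrm{symm}}(x,x')=\langle\nabla H(x')-\nabla H(x),x'-x\rangle$. Noise. $y^*=Ax^*+b$, $\varepsilon=y-y^*$, $m(x^* )=\min_{i\in\sigma^*}x_i^*$, $\bar a_j=\sum_{i\in\sigma^*}a_{ji}$, and, for $e,x\ge0$, $$f(e,x)=\sum_{j=1}^M\left((\bar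 a_jx+b_j+e)\log\frac{\bar a_jx+b_j+e}{\bar a_jx+b_j}-e\right).$$ Functions $h_i$. For $i\in\sigma^*$ and $e,x\ge0$ let $E_i(e,x)$ be the right endpoint of the sublevel interval $\{t>0:g_1^{\mathrm{KL}}(t)\le f(e,x)/(\gamma_i\xi C_K)\}$, where $g_1^{\mathrm{KL}}(t)=t-\log t-1$, and write $u_i^*:=x_i^*$. If $C_K<1$: let $g_{1,i}(\alpha)=1-\frac{c_i\alpha}{C_K(c_i\alpha+\xi)}$, with inverse $g_{1,i}^{-1}$, and $$h_i(e,x)=-\frac{\xi}{c_i\,g_{1,i}^{-1}\!\left(\min\left\{1,\frac{\xi E_i(e,x)}{c_iu_i^*+\xi}\right\}\right)+\xi}.$$ If $C_K\ge1$: let $g_{2,i}(\alpha)=\frac1{c_i\alpha+\xi}$, with inverse $g_{2,i}^{-1}$, and $$h_i(e,x)=-\frac{\xi}{c_i\,g_{2,i}^{-1}\!\left(\min\left\{\frac1\xi,\frac{E_i(e,x)}{c_iu_i^*+\xi}\right\}\right)+\xi}.$$ *)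

theory Defs
  imports "HOL-Analysis.Analysis"
begin

text \<open>
  Conventions: \<open>A :: real^'n^'m\<close> has \<open>M = CARD('m)\<close> rows and \<open>N = CARD('n)\<close> columns, so
  \<open>A $ j $ i\<close> is $a_{ji}$.  The order on vectors is componentwise: \<open>{0..}\<close> is the closed
  nonnegative orthant.  The support $\sigma^*$ is enumerated by an injection
  \<open>\<sigma> :: 'k \<Rightarrow> 'n\<close>, where \<open>k* = CARD('k)\<close> and \<open>\<sigma> l\<close> is $\sigma^*[l]$.
\<close>

definition supp :: "real^'n \<Rightarrow> 'n set" where
  "supp x = {i. x $ i \<noteq> 0}"

definition l0norm :: "real^'n \<Rightarrow> nat" where
  "l0norm x = card (supp x)"

definition gradient :: "('a::real_inner \<Rightarrow> real) \<Rightarrow> 'a \<Rightarrow> 'a" where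
  "gradient f x = (THE d. GDERIV f x :> d)"

definition strictly_concave_on :: "real set \<Rightarrow> (real \<Rightarrow> real) \<Rightarrow> bool" where
  "strictly_concave_on S f \<longleftrightarrow> convex S \<and>
     (\<forall>s\<in>S. \<forall>t\<in>S. \<forall>\<theta>. s \<noteq> t \<longrightarrow> 0 < \<theta> \<longrightarrow> \<theta> < 1 \<longrightarrow>
        (1 - \<theta>) * f s + \<theta> * f t < f ((1 - \<theta>) * s + \<theta> * t))"

definition sym_bregman :: "('a::real_inner \<Rightarrow> real) \<Rightarrow> 'a \<Rightarrow> 'a \<Rightarrow> real" where
  "sym_bregman H x x' = (gradient H x' - gradient H x) \<bullet> (x' - x)"

definition bregman1 :: "(real \<Rightarrow> real) \<Rightarrow> real \<Rightarrow> real \<Rightarrow> real" where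
  "bregman1 \<psi> x x' = \<psi> x - \<psi> x' - deriv \<psi> x' * (x - x')"


subsection \<open>Poisson data fidelity\<close>

text \<open>For \<open>y = 0\<close> the product \<open>y * ln (y / z)\<close> is \<open>0\<close>, the usual convention.\<close>

definition gKL :: "real \<Rightarrow> real \<Rightarrow> real" where
  "gKL y z = z + y * ln (y / z) - y"

definition GKL :: "nat^'m \<Rightarrow> real^'m \<Rightarrow> real^'m \<Rightarrow> real" where
  "GKL y b w = (\<Sum>j\<in>UNIV. gKL (real (y $ j)) (w $ j + b $ j))"

definition Fid :: "real^'n^'m \<Rightarrow> nat^'m \<Rightarrow> real^'m \<Rightarrow> real^'n \<Rightarrow> real" where
  "Fid A y b x = GKL y b (A *v x)"

definition J0 :: "real^'n^'m \<Rightarrow> nat^'m \<Rightarrow> real^'m \<Rightarrow> real \<Rightarrow> real^'n \<Rightarrow> real" where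
  "J0 A y b lam x = Fid A y b x + lam * real (l0norm x)"


subsection \<open>KL generating function, relaxation and critical points\<close>

definition cmin :: "real^'n^'m \<Rightarrow> 'n \<Rightarrow> real" where
  "cmin A i = Min {A $ j $ i | j. A $ j $ i \<noteq> 0}"

definition psi :: "real^'n^'m \<Rightarrow> real \<Rightarrow> real^'n \<Rightarrow> 'n \<Rightarrow> real \<Rightarrow> real" where
  "psi A \<xi> \<gamma> i t = \<gamma> $ i * gKL \<xi> (cmin A i * t + \<xi>)"

definition Psi :: "real^'n^'m \<Rightarrow> real \<Rightarrow> real^'n \<Rightarrow> real^'n \<Rightarrow> real" where
  "Psi A \<xi> \<gamma> x = (\<Sum>i\<in>UNIV. psi A \<xi> \<gamma> i (x $ i))"

definition beta :: "(real \<Rightarrow> real) \<Rightarrow> real \<Rightarrow> real \<Rightarrow> real \<Rightarrow> real" where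
  "beta \<psi> \<alpha> lam t = (if t \<le> \<alpha> then \<psi> 0 - \<psi> t + deriv \<psi> \<alpha> * t else lam)"

definition JPsi ::
  "real^'n^'m \<Rightarrow> nat^'m \<Rightarrow> real^'m \<Rightarrow> real \<Rightarrow> real^'n \<Rightarrow> real^'n \<Rightarrow> real \<Rightarrow> real^'n \<Rightarrow> real" where
  "JPsi A y b \<xi> \<gamma> \<alpha> lam x =
     Fid A y b x + (\<Sum>i\<in>UNIV. beta (psi A \<xi> \<gamma> i) (\<alpha> $ i) lam (x $ i))"

text \<open>
  \<open>subdiff_h \<psi> \<alpha> t\<close> is the subdifferential at \<open>t \<ge> 0\<close> of \<open>beta \<psi> \<alpha> lam + \<psi>\<close>; at
  \<open>t = 0\<close> this function is understood to be continued affinely to the left, so no normal cone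
  of the constraint \<open>t \<ge> 0\<close> appears.
\<close>

definition subdiff_h :: "(real \<Rightarrow> real) \<Rightarrow> real \<Rightarrow> real \<Rightarrow> real set" where
  "subdiff_h \<psi> \<alpha> t = (if t \<le> \<alpha> then {deriv \<psi> \<alpha>} else {deriv \<psi> t})"

definition critical_point ::
  "real^'n^'m \<Rightarrow> nat^'m \<Rightarrow> real^'m \<Rightarrow> real \<Rightarrow> real^'n \<Rightarrow> real^'n \<Rightarrow> real^'n \<Rightarrow> bool" where
  "critical_point A y b \<xi> \<gamma> \<alpha> x \<longleftrightarrow> 0 \<le> x \<and>
     (\<forall>i. (gradient (Psi A \<xi> \<gamma>) x - gradient (Fid A y b) x) $ i
            \<in> subdiff_h (psi A \<xi> \<gamma> i) (\<alpha> $ i) (x $ i))"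


subsection \<open>Oracle and safe oracle region\<close>

definition restrict_vec :: "('k \<Rightarrow> 'n) \<Rightarrow> real^'n \<Rightarrow> real^'k" where
  "restrict_vec \<sigma> x = (\<chi> l. x $ \<sigma> l)"

definition restrict_cols :: "('k \<Rightarrow> 'n) \<Rightarrow> real^'n^'m \<Rightarrow> real^'k^'m" where
  "restrict_cols \<sigma> A = (\<chi> j l. A $ j $ \<sigma> l)"

definition pad_vec :: "('k \<Rightarrow> 'n) \<Rightarrow> real^'k \<Rightarrow> real^'n" where
  "pad_vec \<sigma> u = (\<chi> i. if i \<in> range \<sigma> then u $ inv \<sigma> i else 0)"

definition safe_region ::
  "real^'n^'m \<Rightarrow> nat^'m \<Rightarrow> real^'m \<Rightarrow> real \<Rightarrow> real^'n \<Rightarrow> real \<Rightarrow> ('k \<Rightarrow> 'n) \<Rightarrow> real^'n \<Rightarrow> (real^'k) set"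
  where
  "safe_region A y b \<xi> \<gamma> C \<sigma> xs = {u. 0 \<le> u \<and>
     (\<Sum>l\<in>UNIV. \<gamma> $ \<sigma> l *
        gKL 1 ((cmin A (\<sigma> l) * restrict_vec \<sigma> xs $ l + \<xi>) / (cmin A (\<sigma> l) * u $ l + \<xi>)))
       \<le> Fid (restrict_cols \<sigma> A) y b (restrict_vec \<sigma> xs) / (\<xi> * C)}"


subsection \<open>The functions $f$ and $h_i$\<close>

text \<open>Below, \<open>S\<close> is the support $\sigma^*$ of the ground truth.\<close>

definition abar :: "real^'n^'m \<Rightarrow> 'n set \<Rightarrow> 'm \<Rightarrow> real" where
  "abar A S j = (\<Sum>i\<in>S. A $ j $ i)"

definition fnoise :: "real^'n^'m \<Rightarrow> real^'m \<Rightarrow> 'n set \<Rightarrow> real \<Rightarrow> real \<Rightarrow> real" where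
  "fnoise A b S e x =
     (\<Sum>j\<in>UNIV. (abar A S j * x + b $ j + e) *
        ln ((abar A S j * x + b $ j + e) / (abar A S j * x + b $ j)) - e)"

definition minpos :: "'n set \<Rightarrow> real^'n \<Rightarrow> real" where
  "minpos S x = Min ((\<lambda>i. x $ i) ` S)"

definition E_end ::
  "real^'n^'m \<Rightarrow> real^'m \<Rightarrow> 'n set \<Rightarrow> real \<Rightarrow> real^'n \<Rightarrow> real \<Rightarrow> 'n \<Rightarrow> real \<Rightarrow> real \<Rightarrow> real" where
  "E_end A b S \<xi> \<gamma> C i e x =
     Sup {t. 0 < t \<and> gKL 1 t \<le> fnoise A b S e x / (\<gamma> $ i * \<xi> * C)}"

definition g1 :: "real \<Rightarrow> real \<Rightarrow> real \<Rightarrow> real \<Rightarrow> real" where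
  "g1 c \<xi> C a = 1 - c * a / (C * (c * a + \<xi>))"

definition g2 :: "real \<Rightarrow> real \<Rightarrow> real \<Rightarrow> real" where
  "g2 c \<xi> a = 1 / (c * a + \<xi>)"

text \<open>
  The value $u_i^* = x_i^*$, on which $h_i$ also depends, is the explicit argument \<open>u\<close>; it has
  to vary together with \<open>x\<close> in the regime $m(x^*)\to\infty$.
\<close>

definition hfun ::
  "real^'n^'m \<Rightarrow> real^'m \<Rightarrow> 'n set \<Rightarrow> real \<Rightarrow> real^'n \<Rightarrow> real \<Rightarrow> 'n \<Rightarrow> real \<Rightarrow> real \<Rightarrow> real \<Rightarrow> real"
  where
  "hfun A b S \<xi> \<gamma> C i u e x =
     (let c = cmin A i; E = E_end A b S \<xi> \<gamma> C i e x in
      if C < 1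
      then - \<xi> / (c * inv_into {0..} (g1 c \<xi> C) (min 1 (\<xi> * E / (c * u + \<xi>))) + \<xi>)
      else - \<xi> / (c * inv_into {0..} (g2 c \<xi>) (min (1 / \<xi>) (E / (c * u + \<xi>))) + \<xi>))"


subsection \<open>The bounds on $\lambda_0$\<close>

text \<open>
  In the lower bound the argument of the logarithm may fail to be positive; then
  $-\log$ is read as $+\infty$, so that no $\lambda_0$ exceeds the bound.  (The library's
  \<open>ln\<close> is even on the reals and would give a spurious finite value.)
\<close>

definition neg_log :: "real \<Rightarrow> ereal" where
  "neg_log t = (if t \<le> 0 then \<infinity> else ereal (- ln t))"

definition Lambda_lower ::
  "real^'n^'m \<Rightarrow> real^'m \<Rightarrow> 'n set \<Rightarrow> real \<Rightarrow> real^'n \<Rightarrow> real \<Rightarrow> nat \<Rightarrow> real \<Rightarrow> real \<Rightarrow> real \<Rightarrow> ereal"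
  where
  "Lambda_lower A b S \<xi> \<gamma> C K Lt e m =
     max (ereal (fnoise A b S e m / (1 + real K - 2 * real (card S))))
         (Max ((\<lambda>i. ereal (\<gamma> $ i * \<xi>) *
                  neg_log (1 - norm (column i A) * sqrt (2 * Lt * fnoise A b S e m)
                               / (min C 1 * \<gamma> $ i * cmin A i))) ` (- S)))"

definition Lambda_upper ::
  "real^'n^'m \<Rightarrow> real^'m \<Rightarrow> 'n set \<Rightarrow> real \<Rightarrow> real^'n \<Rightarrow> real \<Rightarrow> real^'n \<Rightarrow> real \<Rightarrow> real \<Rightarrow> real" where
  "Lambda_upper A b S \<xi> \<gamma> C xs e m =
     Min ((\<lambda>i. - \<gamma> $ i * \<xi> * (ln (1 - exp (hfun A b S \<xi> \<gamma> C i (xs $ i) e m)) + 1)) ` S)"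

end

theory Submission
  imports Defs
begin

text \<open>A one-coordinate move in (BRSC) gives \<open>C\<^sub>K < 1\<close>. Integrating (BRSC) at \<open>x\<^sup>*\<close> and at
  \<open>x\<^sup>o\<^sup>r\<close> along segments turns the symmetric Bregman inequality into
  \<open>D\<^sub>F \<ge> C\<^sub>K D\<^sub>\<Psi>\<close>, and minimality of the oracle yields the energy bound
  \<open>\<xi> C\<^sub>K \<Sum>\<^sub>i \<gamma>\<^sub>i g\<^sub>1((c\<^sub>i x\<^sup>*\<^sub>i + \<xi>) / (c\<^sub>i x\<^sup>o\<^sup>r\<^sub>i + \<xi>)) \<le> F(x\<^sup>*) - F(x\<^sup>o\<^sup>r)\<close>.

  The tempting estimate \<open>F(x\<^sup>*) \<le> f(\<parallel>\<epsilon>\<parallel>\<^sub>\<infinity>, m(x\<^sup>*))\<close> only holds up to a third-order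
  term, because negative noise costs more than positive noise of the same size. The defect is
  compensated as follows. If \<open>e = \<parallel>\<epsilon>\<parallel>\<^sub>\<infinity> / \<xi> \<ge> 3/5\<close>, then (BRSC) along an off-support column together with
  the lower bound on \<open>\<lambda>\<^sub>0\<close> shows that rows not touched by the support carry a definite
  share of \<open>f\<close>; these rows cancel in \<open>F(x\<^sup>*) - F(x\<^sup>o\<^sup>r)\<close>. If \<open>e < 3/5\<close>, then the defect is of third order and is
  absorbed by the gap between \<open>-log(1 - e\<^bsup>h\<^esup>) - 1\<close> and the value that is actually needed.

  Consequently \<open>\<psi>\<^sub>i'(\<alpha>\<^sub>i) < C\<^sub>K \<psi>\<^sub>i'(x\<^sup>o\<^sup>r\<^sub>i)\<close> on the support and
  \<open>-\<partial>\<^sub>iF(x\<^sup>o\<^sup>r) < C\<^sub>K \<psi>\<^sub>i'(\<alpha>\<^sub>i)\<close> off it. With \<open>D\<^sub>F \<ge> C\<^sub>K D\<^sub>\<Psi>\<close> this makes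
  \<open>x\<^sup>o\<^sup>r\<close> beat every point within distance \<open>K\<close>, and with the symmetric inequality it excludes other
  critical points there. Any remaining competitor can be rounded, by concavity in each coordinate,
  to entries in \<open>{0} \<union> [\<alpha>\<^sub>i, \<infinity>)\<close>; having more than \<open>k\<^sup>*\<close> nonzero entries it loses
  because \<open>F(x\<^sup>o\<^sup>r) \<le> F(x\<^sup>*) < \<lambda>\<^sub>0\<close>.\<close>

section \<open>Kullback--Leibler estimates\<close>

text \<open>Data \<open>s(1 - d)\<close> cost \<open>s(d^2/2 + d^3/6 + ...)\<close>, data
  \<open>s(1 + d)\<close> only \<open>s(d^2/2 - d^3/6 + ...)\<close>; the defect is thus a factor of
  about \<open>1 - 2d/3\<close>. With \<open>r = \<xi> / (c \<alpha> + \<xi>)\<close> one has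
  \<open>lam = \<gamma> \<xi> (r - 1 - log r)\<close>, and the upper bound reads
  \<open>1 - exp h < r exp(-r)\<close>. As \<open>r exp(-r)\<close> is at most \<open>1/e\<close>,
  this confines \<open>-h\<close> to below \<open>23/50\<close>, and hence, for a normalised signal
  \<open>u\<close>, \<open>C u / (1 + u)\<close> to above \<open>27/50\<close>. The other rational
  constants descend from these two. On the support one needs a ratio formed with the actual oracle
  to stay below \<open>r\<close>; the upper bound leaves a slack of order \<open>h^2/2\<close> for
  it. Off the support, the usual bound of a partial derivative by \<open>norm a sqrt(2 L F)\<close>
  would need the fidelity to be at most \<open>f\<close>. What survives is \<open>157/100 f\<close>
  on the rows that pull upwards, and a quadratic bound is too weak for that factor when
  \<open>r\<close> is near 0. So the derivative is bounded by Fenchel duality: the conjugate of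
  \<open>w - log(1 + w)\<close> is \<open>- log(1 - x) - x\<close>, the very function of
  \<open>x = 1 - r\<close> that gives \<open>lam / (\<gamma> \<xi>)\<close>.\<close>

definition phi :: "real \<Rightarrow> real \<Rightarrow> real" where
  "phi s e = (s + e) * ln ((s + e) / s) - e"

lemma nonneg_by_deriv:
  fixes f f' :: "real \<Rightarrow> real"
  assumes "a \<le> x" "0 \<le> f a"
    and "\<And>t. a \<le> t \<Longrightarrow> t \<le> x \<Longrightarrow> (f has_real_derivative f' t) (at t)"
    and "\<And>t. a \<le> t \<Longrightarrow> t \<le> x \<Longrightarrow> 0 \<le> f' t"
  shows "0 \<le> f x"
  using DERIV_nonneg_imp_nondecreasing[OF assms(1), of f] assms(2-4) by force

lemma gKL_1: "0 < t \<Longrightarrow> gKL 1 t = t - 1 - ln t"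
  by (simp add: gKL_def ln_div)

lemma gKL_0: "gKL 0 z = z"
  by (simp add: gKL_def)

lemma gKL_pos: "0 < y \<Longrightarrow> 0 < z \<Longrightarrow> gKL y z = y * gKL 1 (z / y)"
  by (simp add: gKL_def algebra_simps)

lemma gKL_1_nonneg: "0 < t \<Longrightarrow> 0 \<le> gKL 1 t"
  using ln_le_minus_one[of t] by (simp add: gKL_1)

lemma gKL_nonneg: "0 \<le> y \<Longrightarrow> 0 < z \<Longrightarrow> 0 \<le> gKL y z"
  using gKL_pos[of y z] gKL_1_nonneg[of "z / y"] by (cases "y = 0") (auto simp: gKL_0)

lemma gKL_1_mono: "1 \<le> s \<Longrightarrow> s \<le> t \<Longrightarrow> gKL 1 s \<le> gKL 1 t"
proof -
  assume a: "1 \<le> s" "s \<le> t"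
  have "ln (t / s) \<le> t / s - 1" using a by (intro ln_le_minus_one) auto
  also have "t / s - 1 = (t - s) / s" using a by (simp add: field_simps)
  also have "\<dots> \<le> t - s" using a by (simp add: divide_le_eq mult_le_cancel_left1)
  finally show ?thesis using a by (simp add: gKL_1 ln_div)
qed

lemma gKL_1_scaled_ln: "0 < y \<Longrightarrow> 0 < s \<Longrightarrow> 0 < s' \<Longrightarrow>
    gKL y s - gKL y s' = s - s' - y * ln (s / s')"
  by (simp add: gKL_def ln_div algebra_simps)

lemma gKL_diff: "0 \<le> y \<Longrightarrow> 0 < s \<Longrightarrow> 0 < s' \<Longrightarrow>
    gKL y s - gKL y s' = s - s' - y * ln (s / s')"
  by (cases "y = 0") (auto simp: gKL_0 gKL_1_scaled_ln)

lemma ln_one_plus_ge: "0 \<le> (x::real) \<Longrightarrow> x / (1 + x) \<le> ln (1 + x)"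
  using ln_le_minus_one[of "1 / (1 + x)"] by (simp add: ln_div field_simps)

text \<open>Bennett's function against its Bernstein minorant: after clearing the denominator, two
  differentiations reduce the claim to \<open>ln (1 + t) \<ge> t / (1 + t)\<close>.\<close>

lemma bernstein_aux:
  fixes d :: real assumes "0 \<le> d"
  shows "3 * d\<^sup>2 / (6 + 2 * d) \<le> (1 + d) * ln (1 + d) - d"
proof -
  have D1: "0 \<le> (8 + 4 * x) * ln (1 + x) - 8 * x" if "0 \<le> x" for x :: real
  proof (rule nonneg_by_deriv[where f = "\<lambda>x. (8 + 4 * x) * ln (1 + x) - 8 * x" and a = 0 and f' = "\<lambda>t. 4 * ln (1 + t) - 4 * (t / (1 + t))"])
    fix t :: real assume t: "0 \<le> t" "t \<le> x"
    have "(8 + 4 * t) / (1 + t) - 8 = - 4 * (t / (1 + t))" using t by (simp add: field_simps)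
    then show "((\<lambda>x. (8 + 4 * x) * ln (1 + x) - 8 * x) has_real_derivative
      4 * ln (1 + t) - 4 * (t / (1 + t))) (at t)"
      using t by (auto intro!: derivative_eq_intros)
    show "0 \<le> 4 * ln (1 + t) - 4 * (t / (1 + t))" using ln_one_plus_ge[OF t(1)] by simp
  qed (use that in auto)
  have "0 \<le> (6 + 2 * d) * ((1 + d) * ln (1 + d) - d) - 3 * d\<^sup>2"
  proof (rule nonneg_by_deriv[where f = "\<lambda>d. (6 + 2 * d) * ((1 + d) * ln (1 + d) - d) - 3 * d\<^sup>2" and a = 0 and f' = "\<lambda>t. (8 + 4 * t) * ln (1 + t) - 8 * t"])
    fix t :: real assume t: "0 \<le> t" "t \<le> d"
    then show "((\<lambda>d. (6 + 2 * d) * ((1 + d) * ln (1 + d) - d) - 3 * d\<^sup>2) has_real_derivative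
      (8 + 4 * t) * ln (1 + t) - 8 * t) (at t)"
      by (auto intro!: derivative_eq_intros) (simp add: algebra_simps)
    show "0 \<le> (8 + 4 * t) * ln (1 + t) - 8 * t" by (rule D1) (use t in auto)
  qed (use assms in auto)
  then show ?thesis using assms by (simp add: pos_divide_le_eq mult.commute)
qed

lemma phi_scale: "0 < s \<Longrightarrow> phi s e = s * ((1 + e / s) * ln (1 + e / s) - e / s)"
  by (simp add: phi_def field_simps)

lemma phi_ge:
  assumes a: "0 < s" "0 \<le> e"
  shows "e\<^sup>2 / (2 * s + 2 / 3 * e) \<le> phi s e"
proof -
  define d where "d = e / s"
  define P where "P = (1 + d) * ln (1 + d) - d"
  have d: "e = d * s" "0 \<le> d" using a by (auto simp: d_def)
  have "3 * d\<^sup>2 \<le> P * (6 + 2 * d)"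
    using bernstein_aux[OF d(2)] d(2) by (simp add: P_def pos_divide_le_eq)
  then have "s\<^sup>2 / 3 * (3 * d\<^sup>2) \<le> s\<^sup>2 / 3 * (P * (6 + 2 * d))"
    by (intro mult_left_mono) auto
  then have "e\<^sup>2 \<le> s * P * (2 * s + 2 / 3 * e)"
    by (simp add: d(1) power2_eq_square algebra_simps)
  moreover have "phi s e = s * P" using a by (simp add: phi_scale d_def P_def)
  moreover have "0 < 2 * s + 2 / 3 * e" using a by simp
  ultimately show ?thesis by (simp add: pos_divide_le_eq)
qed

lemma phi_nonneg: "0 < s \<Longrightarrow> 0 \<le> e \<Longrightarrow> 0 \<le> phi s e"
  by (rule order_trans[OF _ phi_ge]) auto

lemma phi_mono: "0 < s \<Longrightarrow> 0 \<le> e \<Longrightarrow> e \<le> e' \<Longrightarrow> phi s e \<le> phi s e'"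
proof -
  assume a: "0 < s" "0 \<le> e" "e \<le> e'"
  have "phi s e \<le> phi s e'"
  proof (rule DERIV_nonneg_imp_nondecreasing[OF a(3)])
    fix t assume t: "e \<le> t" "t \<le> e'"
    have "(phi s has_real_derivative ln ((s + t) / s)) (at t)"
      unfolding phi_def[abs_def] using a t by (auto intro!: derivative_eq_intros)
    then show "\<exists>y. (phi s has_real_derivative y) (at t) \<and> 0 \<le> y"
      using a t by (intro exI[of _ "ln ((s + t) / s)"]) auto
  qed
  then show ?thesis .
qed

text \<open>With \<open>q = (s + e) / s\<close> the derivative in \<open>s\<close> is
  \<open>log q + 1 - q\<close>. This allows \<open>f\<close> to be formed with the smallest entry of
  the ground truth: the true intensities are larger, and there the same noise costs less.\<close>

lemma phi_antimono: "0 < s \<Longrightarrow> s \<le> s' \<Longrightarrow> 0 \<le> e \<Longrightarrow> phi s' e \<le> phi s e"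
proof -
  assume a: "0 < s" "s \<le> s'" "0 \<le> e"
  show ?thesis
  proof (rule DERIV_nonpos_imp_nonincreasing[OF a(2)])
    fix t assume t: "s \<le> t" "t \<le> s'"
    have "((\<lambda>t. (t + e) * (ln (t + e) - ln t) - e) has_real_derivative (ln (t + e) - ln t) + (t + e) * (1 / (t + e) - 1 / t)) (at t)"
      using a t by (auto intro!: derivative_eq_intros)
    then have D: "((\<lambda>t. phi t e) has_real_derivative (ln (t + e) - ln t) + (t + e) * (1 / (t + e) - 1 / t)) (at t)"
    proof (rule has_field_derivative_transform_within_open[of _ _ _ "{0<..}"])
      fix x :: real assume "x \<in> {0<..}"
      then show "(x + e) * (ln (x + e) - ln x) - e = phi x e" using a by (simp add: phi_def ln_div)
    qed (use a t in auto)
    have *: "(ln A - ln t) + A * (1 / A - 1 / t) \<le> 0" if "0 < A" for A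
      using ln_le_minus_one[of "A / t"] a t that by (simp add: right_diff_distrib ln_div)
    have "(ln (t + e) - ln t) + (t + e) * (1 / (t + e) - 1 / t) \<le> 0"
      by (rule *) (use a t in simp)
    with D show "\<exists>y. ((\<lambda>t. phi t e) has_real_derivative y) (at t) \<and> y \<le> 0" by blast
  qed
qed

lemma gKL_eq_phi: "0 < y \<Longrightarrow> 0 < s \<Longrightarrow> gKL y s = phi s (y - s)"
  by (simp add: phi_def gKL_def algebra_simps)

lemma gKL_le_phi: "0 < s \<Longrightarrow> s \<le> y \<Longrightarrow> y - s \<le> e \<Longrightarrow> gKL y s \<le> phi s e"
  by (simp add: gKL_eq_phi phi_mono)

lemma neg_ln_one_minus_ge4:
  fixes x :: real assumes "0 \<le> x" "x < 1"
  shows "x + x\<^sup>2 / 2 + x ^ 3 / 3 + x ^ 4 / 4 \<le> - ln (1 - x)"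
proof -
  have "0 \<le> - ln (1 - x) - (x + x\<^sup>2 / 2 + x ^ 3 / 3 + x ^ 4 / 4)"
  proof (rule nonneg_by_deriv[where f = "\<lambda>x. - ln (1 - x) - (x + x\<^sup>2 / 2 + x ^ 3 / 3 + x ^ 4 / 4)" and a = 0 and f' = "\<lambda>t. 1 / (1 - t) - (1 + t + t\<^sup>2 + t ^ 3)"])
    fix t assume t: "0 \<le> t" "t \<le> x"
    then show "((\<lambda>x. - ln (1 - x) - (x + x\<^sup>2 / 2 + x ^ 3 / 3 + x ^ 4 / 4)) has_real_derivative
      1 / (1 - t) - (1 + t + t\<^sup>2 + t ^ 3)) (at t)"
      using assms by (auto intro!: derivative_eq_intros simp: field_simps)
    have "(1 + t + t\<^sup>2 + t ^ 3) * (1 - t) = 1 - t ^ 4" by (simp add: algebra_simps power_numeral_reduce)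
    also have "\<dots> \<le> 1" using t by simp
    finally show "0 \<le> 1 / (1 - t) - (1 + t + t\<^sup>2 + t ^ 3)" using t assms by (simp add: field_simps)
  qed (use assms in auto)
  then show ?thesis by simp
qed

text \<open>\<open>x + (1 - x) log(1 - x)\<close> is the cost of a relative loss \<open>x\<close>;
  the right side is the Bernstein minorant of the cost of an equal gain. Comparison of the cubic
  coefficients, \<open>1/6 - k/2\<close> against \<open>-1/6\<close>, shows that \<open>2/3\<close>
  is the smallest possible \<open>k\<close> in a factor \<open>1 - k x\<close>.\<close>

lemma kl_bound_neg:
  fixes x :: real assumes "0 \<le> x" "x \<le> 1"
  shows "(1 - 2 / 3 * x) * (x + (1 - x) * ln (1 - x)) \<le> 3 * x\<^sup>2 / (6 + 2 * x)"
proof -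
  define M where "M = x + (1 - x) * ln (1 - x)"
  define N where "N = 6 * x\<^sup>2 + 2 * x ^ 3 + x ^ 4 + 3 * x ^ 5"
  have 1: "12 * M \<le> N"
  proof (cases "x = 1")
    case False
    then have "(1 - x) * (12 * (x + x\<^sup>2 / 2 + x ^ 3 / 3 + x ^ 4 / 4)) \<le> (1 - x) * (12 * (- ln (1 - x)))"
      using assms by (intro mult_left_mono neg_ln_one_minus_ge4) auto
    moreover have "12 * (x + x\<^sup>2 / 2 + x ^ 3 / 3 + x ^ 4 / 4) = 12 * x + 6 * x\<^sup>2 + 4 * x ^ 3 + 3 * x ^ 4"
      by simp
    moreover have "12 * x - (1 - x) * (12 * x + 6 * x\<^sup>2 + 4 * x ^ 3 + 3 * x ^ 4) = N"
      unfolding N_def by (simp add: algebra_simps power_numeral_reduce)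
    moreover have "12 * M = 12 * x - (1 - x) * (12 * (- ln (1 - x)))"
      by (simp add: M_def algebra_simps)
    ultimately show ?thesis by simp
  qed (simp add: N_def M_def)
  have p: "- 18 + 40 * x - 22 * x\<^sup>2 - 12 * x ^ 3 \<le> 0"
  proof -
    have "0 \<le> (2 * x - 1)\<^sup>2 * (x + 1)" using assms by simp
    then have "0 \<le> 4 * x ^ 3 - 3 * x + 1" by (simp add: algebra_simps power_numeral_reduce)
    moreover have "0 \<le> (10 * x - 7)\<^sup>2" by simp
    then have "0 \<le> 100 * x\<^sup>2 - 140 * x + 49" by (simp add: algebra_simps power2_eq_square)
    ultimately show ?thesis using assms by linarith
  qed
  have "(3 - 2 * x) * (12 * M) \<le> (3 - 2 * x) * N"
    using assms by (intro mult_left_mono 1) auto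
  then have "(3 - 2 * x) * (12 * M) * (6 + 2 * x) \<le> (3 - 2 * x) * N * (6 + 2 * x)"
    using assms by (intro mult_right_mono) auto
  also have "\<dots> = 108 * x\<^sup>2 + x^4 * (- 18 + 40 * x - 22 * x\<^sup>2 - 12 * x ^ 3)"
    unfolding N_def by (simp add: algebra_simps power_numeral_reduce)
  also have "\<dots> \<le> 108 * x\<^sup>2" using p by (simp add: mult_nonneg_nonpos)
  finally have "36 * ((1 - 2 / 3 * x) * M * (6 + 2 * x)) \<le> 36 * (3 * x\<^sup>2)" by (simp add: field_simps)
  then have "(1 - 2 / 3 * x) * M * (6 + 2 * x) \<le> 3 * x\<^sup>2" by (simp add: mult_ac)
  then show ?thesis unfolding M_def[symmetric] using assms by (simp add: pos_le_divide_eq)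
qed

lemma gKL_le_phi_neg:
  assumes "0 < s" "0 \<le> y" "y \<le> s" "s - y \<le> e"
  shows "(1 - 2 / 3 * min 1 (e / s)) * gKL y s \<le> phi s e"
proof -
  define x where "x = (s - y) / s"
  define M where "M = x + (1 - x) * ln (1 - x)"
  have x: "0 \<le> x" "x \<le> 1" and xe: "x \<le> min 1 (e / s)"
    using assms by (auto simp: x_def divide_le_eq divide_right_mono)
  have y: "y = s * (1 - x)" using assms by (simp add: x_def field_simps)
  have g: "gKL y s = s * M"
  proof (cases "y = 0")
    case True
    then have "x = 1" using assms by (simp add: x_def)
    then show ?thesis using True by (simp add: gKL_0 M_def)
  next
    case False
    have "gKL y s = s - y + y * ln (y / s)" by (simp add: gKL_def)
    also have "y / s = 1 - x" using assms by (simp add: y)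
    also have "s - y = s * x" by (simp add: y algebra_simps)
    finally show ?thesis by (simp add: y M_def algebra_simps)
  qed
  have M0: "0 \<le> M"
    using gKL_nonneg[OF assms(2,1)] assms(1) by (simp add: g zero_le_mult_iff)
  have "(1 - 2 / 3 * min 1 (e / s)) * gKL y s \<le> s * ((1 - 2 / 3 * x) * M)"
    using xe M0 assms(1) by (simp add: g mult_right_mono)
  also have "\<dots> \<le> s * (3 * x\<^sup>2 / (6 + 2 * x))"
    using kl_bound_neg[OF x] assms(1) by (intro mult_left_mono) (auto simp: M_def)
  also have "\<dots> \<le> s * ((1 + x) * ln (1 + x) - x)"
    using bernstein_aux[OF x(1)] assms(1) by (intro mult_left_mono) auto
  also have "\<dots> = phi s (s - y)" using assms(1) by (simp add: phi_scale x_def)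
  also have "\<dots> \<le> phi s e" using assms by (intro phi_mono) auto
  finally show ?thesis .
qed

lemma gKL_antimono: "0 < z \<Longrightarrow> z \<le> z' \<Longrightarrow> z' \<le> y \<Longrightarrow> gKL y z' \<le> gKL y z"
proof -
  assume a: "0 < z" "z \<le> z'" "z' \<le> y"
  have "z' * (1 - z / z') \<le> y * (1 - z / z')" using a by (intro mult_right_mono) auto
  also have "\<dots> \<le> y * ln (z' / z)"
    using a ln_le_minus_one[of "z / z'"] by (intro mult_left_mono) (auto simp: ln_div)
  finally have "z' - z \<le> y * ln (z' / z)" using a by (simp add: right_diff_distrib)
  then show ?thesis using gKL_diff[of y z' z] a by simp
qed

text \<open>To second order the left side minus the right side is \<open>-(d - z)^2 / 2\<close>, and
  this square absorbs the cubic terms while \<open>d\<close> is small. The limit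
  \<open>553/2000\<close> lies just above \<open>(3/5) / (50/23)\<close>, a bound for the relative
  noise when \<open>e < 3/5\<close>.\<close>

lemma excess_poly:
  fixes z d :: real assumes "0 \<le> z" "z \<le> d" "d \<le> 553 / 2000"
  shows "z * d - (1 - d) * (z\<^sup>2 / 2 + z ^ 3 / 3) \<le> d\<^sup>2 / 2 - d ^ 3 / 6 + 29 / 50 * d * z\<^sup>2"
proof -
  have d: "0 \<le> d" using assms by simp
  \<comment> \<open>Tangent inequality for \<open>z^3\<close> at \<open>z = 83/100 d\<close>, near
    which the two sides come closest when \<open>d\<close> is at its limit.\<close>
  have "0 \<le> (100 * z - 83 * d)\<^sup>2 * (100 * z + 166 * d)" using assms by simp
  then have "0 \<le> 1000000 * z ^ 3 - 2066700 * (d\<^sup>2 * z) + 1143574 * d ^ 3"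
    by (simp add: algebra_simps power_numeral_reduce)
  moreover have "0 \<le> d * (10000 * z - 8258 * d)\<^sup>2" using d by simp
  then have "0 \<le> 100000000 * (d * z\<^sup>2) - 165160000 * (d\<^sup>2 * z) + 68194564 * d ^ 3"
    by (simp add: algebra_simps power_numeral_reduce)
  moreover have "0 \<le> d ^ 3" "0 \<le> z ^ 3" "0 \<le> d\<^sup>2 * z" using assms by auto
  moreover have "d * (d - z)\<^sup>2 \<le> 553 / 2000 * (d - z)\<^sup>2" using assms by (intro mult_right_mono) auto
  then have "d * d\<^sup>2 - 2 * (d\<^sup>2 * z) + d * z\<^sup>2 \<le> 553 / 2000 * (d\<^sup>2 - 2 * (d * z) + z\<^sup>2)"
    by (simp add: algebra_simps power_numeral_reduce)
  moreover have "d * z ^ 3 \<le> 553 / 2000 * z ^ 3" using assms by (intro mult_right_mono) auto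
  ultimately have "300 * (z * d) - (1 - d) * (150 * z\<^sup>2 + 100 * z ^ 3) \<le> 150 * d\<^sup>2 - 50 * d ^ 3 + 174 * (d * z\<^sup>2)"
    by (simp add: algebra_simps power_numeral_reduce)
  then show ?thesis by (simp add: field_simps)
qed

text \<open>Bounds what a mean \<open>s'\<close> below \<open>s\<close> can save. Since
  \<open>y \<ge> s - e\<close>, moving the mean below \<open>s - e\<close> saves nothing more, so
  only the decrease \<open>D\<close>, cut off at \<open>e\<close>, counts. The excess is kept
  proportional to \<open>D\<^sup>2\<close>, not \<open>e\<^sup>2\<close>, so that it can later be
  distributed over the columns that cause the decrease.\<close>

lemma gKL_excess:
  assumes s: "0 < s" "0 < s'" and e: "0 \<le> e" "e \<le> 553 / 2000 * s" and y: "s - e \<le> y" "y \<le> s + e"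
  defines "D \<equiv> max 0 (min (s - s') e)"
  shows "gKL y s - gKL y s' \<le> phi s e + 29 / 50 * e * D\<^sup>2 / s\<^sup>2"
proof -
  have y0: "0 < y" using s e y by linarith
  have n: "0 \<le> 29 / 50 * e * D\<^sup>2 / s\<^sup>2" using e by simp
  consider "s \<le> y" | "y < s" "s \<le> s'" | "y < s" "s' < s" by linarith
  then show ?thesis
  proof cases
    case 1
    then show ?thesis using gKL_le_phi[of s y e] gKL_nonneg[of y s'] s y y0 n by linarith
  next
    case 2
    have "y * ln (s' / s) \<le> y * (s' / s - 1)"
      using s y0 by (intro mult_left_mono ln_le_minus_one) auto
    also have "\<dots> \<le> s * (s' / s - 1)" using 2 s by (intro mult_right_mono) auto
    also have "\<dots> = s' - s" using s by (simp add: right_diff_distrib)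
    finally have "gKL y s - gKL y s' \<le> 0" using gKL_diff[of y s s'] s y0 by (simp add: ln_div algebra_simps)
    then show ?thesis using n phi_nonneg[of s e] s e by linarith
  next
    case 3
    have D: "0 \<le> D" "D \<le> e" "D \<le> s - s'" using 3 e by (auto simp: D_def)
    define z where "z = D / s" define d where "d = e / s"
    have z: "0 \<le> z" "z \<le> d" "d \<le> 553 / 2000" using D s e by (auto simp: z_def d_def divide_right_mono divide_le_eq)
    have 1: "gKL y (s - D) \<le> gKL y s'"
    proof (cases "s - s' \<le> e")
      case True
      then show ?thesis using 3 by (simp add: D_def max_def min_def)
    next
      case False
      then have "D = e" using e by (simp add: D_def)
      then show ?thesis using False y s by (intro gKL_antimono) auto
    qed
    have "0 < s - D" using D s by linarith
    then have "gKL y s - gKL y (s - D) = D - y * ln (s / (s - D))"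
      using gKL_diff[of y s "s - D"] s y0 by simp
    also have "s / (s - D) = 1 / (1 - z)" using s \<open>0 < s - D\<close> by (simp add: z_def field_simps)
    also have "D - y * ln (1 / (1 - z)) \<le> s * z - s * (1 - d) * (z + z\<^sup>2 / 2 + z ^ 3 / 3)"
    proof -
      have "z + z\<^sup>2 / 2 + z ^ 3 / 3 \<le> ln (1 / (1 - z))"
      proof -
        have "ln (1 / (1 - z)) = - ln (1 - z)" using z by (simp add: ln_div)
        then show ?thesis using neg_ln_one_minus_ge4[of z] z zero_le_power[OF z(1), of 4] by linarith
      qed
      moreover have "s * (1 - d) \<le> y" using s y by (simp add: d_def right_diff_distrib)
      moreover have "0 \<le> z + z\<^sup>2 / 2 + z ^ 3 / 3" using z by simp
      ultimately have "s * (1 - d) * (z + z\<^sup>2 / 2 + z ^ 3 / 3) \<le> y * ln (1 / (1 - z))"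
        using y0 by (intro mult_mono) auto
      then show ?thesis using s by (simp add: z_def)
    qed
    also have "\<dots> = s * (z * d - (1 - d) * (z\<^sup>2 / 2 + z ^ 3 / 3))" by (simp add: algebra_simps)
    also have "\<dots> \<le> s * (d\<^sup>2 / 2 - d ^ 3 / 6 + 29 / 50 * d * z\<^sup>2)"
      using excess_poly[OF z] s by (intro mult_left_mono) auto
    also have "\<dots> \<le> phi s e + 29 / 50 * e * D\<^sup>2 / s\<^sup>2"
    proof -
      have "d\<^sup>2 / 2 - d ^ 3 / 6 \<le> 3 * d\<^sup>2 / (6 + 2 * d)"
      proof -
        have "(d\<^sup>2 / 2 - d ^ 3 / 6) * (6 + 2 * d) = 3 * d\<^sup>2 - d ^ 4 / 3" by (simp add: algebra_simps power_numeral_reduce)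
        also have "\<dots> \<le> 3 * d\<^sup>2" by simp
        finally show ?thesis using z by (simp add: pos_le_divide_eq)
      qed
      also have "\<dots> \<le> (1 + d) * ln (1 + d) - d" using bernstein_aux[of d] z by simp
      finally have "s * (d\<^sup>2 / 2 - d ^ 3 / 6) \<le> phi s e" using s by (simp add: phi_scale d_def)
      moreover have "s * (29 / 50 * d * z\<^sup>2) = 29 / 50 * e * D\<^sup>2 / s\<^sup>2"
        using s by (simp add: d_def z_def power_divide)
      ultimately show ?thesis by (simp add: distrib_left)
    qed
    finally show ?thesis using 1 by linarith
  qed
qed

text \<open>Trapezoidal rule for the convex integrand \<open>1/t\<close> on
  \<open>[1, x]\<close>.\<close>

lemma ln_le_trapezoid:
  fixes x :: real assumes "1 \<le> x" shows "ln x \<le> (x - 1 / x) / 2"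
proof -
  have "0 \<le> (x - 1 / x) / 2 - ln x"
  proof (rule nonneg_by_deriv[where a = 1 and f = "\<lambda>x. (x - 1 / x) / 2 - ln x" and f' = "\<lambda>t. (1 + 1 / t\<^sup>2) / 2 - 1 / t"])
    fix t :: real assume t: "1 \<le> t" "t \<le> x"
    then show "((\<lambda>x. (x - 1 / x) / 2 - ln x) has_real_derivative (1 + 1 / t\<^sup>2) / 2 - 1 / t) (at t)"
      by (auto intro!: derivative_eq_intros simp: power2_eq_square)
    have "0 \<le> (1 - 1 / t)\<^sup>2 / 2" by simp
    then show "0 \<le> (1 + 1 / t\<^sup>2) / 2 - 1 / t" by (simp add: power2_eq_square algebra_simps)
  qed (use assms in auto)
  then show ?thesis by simp
qed

lemma gKL_1_ge_sq:
  fixes D S :: real assumes "0 \<le> D" "D < S"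
  shows "D\<^sup>2 / (2 * S\<^sup>2) \<le> gKL 1 (S / (S - D))"
proof -
  have *: "0 \<le> z / (1 - z) + ln (1 - z) - z\<^sup>2 / 2" if z: "0 \<le> z" "z < 1" for z :: real
  proof (rule nonneg_by_deriv[where a = 0 and f = "\<lambda>z. z / (1 - z) + ln (1 - z) - z\<^sup>2 / 2" and f' = "\<lambda>z. z / (1 - z)\<^sup>2 - z"])
    fix t :: real assume t: "0 \<le> t" "t \<le> z"
    have "1 / (1 - t)\<^sup>2 - 1 / (1 - t) = t / (1 - t)\<^sup>2" using t z by (simp add: power2_eq_square divide_simps)
    then show "((\<lambda>z. z / (1 - z) + ln (1 - z) - z\<^sup>2 / 2) has_real_derivative t / (1 - t)\<^sup>2 - t) (at t)"
      using t z by (auto intro!: derivative_eq_intros simp: power2_eq_square)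
    have "t * (1 - t)\<^sup>2 \<le> t" using t z by (intro mult_left_le) (auto simp: power_le_one)
    then show "0 \<le> t / (1 - t)\<^sup>2 - t" using t z by (simp add: pos_le_divide_eq)
  qed (use z in auto)
  define z where "z = D / S"
  have S: "0 < S" using assms by simp
  have z: "0 \<le> z" "z < 1" using assms by (auto simp: z_def)
  have "S / (S - D) = 1 / (1 - z)" using assms by (simp add: z_def field_simps)
  moreover have "1 / (1 - z) - 1 = z / (1 - z)" using z by (simp add: field_simps)
  ultimately have "gKL 1 (S / (S - D)) = z / (1 - z) + ln (1 - z)"
    using z by (simp add: gKL_1 ln_div)
  moreover have "D\<^sup>2 / (2 * S\<^sup>2) = z\<^sup>2 / 2" by (simp add: z_def power_divide)
  ultimately show ?thesis using *[OF z] by linarith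
qed

text \<open>The factor \<open>1 - 1 / R\<close> is kept because for
  \<open>R = (1 + u) / (1 + v)\<close> it equals \<open>(u - v) / (1 + u)\<close>, and the decrease
  \<open>u - v\<close> will cancel.\<close>

lemma gKL_1_diff_ge:
  fixes E R :: real assumes "1 \<le> E" "E \<le> R"
  shows "(R - E) * (1 - 1 / R) / 2 \<le> gKL 1 R - gKL 1 E"
proof -
  define x where "x = R / E"
  have x: "1 \<le> x" using assms by (simp add: x_def)
  have "ln R - ln E \<le> (x - 1 / x) / 2" using ln_le_trapezoid[OF x] assms by (simp add: x_def ln_div)
  also have "\<dots> = ((x - 1) + (1 - 1 / x)) / 2" by simp
  also have "x - 1 \<le> E * (x - 1)" using x assms by (simp add: mult_le_cancel_right1)
  then have "((x - 1) + (1 - 1 / x)) / 2 \<le> (E * (x - 1) + (1 - 1 / x)) / 2" by simp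
  also have "E * (x - 1) = R - E" using assms by (simp add: x_def right_diff_distrib)
  also have "1 - 1 / x = (R - E) / R" using assms by (simp add: x_def field_simps)
  finally show ?thesis using assms by (simp add: gKL_1 field_simps)
qed

section \<open>Numerical consequences of the upper bound on \<open>lam\<close>\<close>

lemma exp_ge_sum: "0 \<le> x \<Longrightarrow> (\<Sum>k<n. x ^ k / fact k) \<le> exp (x::real)"
  unfolding exp_def using summable_exp[of x]
  by (auto intro!: sum_le_suminf simp: divide_inverse mult.commute scaleR_conv_of_real)

text \<open>\<open>r exp(-r)\<close> never exceeds \<open>1/e\<close>, and
  \<open>- log(1 - 1/e) = 0.4587\<close>; rounded up, this is \<open>23/50\<close>.\<close>

lemma rho_bound:
  fixes r \<rho> :: real
  assumes "1 - exp (- \<rho>) < r * exp (- r)"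
  shows "\<rho> < 23 / 50"
proof (rule ccontr)
  assume "\<not> ?thesis"
  then have "exp (- \<rho>) \<le> exp (- (23 / 50))" by simp
  also have "\<dots> = 1 / exp (23 / 50)" by (simp only: exp_minus inverse_eq_divide)
  also have "\<dots> \<le> 1 / (15838 / 10000)" using exp_ge_sum[of "23 / 50" 5]
    by (intro divide_left_mono) (auto simp: eval_nat_numeral fact_numeral)
  finally have 1: "exp (- \<rho>) \<le> 1 / (15838 / 10000)" .
  have "r \<le> exp (r - 1)" using exp_ge_add_one_self[of "r - 1"] by simp
  then have "r * exp (- r) \<le> exp (r - 1) * exp (- r)" by (intro mult_right_mono) auto
  also have "\<dots> = 1 / exp 1" by (simp add: exp_diff exp_minus inverse_eq_divide)
  also have "\<dots> \<le> 1 / (2716 / 1000)" using exp_ge_sum[of 1 6]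
    by (intro divide_left_mono) (auto simp: eval_nat_numeral fact_numeral)
  finally show False using 1 assms by simp
qed

text \<open>As \<open>t exp(-t)\<close> increases on \<open>[0, 1]\<close>, it suffices that
  \<open>rt exp(-rt) \<le> 1 - exp(-\<rho>)\<close>. At \<open>rt = \<rho>\<close> this holds with
  room to spare, because \<open>exp \<rho> - 1\<close> exceeds \<open>\<rho>\<close> by at least
  \<open>\<rho>^2 / 2\<close>; the room pays for an excess \<open>rt - \<rho>\<close> of that order.
  In the application \<open>\<rho>\<close> is \<open>-h\<close> and \<open>rt\<close> is its
  counterpart at the actual oracle.\<close>

lemma ratio_bound:
  fixes r rt \<rho> :: real
  assumes h: "1 - exp (- \<rho>) < r * exp (- r)" and r: "0 < r" and rt: "rt \<le> 1"
    and rho: "0 \<le> \<rho>" and D: "(rt - \<rho>) * (1 - \<rho>) \<le> \<rho>\<^sup>2 / 2"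
  shows "rt < r"
proof (rule ccontr)
  assume n: "\<not> ?thesis"
  have rho': "\<rho> < 23 / 50" by (rule rho_bound[OF h])
  define w where "w = rt - r"
  have w: "0 \<le> w" "w < 1" using n rt r by (auto simp: w_def)
  have "0 \<le> w * (1 - rt)" using w rt by simp
  then have "r \<le> rt * (1 - w)" by (simp add: w_def algebra_simps)
  also have "\<dots> \<le> rt * exp (- w)" using exp_ge_add_one_self[of "- w"] n r by (intro mult_left_mono) auto
  finally have "r * exp (- r) \<le> rt * exp (- w) * exp (- r)" by (intro mult_right_mono) auto
  also have "\<dots> = rt * exp (- rt)" by (simp add: w_def exp_add[symmetric])
  finally have 1: "r * exp (- r) \<le> rt * exp (- rt)" .
  define E where "E = rt - \<rho>"
  have E: "0 < 1 + E" using n r rho' by (simp add: E_def)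
  have "E * (1 - \<rho> - \<rho>\<^sup>2 / 2) \<le> \<rho>\<^sup>2 / 2"
  proof (cases "0 \<le> E")
    case True
    then have "E * (1 - \<rho> - \<rho>\<^sup>2 / 2) \<le> E * (1 - \<rho>)" by (intro mult_left_mono) auto
    then show ?thesis using D by (simp add: E_def)
  next
    case False
    have "\<rho>\<^sup>2 \<le> 1" using rho rho' by (intro power_le_one) auto
    then have "0 \<le> 1 - \<rho> - \<rho>\<^sup>2 / 2" using rho' by linarith
    then have "E * (1 - \<rho> - \<rho>\<^sup>2 / 2) \<le> 0" using False by (simp add: mult_nonpos_nonneg)
    also have "0 \<le> \<rho>\<^sup>2 / 2" by simp
    finally show ?thesis .
  qed
  moreover have "(\<rho> + \<rho>\<^sup>2 / 2) * (1 + E) - rt = \<rho>\<^sup>2 / 2 - E * (1 - \<rho> - \<rho>\<^sup>2 / 2)"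
    by (simp add: E_def field_simps)
  ultimately have "rt \<le> (\<rho> + \<rho>\<^sup>2 / 2) * (1 + E)" by linarith
  also have "\<dots> \<le> (exp \<rho> - 1) * exp E"
  proof (rule mult_mono)
    show "\<rho> + \<rho>\<^sup>2 / 2 \<le> exp \<rho> - 1" using exp_lower_Taylor_quadratic[OF rho] by simp
    show "1 + E \<le> exp E" by (rule exp_ge_add_one_self)
  qed (use E rho in auto)
  finally have "rt * exp (- rt) \<le> (exp \<rho> - 1) * exp E * exp (- rt)" by (intro mult_right_mono) auto
  also have "\<dots> = (exp \<rho> - 1) * exp (- \<rho>)" by (simp add: E_def mult.assoc exp_add[symmetric])
  also have "\<dots> = 1 - exp (- \<rho>)" by (simp add: left_diff_distrib exp_add[symmetric])
  finally show False using 1 h by simp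
qed

section \<open>Conjugate estimates for the gradient off the support\<close>

lemma neg_ln_one_minus_ge6:
  fixes x :: real assumes "0 \<le> x" "x < 1"
  shows "x + x\<^sup>2 / 2 + x ^ 3 / 3 + x ^ 4 / 4 + x ^ 5 / 5 + x ^ 6 / 6 \<le> - ln (1 - x)"
proof -
  have "0 \<le> - ln (1 - x) - (x + x\<^sup>2 / 2 + x ^ 3 / 3 + x ^ 4 / 4 + x ^ 5 / 5 + x ^ 6 / 6)"
  proof (rule nonneg_by_deriv[where f = "\<lambda>x. - ln (1 - x) - (x + x\<^sup>2 / 2 + x ^ 3 / 3 + x ^ 4 / 4 + x ^ 5 / 5 + x ^ 6 / 6)" and a = 0 and f' = "\<lambda>t. 1 / (1 - t) - (1 + t + t\<^sup>2 + t ^ 3 + t ^ 4 + t ^ 5)"])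
    fix t assume t: "0 \<le> t" "t \<le> x"
    then show "((\<lambda>x. - ln (1 - x) - (x + x\<^sup>2 / 2 + x ^ 3 / 3 + x ^ 4 / 4 + x ^ 5 / 5 + x ^ 6 / 6)) has_real_derivative
      1 / (1 - t) - (1 + t + t\<^sup>2 + t ^ 3 + t ^ 4 + t ^ 5)) (at t)"
      using assms by (auto intro!: derivative_eq_intros simp: field_simps)
    have "(1 + t + t\<^sup>2 + t ^ 3 + t ^ 4 + t ^ 5) * (1 - t) = 1 - t ^ 6" by (simp add: algebra_simps power_numeral_reduce)
    also have "\<dots> \<le> 1" using t by simp
    finally show "0 \<le> 1 / (1 - t) - (1 + t + t\<^sup>2 + t ^ 3 + t ^ 4 + t ^ 5)" using t assms by (simp add: field_simps)
  qed (use assms in auto)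
  then show ?thesis by simp
qed

text \<open>\<open>\<tau>\<close> and \<open>\<kappa>\<close> are tied by the lower bound on \<open>\<lambda>\<^sub>0\<close>; already \<open>\<kappa> < \<tau>\<^sup>2\<close> leaves the room that is needed.\<close>

lemma kappa_less_tau_sq:
  fixes \<tau> \<kappa> :: real
  assumes "0 < \<tau>" "\<tau> < 1" "\<kappa> < 1" "- ln (1 - \<kappa>) < - ln (1 - \<tau>) - \<tau>"
  shows "\<kappa> < \<tau>\<^sup>2"
proof -
  have "(1 - \<tau>) * exp \<tau> = exp (ln (1 - \<tau>) + \<tau>)" using assms by (simp add: exp_add)
  also have "\<dots> < exp (ln (1 - \<kappa>))" by (subst exp_less_cancel_iff) (use assms in linarith)
  also have "\<dots> = 1 - \<kappa>" using assms by simp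
  finally have 1: "(1 - \<tau>) * exp \<tau> < 1 - \<kappa>" .
  have "(1 - \<tau>) * (1 + \<tau> + \<tau>\<^sup>2 / 2) \<le> (1 - \<tau>) * exp \<tau>"
    using assms exp_lower_Taylor_quadratic[of \<tau>] by (intro mult_left_mono) auto
  also have "(1 - \<tau>) * (1 + \<tau> + \<tau>\<^sup>2 / 2) = 1 - \<tau>\<^sup>2 + \<tau>\<^sup>2 * (1 - \<tau>) / 2"
    by (simp add: field_simps power2_eq_square)
  moreover have "0 \<le> \<tau>\<^sup>2 * (1 - \<tau>) / 2" using assms by simp
  ultimately show ?thesis using 1 by linarith
qed

text \<open>\<open>157/200\<close> is half the constant of \<open>positive_rows_bound\<close>. For
  \<open>\<kappa> = \<tau>\<^sup>2\<close> near 1 the quadratic term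
  \<open>\<tau>\<^sup>2 / 2\<close> of the right side is too small; the terms up to order six, with
  \<open>n \<ge> 27/50\<close>, raise the total coefficient to \<open>797/1000\<close> against the
  required \<open>785/1000\<close>.\<close>

lemma conjugate_bound:
  fixes \<tau> \<kappa> n :: real
  assumes t: "0 < \<tau>" "\<tau> < 1" and k: "0 \<le> \<kappa>" "\<kappa> \<le> \<tau>\<^sup>2" and n: "27 / 50 \<le> n" "n < 1"
  shows "157 / 200 * n\<^sup>2 * \<kappa>\<^sup>2 < - ln (1 - n * \<tau>) - n * \<tau>"
proof -
  define x where "x = n * \<tau>"
  have x: "0 \<le> x" "x < 1"
    using t n mult_strict_mono[of n 1 \<tau> 1] by (auto simp: x_def)
  have n0: "0 < n" using n by simp
  have n2: "729 / 2500 \<le> n\<^sup>2" using power_mono[of "27/50" n 2] n by (simp add: power2_eq_square)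
  have n3: "19683 / 125000 \<le> n ^ 3" using power_mono[of "27/50" n 3] n by (simp add: power3_eq_cube)
  have n4: "531441 / 6250000 \<le> n ^ 4" using power_mono[of "27/50" n 4] n by (simp add: power_numeral_reduce)
  have "157 / 200 * \<kappa>\<^sup>2 \<le> 157 / 200 * \<tau> ^ 4"
    using power_mono[OF k(2,1), of 2] by simp
  also have "\<dots> < \<tau>\<^sup>2 / 2 + 9 / 50 * \<tau> ^ 3 + 72 / 1000 * \<tau> ^ 4 + 31 / 1000 * \<tau> ^ 5 + 14 / 1000 * \<tau> ^ 6"
  proof -
    have "0 \<le> \<tau>\<^sup>2 * (1 - \<tau>\<^sup>2)\<^sup>2" "0 \<le> \<tau> ^ 3 * (1 - \<tau>)" "0 \<le> \<tau> ^ 4 * (1 - \<tau>)" "0 \<le> \<tau> ^ 5 * (1 - \<tau>)" "0 < \<tau> ^ 4"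
      using t by auto
    then have "785 * \<tau> ^ 4 < 500 * \<tau>\<^sup>2 + 180 * \<tau> ^ 3 + 72 * \<tau> ^ 4 + 31 * \<tau> ^ 5 + 14 * \<tau> ^ 6"
      by (simp add: algebra_simps power_numeral_reduce)
    then show ?thesis by linarith
  qed
  also have "\<dots> \<le> \<tau>\<^sup>2 / 2 + n * \<tau> ^ 3 / 3 + n\<^sup>2 * \<tau> ^ 4 / 4 + n ^ 3 * \<tau> ^ 5 / 5 + n ^ 4 * \<tau> ^ 6 / 6"
  proof -
    have "27 / 50 * \<tau> ^ 3 \<le> n * \<tau> ^ 3" "729 / 2500 * \<tau> ^ 4 \<le> n\<^sup>2 * \<tau> ^ 4"
      "19683 / 125000 * \<tau> ^ 5 \<le> n ^ 3 * \<tau> ^ 5" "531441 / 6250000 * \<tau> ^ 6 \<le> n ^ 4 * \<tau> ^ 6"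
      using t n n2 n3 n4 by (auto intro!: mult_right_mono)
    moreover have "0 \<le> \<tau> ^ 4" "0 \<le> \<tau> ^ 5" "0 \<le> \<tau> ^ 6" using t by auto
    ultimately show ?thesis by linarith
  qed
  finally have "n\<^sup>2 * (157 / 200 * \<kappa>\<^sup>2) < n\<^sup>2 * (\<tau>\<^sup>2 / 2 + n * \<tau> ^ 3 / 3 + n\<^sup>2 * \<tau> ^ 4 / 4 + n ^ 3 * \<tau> ^ 5 / 5 + n ^ 4 * \<tau> ^ 6 / 6)"
    using n0 by (intro mult_strict_left_mono) auto
  also have "\<dots> = x\<^sup>2 / 2 + x ^ 3 / 3 + x ^ 4 / 4 + x ^ 5 / 5 + x ^ 6 / 6"
    by (simp add: x_def field_simps power_numeral_reduce)
  also have "\<dots> \<le> - ln (1 - x) - x" using neg_ln_one_minus_ge6[OF x] by simp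
  finally show ?thesis by (simp add: x_def mult_ac)
qed

text \<open>\<open>X - log(1 + X)\<close> is a concave function of \<open>X\<^sup>2\<close>, with
  slope \<open>1 / (2 (1 + X))\<close> in that variable; the right side is its tangent at
  \<open>Y\<^sup>2\<close>.\<close>

lemma ln_trapezoid_gen:
  fixes X Y :: real assumes "0 \<le> X" "0 \<le> Y"
  shows "X - ln (1 + X) \<le> Y - ln (1 + Y) + (X\<^sup>2 - Y\<^sup>2) / (2 * (1 + Y))"
proof -
  define w where "w = (1 + X) / (1 + Y)"
  have w0: "0 < w" "1 / (1 + Y) \<le> w" using assms by (auto simp: w_def field_simps)
  have X: "X = w * (1 + Y) - 1" using assms by (simp add: w_def)
  have lnw: "ln w = ln (1 + X) - ln (1 + Y)" using assms by (simp add: w_def ln_div)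
  have "(w - 1) - (w - 1)\<^sup>2 * (1 + Y) / 2 \<le> ln w"
  proof (cases "1 \<le> w")
    case True
    have "0 \<le> ln w - ((w - 1) - (w - 1)\<^sup>2 / 2)"
    proof (rule nonneg_by_deriv[where a = 1 and f = "\<lambda>w. ln w - ((w - 1) - (w - 1)\<^sup>2 / 2)" and f' = "\<lambda>t. 1 / t + t - 2"])
      fix t assume t: "1 \<le> t" "t \<le> w"
      then show "((\<lambda>w. ln w - ((w - 1) - (w - 1)\<^sup>2 / 2)) has_real_derivative 1 / t + t - 2) (at t)"
        by (auto intro!: derivative_eq_intros simp: diff_divide_distrib)
      have "0 \<le> (t - 1)\<^sup>2 / t" using t by simp
      then show "0 \<le> 1 / t + t - 2" using t by (simp add: power2_eq_square field_simps)
    qed (use True in auto)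
    moreover have "(w - 1)\<^sup>2 * 1 \<le> (w - 1)\<^sup>2 * (1 + Y)" using assms by (intro mult_left_mono) auto
    ultimately show ?thesis by simp
  next
    case False
    have 1: "ln (1 / w) \<le> (1 / w - w) / 2" using ln_le_trapezoid[of "1 / w"] False w0 by simp
    have "1 / w \<le> 1 + Y" using w0 assms by (simp add: field_simps)
    then have "(w - 1)\<^sup>2 * (1 / w) \<le> (w - 1)\<^sup>2 * (1 + Y)" by (intro mult_left_mono) auto
    moreover have "(w - 1) - (w - 1)\<^sup>2 * (1 / w) / 2 = (w - 1 / w) / 2" using w0 by (simp add: power2_eq_square field_simps)
    ultimately show ?thesis using 1 w0 by (simp add: ln_div)
  qed
  moreover have "(X\<^sup>2 - Y\<^sup>2) / (2 * (1 + Y)) = (X - Y) - ((w - 1) - (w - 1)\<^sup>2 * (1 + Y) / 2)"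
  proof -
    define d where "d = w - 1"
    have Xd: "X = Y + d * (1 + Y)" by (simp add: X d_def algebra_simps)
    have "2 * (X\<^sup>2 - Y\<^sup>2) = (2 * (X - Y) - (2 * d - d\<^sup>2 * (1 + Y))) * (2 * (1 + Y))"
      by (simp add: Xd algebra_simps power2_eq_square)
    then have "X\<^sup>2 - Y\<^sup>2 = ((X - Y) - (d - d\<^sup>2 * (1 + Y) / 2)) * (2 * (1 + Y))"
      by (simp add: field_simps)
    then have "X\<^sup>2 - Y\<^sup>2 = ((X - Y) - ((w - 1) - (w - 1)\<^sup>2 * (1 + Y) / 2)) * (2 * (1 + Y))"
      by (simp only: d_def)
    then show ?thesis using assms by (simp only:) simp
  qed
  ultimately show ?thesis using lnw by linarith
qed

text \<open>The derivatives compare as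
  \<open>a\<^sup>2 t / (1 + a t) \<le> a\<^sup>2 t / (1 + t)\<close>. In this way a matrix entry
  enters only through its square, which is the weight controlled by \<open>g\<close>.\<close>

lemma psi0_scale:
  fixes a w :: real assumes "1 \<le> a" "0 \<le> w"
  shows "a * w - ln (1 + a * w) \<le> a\<^sup>2 * (w - ln (1 + w))"
proof -
  have "0 \<le> a\<^sup>2 * (w - ln (1 + w)) - (a * w - ln (1 + a * w))"
  proof (rule nonneg_by_deriv[where a = 0 and f = "\<lambda>w. a\<^sup>2 * (w - ln (1 + w)) - (a * w - ln (1 + a * w))"
       and f' = "\<lambda>t. a\<^sup>2 * (1 - 1 / (1 + t)) - (a - a / (1 + a * t))"])
    fix t assume t: "0 \<le> t" "t \<le> w"
    have p: "0 < 1 + a * t" "0 < 1 + t" using t assms by (auto simp: add_pos_nonneg)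
    then show "((\<lambda>w. a\<^sup>2 * (w - ln (1 + w)) - (a * w - ln (1 + a * w))) has_real_derivative
        a\<^sup>2 * (1 - 1 / (1 + t)) - (a - a / (1 + a * t))) (at t)"
      by (auto intro!: derivative_eq_intros)
    have "a - a / (1 + a * t) = a\<^sup>2 * (t / (1 + a * t))" using p by (simp add: divide_simps power2_eq_square) (simp add: algebra_simps)
    moreover have "1 - 1 / (1 + t) = t / (1 + t)" using p by (simp add: field_simps)
    moreover have "t / (1 + a * t) \<le> t / (1 + t)" using t assms p by (intro divide_left_mono) (auto simp: mult_le_cancel_right1)
    then have "a\<^sup>2 * (t / (1 + a * t)) \<le> a\<^sup>2 * (t / (1 + t))" by (intro mult_left_mono) auto
    ultimately show "0 \<le> a\<^sup>2 * (1 - 1 / (1 + t)) - (a - a / (1 + a * t))"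
      by simp
  qed (use assms in auto)
  then show ?thesis by simp
qed

lemma psi0_ge: "0 \<le> (x::real) \<Longrightarrow> x\<^sup>2 / (2 * (1 + x)) \<le> x - ln (1 + x)"
proof -
  assume x: "0 \<le> x"
  have "(1 + x - 1 / (1 + x)) / 2 = x - x\<^sup>2 / (2 * (1 + x))"
    using x by (simp add: divide_simps power2_eq_square) (simp add: algebra_simps)
  then show ?thesis using ln_le_trapezoid[of "1 + x"] x by simp
qed

section \<open>The normalised oracle problem\<close>

definition aff :: "('m \<Rightarrow> 'n::finite \<Rightarrow> real) \<Rightarrow> ('m \<Rightarrow> real) \<Rightarrow> ('n \<Rightarrow> real) \<Rightarrow> 'm \<Rightarrow> real" where
  "aff a b x j = b j + (\<Sum>i\<in>UNIV. a j i * x i)"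

lemma frac_le_frac_iff: "0 < w \<Longrightarrow> 0 < z \<Longrightarrow> x / w \<le> y / z \<longleftrightarrow> x * z \<le> y * (w::real)"
  by (simp add: divide_simps)

text \<open>If \<open>V < C\<^sup>2 \<gamma>\<close>, then with
  \<open>x = sqrt (P / \<gamma>)\<close> one gets \<open>X \<le> C \<gamma> x\<close>, so the
  missing \<open>C \<gamma> (1 - x)\<close> must come from
  \<open>Q / S \<le> \<gamma> (1 - x\<^sup>2) / S\<close>. Division by \<open>1 - x\<close> leaves
  \<open>C S \<le> 1 + x < 2\<close>. For \<open>x = 1\<close> nothing is left in \<open>Q\<close>
  and \<open>X\<^sup>2 \<le> P V\<close> alone contradicts.\<close>

lemma share_algebra:
  fixes C \<gamma> X P Q V S :: real
  assumes "0 < \<gamma>" "0 < C" "0 < S" "C * \<gamma> \<le> X + Q / S" "P + Q \<le> \<gamma>" "X\<^sup>2 \<le> P * V" "2 \<le> C * S"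
    "0 \<le> P" "0 \<le> Q" "0 \<le> V" "0 \<le> X"
  shows "C\<^sup>2 * \<gamma> \<le> V"
proof (rule ccontr)
  assume n: "\<not> ?thesis"
  define x where "x = sqrt (P / \<gamma>)"
  have x: "0 \<le> x" "x \<le> 1" "x\<^sup>2 * \<gamma> = P" using assms by (auto simp: x_def)
  have "X\<^sup>2 \<le> P * (C\<^sup>2 * \<gamma>)"
    using n assms by (intro order_trans[OF assms(6)] mult_left_mono) auto
  also have "\<dots> = x\<^sup>2 * \<gamma> * (C\<^sup>2 * \<gamma>)" by (simp only: x(3))
  also have "\<dots> = (C * \<gamma> * x)\<^sup>2" by (simp only: power2_eq_square mult_ac)
  finally have X: "X \<le> C * \<gamma> * x"
    by (rule power2_le_imp_le) (use assms x in auto)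
  show False
  proof (cases "x = 1")
    case True
    then have P: "P = \<gamma>" "Q = 0" using x assms by auto
    then have "(C * \<gamma>)\<^sup>2 \<le> X\<^sup>2" using assms by (intro power_mono) auto
    also have "\<dots> \<le> \<gamma> * V" using assms P by simp
    also have "\<dots> < \<gamma> * (C\<^sup>2 * \<gamma>)" using n assms by simp
    finally show False by (simp add: power2_eq_square)
  next
    case False
    have "Q / S \<le> (\<gamma> - x\<^sup>2 * \<gamma>) / S" using assms x by (intro divide_right_mono) auto
    then have "C * \<gamma> * (1 - x) \<le> (\<gamma> - x\<^sup>2 * \<gamma>) / S" using X assms(4) by (simp add: algebra_simps)
    then have "C * \<gamma> * (1 - x) * S \<le> \<gamma> - x\<^sup>2 * \<gamma>" using assms by (simp add: pos_le_divide_eq)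
    moreover have "C * \<gamma> * (1 - x) * S = (\<gamma> * (1 - x)) * (C * S)" by simp
    moreover have "\<gamma> - x\<^sup>2 * \<gamma> = (\<gamma> * (1 - x)) * (1 + x)" by (simp add: algebra_simps power2_eq_square)
    ultimately have "(\<gamma> * (1 - x)) * (C * S) \<le> (\<gamma> * (1 - x)) * (1 + x)" by simp
    then have "C * S \<le> 1 + x" using assms x False by (simp add: mult_le_cancel_left)
    then show False using assms x False by simp
  qed
qed

text \<open>\<open>S\<^sup>2 \<ge> 4 (S - 1)\<close> turns the hypothesis into
  \<open>C S \<ge> 54/25\<close>; the first and third claims use only \<open>C \<le> 1\<close> and
  \<open>S - 1 \<le> S\<close>.\<close>

lemma margin_facts:
  fixes C S :: real
  assumes "27 / 50 * S \<le> C * (S - 1)" "0 < C" "C \<le> 1" "1 < S"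
  shows "50 / 23 \<le> S" "2 \<le> C * S" "27 / 50 \<le> C" "(C - 27 / 50) \<ge> C / S"
proof -
  have "C * (S - 1) \<le> 1 * (S - 1)" using assms by (intro mult_right_mono) auto
  with assms(1) have "27 / 50 * S \<le> 1 * (S - 1)" by (rule order_trans)
  then show "50 / 23 \<le> S" by simp
  have "27 / 50 * (4 * (S - 1)) \<le> 27 / 50 * S\<^sup>2"
    using zero_le_power2[of "S - 2"] by (simp add: power2_eq_square algebra_simps)
  also have "\<dots> \<le> C * S * (S - 1)" using mult_left_mono[OF assms(1), of S] assms(4) by (simp add: power2_eq_square mult_ac)
  finally have "54 / 25 * (S - 1) \<le> C * S * (S - 1)" by simp
  then have "54 / 25 \<le> C * S" using assms(4) by (simp only: mult_le_cancel_right_pos)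
  then show "2 \<le> C * S" by simp
  have "C * (S - 1) \<le> C * S" using assms by simp
  with assms(1) have "27 / 50 * S \<le> C * S" by (rule order_trans)
  then show "27 / 50 \<le> C" using assms(4) by (simp only: mult_le_cancel_right_pos)
  have "C \<le> (C - 27 / 50) * S" using assms(1) by (simp add: algebra_simps)
  moreover have "0 < S" using assms(4) by simp
  ultimately show "(C - 27 / 50) \<ge> C / S" by (simp only: pos_divide_le_eq)
qed

text \<open>Says that the share of \<open>f\<close> held by the untouched rows outweighs the factor
  lost on the touched ones. For moderate \<open>e\<close> it comes down to
  \<open>23 e\<^sup>2 - 133 e + 69 \<le> 0\<close>, whose smaller root lies just below
  \<open>3/5\<close>: hence the border between the two noise regimes. For \<open>e > 5\<close> the
  minimum is replaced by 1 and \<open>C \<ge> 27/50\<close> suffices.\<close>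

lemma defect_le_share:
  fixes C S e :: real
  assumes "C / S \<le> C - 27 / 50" "0 < C" "C \<le> 1" "1 < S" "3 / 5 \<le> e"
  shows "2 / 3 * min 1 (e / S) * ((1 + e) * (1 + e / 3)) \<le> C * e\<^sup>2"
proof -
  have C: "27 / 50 \<le> C" using assms divide_nonneg_pos[of C S] by linarith
  have p: "0 \<le> (1 + e) * (1 + e / 3)" using assms by simp
  show ?thesis
  proof (cases "e \<le> 5")
    case True
    have "0 \<le> (1 - C) * (27 - 23 * C)" using assms by simp
    then have "50 * C - 27 \<le> 23 * C\<^sup>2" by (simp add: algebra_simps power2_eq_square)
    then have "C - 27 / 50 \<le> 23 / 50 * C\<^sup>2" by simp
    moreover have "C * (1 / S) = C / S" "C * (23 / 50 * C) = 23 / 50 * C\<^sup>2" by (simp_all add: power2_eq_square)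
    ultimately have "C * (1 / S) \<le> C * (23 / 50 * C)" using assms(1) by linarith
    then have "1 / S \<le> 23 / 50 * C" using assms(2) by (simp only: mult_le_cancel_left_pos)
    then have "e * (1 / S) \<le> e * (23 / 50 * C)" using assms(5) by (intro mult_left_mono) auto
    moreover have "min 1 (e / S) \<le> e * (1 / S)" "e * (23 / 50 * C) = 23 / 50 * C * e" by simp_all
    ultimately have "min 1 (e / S) \<le> 23 / 50 * C * e" by linarith
    then have "2 / 3 * min 1 (e / S) * ((1 + e) * (1 + e / 3)) \<le> 2 / 3 * (23 / 50 * C * e) * ((1 + e) * (1 + e / 3))"
      using p by (intro mult_right_mono) auto
    also have "\<dots> = C * e * (23 / 75 * ((1 + e) * (1 + e / 3)))" by simp
    also have "\<dots> \<le> C * e * e"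
    proof (intro mult_left_mono)
      have "0 \<le> (e - 3 / 5) * (5 - e)" using True assms by simp
      then show "23 / 75 * ((1 + e) * (1 + e / 3)) \<le> e" using assms(5) by (simp add: field_simps)
    qed (use assms in auto)
    finally show ?thesis by (simp add: power2_eq_square)
  next
    case False
    have "2 / 3 * min 1 (e / S) * ((1 + e) * (1 + e / 3)) \<le> 2 / 3 * ((1 + e) * (1 + e / 3))"
      using p by (intro mult_right_mono) auto
    also have "\<dots> \<le> 27 / 50 * e\<^sup>2"
    proof -
      have "5 * e \<le> e\<^sup>2" using False by (simp add: power2_eq_square)
      moreover have "2 / 3 * ((1 + e) * (1 + e / 3)) = 2 / 3 + 8 / 9 * e + 2 / 9 * e\<^sup>2"
        by (simp add: field_simps power2_eq_square)
      ultimately show ?thesis using False by linarith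
    qed
    also have "\<dots> \<le> C * e\<^sup>2" using C by (intro mult_right_mono) auto
    finally show ?thesis .
  qed
qed

text \<open>A large \<open>e / S\<close> sharpens the margin to
  \<open>C (e - 17/20) \<ge> 27/50 e\<close>, which eliminates \<open>S\<close>; after
  multiplication by \<open>e - 17/20\<close> a cubic inequality in \<open>e\<close> alone
  remains.\<close>

lemma share_large:
  fixes C S e :: real
  assumes "C / S \<le> C - 27 / 50" "0 < C" "C \<le> 1" "1 < S" "17 / 20 < e / S"
  shows "18 / 25 * ((1 + e) * (1 + e / 3)) \<le> C * e\<^sup>2"
proof -
  have e: "17 / 20 < e" using assms(4,5) by (simp add: field_simps)
  have "17 / 20 * C \<le> (e / S) * C" using assms by (intro mult_right_mono) auto
  also have "\<dots> = e * (C / S)" by simp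
  also have "\<dots> \<le> e * (C - 27 / 50)" using assms e by (intro mult_left_mono) auto
  finally have 1: "27 / 50 * e \<le> C * (e - 17 / 20)" by (simp add: algebra_simps)
  have "(e - 17 / 20) * (18 / 25 * ((1 + e) * (1 + e / 3))) \<le> 27 / 50 * e ^ 3"
  proof -
    have "0 \<le> (5 * e - 8)\<^sup>2 * (50 * e + 33)" "0 \<le> (5 * e - 16)\<^sup>2" using e by auto
    then have "0 \<le> 1250 * e ^ 3 - 3150 * e\<^sup>2 + 400 * e + 2550"
      by (simp add: algebra_simps power_numeral_reduce)
    moreover have "(e - 17 / 20) * (18 / 25 * ((1 + e) * (1 + e / 3))) = 6 / 25 * e ^ 3 + 189 / 250 * e\<^sup>2 - 12 / 125 * e - 153 / 250"
      by (simp add: field_simps power_numeral_reduce)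
    ultimately show ?thesis by linarith
  qed
  also have "\<dots> = 27 / 50 * e * e\<^sup>2" by (simp add: power_numeral_reduce)
  also have "\<dots> \<le> C * (e - 17 / 20) * e\<^sup>2" using 1 by (intro mult_right_mono) auto
  finally have "(e - 17 / 20) * (18 / 25 * ((1 + e) * (1 + e / 3))) \<le> (e - 17 / 20) * (C * e\<^sup>2)" by (simp add: mult_ac)
  then show ?thesis using e by simp
qed

text \<open>Here \<open>\<xi> = 1\<close> and every \<open>c\<^sub>i = 1\<close>, and \<open>g\<close>, \<open>u\<close>, \<open>v\<close> stand for \<open>\<gamma>\<close>, the ground truth and
  the oracle solution. The assumptions \<open>oc\<close> on an off-support column are the limit of (BRSC) along
  that column at infinity and \<open>\<kappa> < 1\<close> in the lower bound for \<open>\<lambda>\<^sub>0\<close>; \<open>margin\<close> follows from the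
  nonemptiness of the window, since \<open>1 - e\<^bsup>h\<^esup> < 1 / e\<close> forces \<open>- h < 23 / 50\<close>.\<close>

locale noisy_oracle =
  fixes a :: "'m::finite \<Rightarrow> 'n::finite \<Rightarrow> real" and b y :: "'m \<Rightarrow> real" and g :: "'n \<Rightarrow> real"
    and C e f :: real and S :: "'n set" and u v :: "'n \<Rightarrow> real" and oc :: 'n
  assumes a01: "\<And>j i. a j i = 0 \<or> 1 \<le> a j i"
    and b1: "\<And>j. 1 \<le> b j" and y0: "\<And>j. 0 \<le> y j"
    and g: "\<And>i. (\<Sum>j\<in>UNIV. (a j i)\<^sup>2 * y j) < g i"
    and S: "S \<noteq> {}"
    and u: "\<And>i. i \<in> S \<Longrightarrow> 0 < u i" "\<And>i. i \<notin> S \<Longrightarrow> u i = 0"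
    and v: "\<And>i. 0 \<le> v i" "\<And>i. i \<notin> S \<Longrightarrow> v i = 0"
    and C: "0 < C" "C \<le> 1"
    and e: "0 \<le> e" "\<And>j. \<bar>y j - aff a b u j\<bar> \<le> e"
    and f: "(\<Sum>j\<in>UNIV. phi (aff a b u j) e) \<le> f"
    and energy: "C * (\<Sum>l\<in>S. g l * gKL 1 ((1 + u l) / (1 + v l)))
      \<le> (\<Sum>j\<in>UNIV. gKL (y j) (aff a b u j)) - (\<Sum>j\<in>UNIV. gKL (y j) (aff a b v j))"
    and margin: "\<And>l. l \<in> S \<Longrightarrow> 27 / 50 * (1 + u l) \<le> C * u l"
    and oc: "oc \<notin> S" "C * g oc \<le> (\<Sum>j\<in>UNIV. a j oc * y j / aff a b u j)" "2 * f < C * g oc"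
begin

section \<open>Rows touched by the support and rows that are not\<close>

abbreviation "s \<equiv> aff a b u"
abbreviation "s' \<equiv> aff a b v"

definition T where "T = {j. \<exists>l\<in>S. a j l \<noteq> 0}"
definition S0 where "S0 = Min ((\<lambda>l. 1 + u l) ` S)"
definition fU where "fU = (\<Sum>j\<in>-T. phi (s j) e)"
definition fT where "fT = (\<Sum>j\<in>T. phi (s j) e)"
definition FT where "FT = (\<Sum>j\<in>T. gKL (y j) (s j))"

lemma a0: "0 \<le> a j i" using a01[of j i] by auto

lemma u0: "0 \<le> u i" using u[of i] by force

lemma g0: "0 < g i"
  using g[of i] sum_nonneg[of UNIV "\<lambda>j. (a j i)\<^sup>2 * y j"] y0 by simp

lemma s_ge1: "1 \<le> s j" and s'_ge1: "1 \<le> s' j"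
  using b1[of j] a0 u0 v(1) by (auto simp: aff_def intro!: add_increasing2 sum_nonneg mult_nonneg_nonneg)

lemma s_ge: "a j l \<noteq> 0 \<Longrightarrow> 1 + u l \<le> s j"
proof -
  assume "a j l \<noteq> 0"
  then have "u l \<le> a j l * u l" using a01[of j l] u0[of l] by (simp add: mult_le_cancel_right1)
  also have "\<dots> \<le> (\<Sum>i\<in>UNIV. a j i * u i)" using a0 u0 by (intro member_le_sum) auto
  finally show ?thesis using b1[of j] by (simp add: aff_def)
qed

lemma S0: obtains l where "l \<in> S" "S0 = 1 + u l"
proof -
  have "S0 \<in> (\<lambda>l. 1 + u l) ` S" unfolding S0_def using S by (intro Min_in) auto
  then show ?thesis using that by auto
qed

lemma S0_margin: "27 / 50 * S0 \<le> C * (S0 - 1)" "1 < S0"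
  using S0 margin u by (metis add_diff_cancel_left', metis add.right_neutral add_less_cancel_left)

lemmas S0_facts = margin_facts[OF S0_margin(1) C S0_margin(2)]

lemma S0_le: "l \<in> S \<Longrightarrow> S0 \<le> 1 + u l" "j \<in> T \<Longrightarrow> S0 \<le> s j"
proof -
  show 1: "S0 \<le> 1 + u l" if "l \<in> S" for l using that by (auto simp: S0_def)
  show "S0 \<le> s j" if "j \<in> T" using that s_ge 1 by (force simp: T_def intro: order_trans)
qed

lemma untouched: "j \<notin> T \<Longrightarrow> s' j = s j"
proof -
  assume "j \<notin> T"
  then have "a j i * v i = a j i * u i" for i using u(2)[of i] v(2)[of i] by (cases "i \<in> S") (auto simp: T_def)
  then have "(\<Sum>i\<in>UNIV. a j i * v i) = (\<Sum>i\<in>UNIV. a j i * u i)" by (intro sum.cong) auto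
  then show ?thesis by (simp add: aff_def)
qed

lemma f_split: "fU + fT \<le> f"
  using f unfolding fU_def fT_def by (simp add: sum.subset_diff[of T UNIV] Compl_eq_Diff_UNIV)

lemma phi0: "0 \<le> phi (s j) e"
  using phi_nonneg[of "s j" e] s_ge1[of j] e by simp

lemma fU0: "0 \<le> fU" "0 \<le> fT" by (auto simp: fU_def fT_def phi0 sum_nonneg)

lemma f0: "0 \<le> f" using f_split fU0 by simp

lemma FT0: "0 \<le> FT"
  unfolding FT_def using s_ge1 by (intro sum_nonneg gKL_nonneg y0) (metis less_le_trans zero_less_one)

lemma energy_T: "C * (\<Sum>l\<in>S. g l * gKL 1 ((1 + u l) / (1 + v l)))
    \<le> (\<Sum>j\<in>T. gKL (y j) (s j) - gKL (y j) (s' j))"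
proof -
  have "(\<Sum>j\<in>UNIV. gKL (y j) (s j)) - (\<Sum>j\<in>UNIV. gKL (y j) (s' j)) = (\<Sum>j\<in>UNIV. gKL (y j) (s j) - gKL (y j) (s' j))"
    by (simp add: sum_subtractf)
  also have "\<dots> = (\<Sum>j\<in>T. gKL (y j) (s j) - gKL (y j) (s' j))"
    by (rule sum.mono_neutral_right) (auto simp: untouched)
  finally show ?thesis using energy by simp
qed

lemma energy_pos: "i \<in> S \<Longrightarrow> 0 \<le> g i * gKL 1 ((1 + u i) / (1 + v i))"
  using u0[of i] v(1)[of i] g0[of i] by (intro mult_nonneg_nonneg gKL_1_nonneg divide_pos_pos) auto

lemma FT_oracle_le: "(\<Sum>j\<in>T. gKL (y j) (s' j)) \<le> FT"
proof -
  have "0 \<le> C * (\<Sum>l\<in>S. g l * gKL 1 ((1 + u l) / (1 + v l)))"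
    using C by (intro mult_nonneg_nonneg sum_nonneg energy_pos) auto
  then show ?thesis using energy_T by (simp add: FT_def sum_subtractf)
qed

text \<open>By Cauchy--Schwarz in the column \<open>oc\<close>, which is nearly free of rows touched by the support,
  the rows outside \<open>T\<close> carry a definite share of the noise bound \<open>f\<close>.\<close>

lemma untouched_share: "C * e\<^sup>2 * f \<le> (1 + e) * (1 + e / 3) * fU"
proof -
  define R where "R = {j. j \<notin> T \<and> a j oc \<noteq> 0}"
  define X where "X = (\<Sum>j\<in>R. a j oc * y j / s j)"
  define P where "P = (\<Sum>j\<in>R. (a j oc)\<^sup>2 * y j)"
  define Q where "Q = (\<Sum>j\<in>T. (a j oc)\<^sup>2 * y j)"
  define V where "V = (\<Sum>j\<in>R. y j / (s j)\<^sup>2)"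
  have disj: "R \<inter> T = {}" by (auto simp: R_def)
  have "X = (\<Sum>j\<in>-T. a j oc * y j / s j)" unfolding X_def by (rule sum.mono_neutral_left) (auto simp: R_def)
  then have "C * g oc \<le> X + (\<Sum>j\<in>T. a j oc * y j / s j)"
    using oc(2) by (simp add: sum.subset_diff[of T UNIV] Compl_eq_Diff_UNIV)
  also have "(\<Sum>j\<in>T. a j oc * y j / s j) \<le> (\<Sum>j\<in>T. (a j oc)\<^sup>2 * y j / S0)"
  proof (rule sum_mono)
    fix j assume j: "j \<in> T"
    have "a j oc * y j / s j \<le> a j oc * y j / S0"
      using S0_le(2)[OF j] S0_margin(2) s_ge1[of j] a0 y0 by (intro divide_left_mono) auto
    also have "\<dots> \<le> (a j oc)\<^sup>2 * y j / S0"
      using a01[of j oc] y0[of j] S0_margin(2) by (intro divide_right_mono mult_right_mono) (auto simp: power2_eq_square)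
    finally show "a j oc * y j / s j \<le> (a j oc)\<^sup>2 * y j / S0" .
  qed
  also have "\<dots> = Q / S0" by (simp add: Q_def sum_divide_distrib)
  finally have 1: "C * g oc \<le> X + Q / S0" by simp
  have "P + Q = (\<Sum>j\<in>R \<union> T. (a j oc)\<^sup>2 * y j)" unfolding P_def Q_def using disj by (simp add: sum.union_disjoint)
  also have "\<dots> \<le> (\<Sum>j\<in>UNIV. (a j oc)\<^sup>2 * y j)" using y0 by (intro sum_mono2) auto
  finally have 2: "P + Q \<le> g oc" using g[of oc] by simp
  have 3: "X\<^sup>2 \<le> P * V"
  proof -
    have "X = (\<Sum>j\<in>R. (a j oc * sqrt (y j)) * (sqrt (y j) / s j))"
      unfolding X_def using y0 by (intro sum.cong) (auto simp: real_sqrt_mult_self)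
    also have "\<dots>\<^sup>2 \<le> (\<Sum>j\<in>R. (a j oc * sqrt (y j))\<^sup>2) * (\<Sum>j\<in>R. (sqrt (y j) / s j)\<^sup>2)"
      by (rule Cauchy_Schwarz_ineq_sum)
    also have "\<dots> = P * V" using y0 by (simp add: P_def V_def power_mult_distrib power_divide)
    finally show ?thesis .
  qed
  have V: "C\<^sup>2 * g oc \<le> V"
    by (rule share_algebra[OF g0 C(1) _ 1 2 3 S0_facts(2)])
      (use S0_margin y0 a0 s_ge1 in \<open>auto simp: P_def Q_def V_def X_def intro!: sum_nonneg divide_nonneg_nonneg intro: order_trans[OF zero_le_one]\<close>)
  \<comment> \<open>Since \<open>s j \<ge> 1\<close>, replacing \<open>y j\<close> by
    \<open>s j + e\<close> and then using the Bernstein bound costs at most the factor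
    \<open>(1 + e) (1 + e / 3)\<close>.\<close>
  have "e\<^sup>2 / 2 * V \<le> (1 + e) * (1 + e / 3) * (\<Sum>j\<in>R. phi (s j) e)"
    unfolding V_def sum_distrib_left
  proof (rule sum_mono)
    fix j assume "j \<in> R"
    have s1: "1 \<le> s j" by (rule s_ge1)
    have "y j \<le> s j + e" using e(2)[of j] by linarith
    then have "e\<^sup>2 / 2 * (y j / (s j)\<^sup>2) \<le> e\<^sup>2 / 2 * ((s j + e) / (s j)\<^sup>2)"
      by (intro mult_left_mono divide_right_mono) auto
    also have "\<dots> \<le> (1 + e) * (1 + e / 3) * (e\<^sup>2 / (2 * s j + 2 / 3 * e))"
    proof -
      have "s j + e \<le> s j * (1 + e)" "s j + e / 3 \<le> s j * (1 + e / 3)"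
        using s1 e(1) by (simp_all add: distrib_left mult_le_cancel_right1)
      then have "(s j + e) * (s j + e / 3) \<le> s j * (1 + e) * (s j * (1 + e / 3))"
        using s1 e(1) by (intro mult_mono) auto
      then have *: "(s j + e) * (s j + e / 3) \<le> (s j)\<^sup>2 * ((1 + e) * (1 + e / 3))" by (simp add: power2_eq_square mult_ac)
      have "(s j + e) / (s j)\<^sup>2 \<le> (1 + e) * (1 + e / 3) / (s j + e / 3)"
        using s1 e(1) * by (simp add: pos_divide_le_eq pos_le_divide_eq mult_ac)
      then have "e\<^sup>2 / 2 * ((s j + e) / (s j)\<^sup>2) \<le> e\<^sup>2 / 2 * ((1 + e) * (1 + e / 3) / (s j + e / 3))"
        by (intro mult_left_mono) auto
      also have "\<dots> = (1 + e) * (1 + e / 3) * (e\<^sup>2 / (2 * s j + 2 / 3 * e))"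
      proof -
        have "2 * s j + 2 / 3 * e = 2 * (s j + e / 3)" by simp
        then show ?thesis by (simp only:) simp
      qed
      finally show ?thesis .
    qed
    also have "\<dots> \<le> (1 + e) * (1 + e / 3) * phi (s j) e"
      using phi_ge[of "s j" e] s1 e(1) by (intro mult_left_mono) auto
    finally show "e\<^sup>2 / 2 * (y j / (s j)\<^sup>2) \<le> (1 + e) * (1 + e / 3) * phi (s j) e" .
  qed
  also have "\<dots> \<le> (1 + e) * (1 + e / 3) * fU"
    unfolding fU_def using e(1) phi0 by (intro mult_left_mono sum_mono2) (auto simp: R_def)
  finally have 4: "e\<^sup>2 / 2 * V \<le> (1 + e) * (1 + e / 3) * fU" .
  have "C * e\<^sup>2 * f \<le> C * e\<^sup>2 * (C * g oc / 2)" using oc(3) C e by (intro mult_left_mono) auto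
  also have "\<dots> = e\<^sup>2 / 2 * (C\<^sup>2 * g oc)" by (simp add: power2_eq_square)
  also have "\<dots> \<le> e\<^sup>2 / 2 * V" using V by (intro mult_left_mono) auto
  finally show ?thesis using 4 by linarith
qed

section \<open>Fidelity of the ground truth measured against \<open>f\<close>\<close>

lemma row_bound:
  assumes "j \<in> T" shows "(1 - 2 / 3 * min 1 (e / S0)) * gKL (y j) (s j) \<le> phi (s j) e"
proof -
  have s: "S0 \<le> s j" "0 < s j" using S0_le(2)[OF assms] S0_margin(2) by auto
  have g0: "0 \<le> gKL (y j) (s j)" using s y0 by (intro gKL_nonneg) auto
  show ?thesis
  proof (cases "y j \<le> s j")
    case True
    have "e / s j \<le> e / S0" using s e S0_margin(2) by (intro divide_left_mono) auto
    then have "(1 - 2 / 3 * min 1 (e / S0)) * gKL (y j) (s j) \<le> (1 - 2 / 3 * min 1 (e / s j)) * gKL (y j) (s j)"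
      using g0 by (intro mult_right_mono) auto
    also have "\<dots> \<le> phi (s j) e" using True e(2)[of j] s y0 by (intro gKL_le_phi_neg) auto
    finally show ?thesis .
  next
    case False
    have "(1 - 2 / 3 * min 1 (e / S0)) * gKL (y j) (s j) \<le> 1 * gKL (y j) (s j)"
      using g0 e(1) S0_margin(2) by (intro mult_right_mono) auto
    also have "\<dots> \<le> phi (s j) e" using False e(2)[of j] s by (simp add: gKL_le_phi)
    finally show ?thesis .
  qed
qed

lemma FT_bound: "(1 - 2 / 3 * min 1 (e / S0)) * FT \<le> fT"
  unfolding FT_def fT_def sum_distrib_left by (intro sum_mono row_bound)

text \<open>Even the worst factor \<open>1 - 2/3\<close> leaves a third. This crude bound serves to
  place the fidelity of the ground truth below \<open>lam\<close>.\<close>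

lemma fidelity_le_3f: "(\<Sum>j\<in>UNIV. gKL (y j) (s j)) \<le> 3 * f"
proof -
  have "gKL (y j) (s j) \<le> 3 * phi (s j) e" for j
  proof (cases "y j \<le> s j")
    case True
    have s: "0 < s j" using s_ge1[of j] by simp
    have "1 / 3 * gKL (y j) (s j) \<le> (1 - 2 / 3 * min 1 (e / s j)) * gKL (y j) (s j)"
      using gKL_nonneg[OF y0 s] by (intro mult_right_mono) auto
    also have "\<dots> \<le> phi (s j) e" using True e(2)[of j] s y0 by (intro gKL_le_phi_neg) auto
    finally show ?thesis by simp
  next
    case False
    then show ?thesis using gKL_le_phi[of "s j" "y j" e] e(2)[of j] s_ge1[of j] phi0[of j] by simp
  qed
  then have "(\<Sum>j\<in>UNIV. gKL (y j) (s j)) \<le> (\<Sum>j\<in>UNIV. 3 * phi (s j) e)" by (intro sum_mono)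
  also have "\<dots> \<le> 3 * f" using f by (simp add: sum_distrib_left[symmetric])
  finally show ?thesis .
qed

text \<open>The untouched rows hold at least \<open>m f\<close>, so at most \<open>(1 - m) f\<close>
  is left for the touched rows, and the loss factor \<open>1 - m\<close> cancels.\<close>

lemma FT_le_f: assumes "3 / 5 \<le> e" shows "FT \<le> f"
proof -
  define m where "m = 2 / 3 * min 1 (e / S0)"
  define p where "p = (1 + e) * (1 + e / 3)"
  have p: "0 < p" using e(1) by (simp add: p_def add_pos_nonneg)
  have "m * p \<le> C * e\<^sup>2"
    using defect_le_share[OF S0_facts(4) C S0_margin(2) assms] by (simp add: m_def p_def)
  then have "m * p * f \<le> p * fU" using mult_right_mono[of "m * p" "C * e\<^sup>2" f] f0 untouched_share by (simp add: p_def)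
  then have "m * f \<le> fU" using p by (simp add: mult_ac)
  moreover have "(1 - m) * FT \<le> fT" using FT_bound by (simp add: m_def)
  ultimately have "(1 - m) * FT \<le> (1 - m) * f" using f_split by (simp add: algebra_simps)
  moreover have "0 < 1 - m" by (simp add: m_def)
  ultimately show ?thesis by simp
qed

text \<open>The relevant rows off the support are those with \<open>y j > s' j\<close>, the only ones that pull a coordinate upwards.\<close>

lemma positive_rows_bound: "(\<Sum>j | s' j < y j. gKL (y j) (s' j)) \<le> 157 / 100 * f"
proof -
  have "(\<Sum>j | s' j < y j. gKL (y j) (s' j))
      = (\<Sum>j\<in>{j. s' j < y j} \<inter> T. gKL (y j) (s' j)) + (\<Sum>j\<in>{j. s' j < y j} - T. gKL (y j) (s' j))"
    by (subst sum.Int_Diff[of _ _ T]) auto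
  also have "(\<Sum>j\<in>{j. s' j < y j} \<inter> T. gKL (y j) (s' j)) \<le> (\<Sum>j\<in>T. gKL (y j) (s' j))"
    using s'_ge1 y0 by (intro sum_mono2 gKL_nonneg) (auto intro: less_le_trans[OF zero_less_one])
  also have "\<dots> \<le> FT" by (rule FT_oracle_le)
  also have "(\<Sum>j\<in>{j. s' j < y j} - T. gKL (y j) (s' j)) \<le> (\<Sum>j\<in>{j. s' j < y j} - T. phi (s j) e)"
  proof (rule sum_mono)
    fix j assume j: "j \<in> {j. s' j < y j} - T"
    then have "s' j = s j" by (simp add: untouched)
    then show "gKL (y j) (s' j) \<le> phi (s j) e" using j e(2)[of j] s_ge1[of j] by (intro order_trans[OF gKL_le_phi[of _ _ e]]) auto
  qed
  also have "\<dots> \<le> fU" unfolding fU_def using phi0 by (intro sum_mono2) auto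
  finally have 1: "(\<Sum>j | s' j < y j. gKL (y j) (s' j)) \<le> FT + fU" by simp
  define m where "m = 2 / 3 * min 1 (e / S0)"
  have m: "FT - fT \<le> m * FT" "m \<le> 2 / 3" using FT_bound by (auto simp: m_def algebra_simps)
  \<comment> \<open>\<open>FT + fU\<close> equals \<open>(FT - fT) + (fU + fT)\<close>. The constant
    \<open>57/100\<close> covers \<open>2/3 * 17/20\<close> in the middle regime, and in the last
    one \<open>2 (1 - 18/25)\<close>, as there \<open>FT - fT \<le> 2 fT\<close> and
    \<open>fU\<close> holds \<open>18/25 f\<close>.\<close>
  have "FT - fT \<le> 57 / 100 * f"
  proof -
    consider "e < 3 / 5" | "3 / 5 \<le> e" "e / S0 \<le> 17 / 20" | "17 / 20 < e / S0" by linarith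
    then show ?thesis
    proof cases
      case 1
      have "e / S0 \<le> (3 / 5) / (50 / 23)" using 1 S0_facts(1) e(1) by (intro frac_le) auto
      then have "e / S0 \<le> 69 / 250" by simp
      moreover have "min 1 (e / S0) \<le> e / S0" by simp
      ultimately have "min 1 (e / S0) \<le> 69 / 250" by (rule order_trans[rotated])
      then have "m \<le> 46 / 250" unfolding m_def by linarith
      then have "m * FT \<le> 46 / 250 * FT" using FT0 by (intro mult_right_mono)
      then have "204 / 250 * FT \<le> fT" using m by linarith
      then show ?thesis using f_split fU0 by linarith
    next
      case 2
      have "min 1 (e / S0) \<le> 17 / 20" by (rule order_trans[OF min.cobounded2 2(2)])
      then have "m \<le> 57 / 100" unfolding m_def by linarith
      then have "m * FT \<le> 57 / 100 * FT" using FT0 by (intro mult_right_mono)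
      then show ?thesis using FT_le_f[OF 2(1)] m by linarith
    next
      case 3
      define p where "p = (1 + e) * (1 + e / 3)"
      have p: "0 < p" using e(1) by (simp add: p_def add_pos_nonneg)
      have "18 / 25 * p \<le> C * e\<^sup>2" using share_large[OF S0_facts(4) C S0_margin(2) 3] by (simp add: p_def)
      then have "18 / 25 * p * f \<le> C * e\<^sup>2 * f" using f0 by (rule mult_right_mono)
      also have "\<dots> \<le> p * fU" using untouched_share by (simp add: p_def)
      finally have "18 / 25 * p * f \<le> p * fU" .
      then have "p * (18 / 25 * f) \<le> p * fU" by (simp add: mult_ac)
      then have "18 / 25 * f \<le> fU" using p by (simp only: mult_le_cancel_left_pos)
      moreover have "m * FT \<le> 2 / 3 * FT" using m FT0 by (intro mult_right_mono)
      ultimately show ?thesis using m f_split f0 by linarith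
    qed
  qed
  then show ?thesis using 1 f_split by linarith
qed

text \<open>For small noise the energy of the rows of other columns cannot be concentrated in column \<open>i\<close>:
  the third-order excess of each row is distributed over its columns by Cauchy--Schwarz, and every
  other column pays for its own share.\<close>

lemma column_energy:
  assumes small: "e < 3 / 5" and i: "i \<in> S"
  defines "d \<equiv> max 0 (min (u i - v i) e)"
  shows "C * (g i * gKL 1 ((1 + u i) / (1 + v i)))
    \<le> f + g i * (29 / 50 * e * d\<^sup>2 / (u i * (1 + u i) * (1 + u i - e)))"
proof -
  define dl where "dl l = max 0 (min (u l - v l) e)" for l
  define W where "W l = 29 / 50 * e * (dl l)\<^sup>2 / (u l * (1 + u l) * (1 + u l - e))" for l
  have S2: "50 / 23 \<le> 1 + u l" if "l \<in> S" for l using S0_facts(1) S0_le(1)[OF that] by linarith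
  have dl0: "0 \<le> dl l" for l by (simp add: dl_def)
  have row: "gKL (y j) (s j) - gKL (y j) (s' j) \<le> phi (s j) e + (\<Sum>l\<in>S. 29 / 50 * e * (dl l)\<^sup>2 / u l * (a j l / s j))"
    if j: "j \<in> T" for j
  proof -
    define D where "D = max 0 (min (s j - s' j) e)"
    have s: "0 < s j" "0 < s' j" using s_ge1[of j] s'_ge1[of j] by auto
    have "50 / 23 \<le> s j" using S0_facts(1) S0_le(2)[OF j] by linarith
    then have "gKL (y j) (s j) - gKL (y j) (s' j) \<le> phi (s j) e + 29 / 50 * e * D\<^sup>2 / (s j)\<^sup>2"
      unfolding D_def using s e(1) e(2)[of j] small by (intro gKL_excess) (auto simp: abs_le_iff)
    also have "29 / 50 * e * D\<^sup>2 / (s j)\<^sup>2 \<le> (\<Sum>l\<in>S. 29 / 50 * e * (dl l)\<^sup>2 / u l * (a j l / s j))"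
    proof -
      have D0: "0 \<le> D" by (simp add: D_def)
      \<comment> \<open>Either one column meeting row \<open>j\<close> drops by more than
        \<open>e\<close>, and its cut-off drop \<open>e\<close> alone dominates \<open>D\<close>, or
        the cut-off acts in no such column and the drops simply add up.\<close>
      have D: "D \<le> (\<Sum>l\<in>S. a j l * dl l)"
      proof (cases "\<exists>l\<in>S. a j l \<noteq> 0 \<and> e < u l - v l")
        case True
        then obtain l where l: "l \<in> S" "a j l \<noteq> 0" "e < u l - v l" by auto
        have "D \<le> dl l" using l e(1) by (simp add: D_def dl_def)
        also have "\<dots> \<le> a j l * dl l" using a01[of j l] l dl0[of l] by (simp add: mult_le_cancel_right1)
        also have "\<dots> \<le> (\<Sum>l\<in>S. a j l * dl l)" using l a0 dl0 by (intro member_le_sum) auto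
        finally show ?thesis .
      next
        case False
        have "s j - s' j = (\<Sum>l\<in>UNIV. a j l * (u l - v l))"
          by (simp add: aff_def sum_subtractf right_diff_distrib)
        also have "\<dots> = (\<Sum>l\<in>S. a j l * (u l - v l))"
          using u(2) v(2) by (intro sum.mono_neutral_right) auto
        also have "\<dots> \<le> (\<Sum>l\<in>S. a j l * dl l)"
        proof (rule sum_mono)
          fix l assume l: "l \<in> S"
          show "a j l * (u l - v l) \<le> a j l * dl l"
          proof (cases "a j l = 0")
            case False
            then have "u l - v l \<le> dl l" using \<open>\<not> (\<exists>l\<in>S. _ l)\<close> l by (auto simp: dl_def)
            then show ?thesis using a0 by (intro mult_left_mono) auto
          qed simp
        qed
        finally have "s j - s' j \<le> (\<Sum>l\<in>S. a j l * dl l)" .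
        moreover have "0 \<le> (\<Sum>l\<in>S. a j l * dl l)" using a0 dl0 by (intro sum_nonneg) auto
        ultimately show ?thesis by (simp add: D_def)
      qed
      \<comment> \<open>Cauchy-Schwarz with the weights \<open>a j l * u l\<close>, whose sum is at
        most \<open>s j\<close>; this cancels one power of \<open>s j\<close>.\<close>
      have "(\<Sum>l\<in>S. a j l * dl l) = (\<Sum>l\<in>S. sqrt (a j l * u l) * (sqrt (a j l / u l) * dl l))"
      proof (rule sum.cong)
        fix l assume "l \<in> S"
        then have "0 < u l" by (rule u)
        then have "sqrt (a j l * u l) * sqrt (a j l / u l) = a j l"
          using a0[of j l] by (simp add: real_sqrt_mult[symmetric])
        then show "a j l * dl l = sqrt (a j l * u l) * (sqrt (a j l / u l) * dl l)" by simp
      qed simp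
      also have "\<dots>\<^sup>2 \<le> (\<Sum>l\<in>S. (sqrt (a j l * u l))\<^sup>2) * (\<Sum>l\<in>S. (sqrt (a j l / u l) * dl l)\<^sup>2)"
        by (rule Cauchy_Schwarz_ineq_sum)
      also have "\<dots> = (\<Sum>l\<in>S. a j l * u l) * (\<Sum>l\<in>S. a j l / u l * (dl l)\<^sup>2)"
        using a0 u0 by (simp add: power_mult_distrib)
      also have "\<dots> \<le> s j * (\<Sum>l\<in>S. a j l / u l * (dl l)\<^sup>2)"
      proof (rule mult_right_mono)
        have "(\<Sum>l\<in>S. a j l * u l) \<le> (\<Sum>l\<in>UNIV. a j l * u l)" using a0 u0 by (intro sum_mono2) auto
        then show "(\<Sum>l\<in>S. a j l * u l) \<le> s j" using b1[of j] by (simp add: aff_def)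
      qed (use a0 u0 in \<open>auto intro!: sum_nonneg\<close>)
      finally have "D\<^sup>2 \<le> s j * (\<Sum>l\<in>S. a j l / u l * (dl l)\<^sup>2)"
        using power_mono[OF D D0, of 2] by linarith
      then have "D\<^sup>2 / (s j)\<^sup>2 \<le> s j * (\<Sum>l\<in>S. a j l / u l * (dl l)\<^sup>2) / (s j)\<^sup>2"
        by (intro divide_right_mono) auto
      also have "\<dots> = (\<Sum>l\<in>S. a j l / u l * (dl l)\<^sup>2) / s j" using s by (simp add: power2_eq_square)
      finally have "29 / 50 * e * (D\<^sup>2 / (s j)\<^sup>2) \<le> 29 / 50 * e * ((\<Sum>l\<in>S. a j l / u l * (dl l)\<^sup>2) / s j)"
        using e(1) by (intro mult_left_mono) auto
      also have "\<dots> = (\<Sum>l\<in>S. 29 / 50 * e * (dl l)\<^sup>2 / u l * (a j l / s j))"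
        unfolding sum_divide_distrib sum_distrib_left by (intro sum.cong) (auto simp: mult_ac)
      finally show ?thesis by simp
    qed
    finally show ?thesis by simp
  qed
  \<comment> \<open>In the rows of column \<open>l\<close> the data are at least
    \<open>1 + u l - e\<close>, which converts the bound \<open>g l\<close> for the sum of
    \<open>a\<^sup>2 y\<close> into one for the sum of \<open>a / s\<close>.\<close>
  have col: "(\<Sum>j\<in>T. a j l / s j) \<le> g l / ((1 + u l) * (1 + u l - e))" if l: "l \<in> S" for l
  proof -
    have p: "0 < 1 + u l - e" "0 < 1 + u l" using S2[OF l] small by auto
    have "(\<Sum>j\<in>T. a j l / s j) \<le> (\<Sum>j\<in>T. (a j l)\<^sup>2 * y j / ((1 + u l) * (1 + u l - e)))"
    proof (rule sum_mono)
      fix j assume "j \<in> T"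
      show "a j l / s j \<le> (a j l)\<^sup>2 * y j / ((1 + u l) * (1 + u l - e))"
      proof (cases "a j l = 0")
        case False
        have s: "1 + u l \<le> s j" by (rule s_ge[OF False])
        have "1 + u l - e \<le> y j" using s e(2)[of j] by linarith
        then have "(1 + u l) * (1 + u l - e) \<le> s j * y j" using p s by (intro mult_mono) auto
        then have "a j l * ((1 + u l) * (1 + u l - e)) \<le> a j l * (s j * y j)" using a0 by (intro mult_left_mono) auto
        also have "\<dots> \<le> (a j l)\<^sup>2 * (s j * y j)"
          using a01[of j l] False s_ge1[of j] y0[of j] by (intro mult_right_mono) (auto simp: power2_eq_square)
        finally have "a j l * ((1 + u l) * (1 + u l - e)) \<le> (a j l)\<^sup>2 * y j * s j" by (simp add: mult_ac)
        then show ?thesis using p s_ge1[of j] by (simp add: divide_simps)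
      qed (use y0 p in auto)
    qed
    also have "\<dots> = (\<Sum>j\<in>T. (a j l)\<^sup>2 * y j) / ((1 + u l) * (1 + u l - e))" by (simp add: sum_divide_distrib)
    also have "\<dots> \<le> g l / ((1 + u l) * (1 + u l - e))"
    proof (rule divide_right_mono)
      have "(\<Sum>j\<in>T. (a j l)\<^sup>2 * y j) \<le> (\<Sum>j\<in>UNIV. (a j l)\<^sup>2 * y j)" using y0 by (intro sum_mono2) auto
      then show "(\<Sum>j\<in>T. (a j l)\<^sup>2 * y j) \<le> g l" using g[of l] by linarith
    qed (use p in auto)
    finally show ?thesis .
  qed
  have "C * (\<Sum>l\<in>S. g l * gKL 1 ((1 + u l) / (1 + v l)))
      \<le> (\<Sum>j\<in>T. phi (s j) e + (\<Sum>l\<in>S. 29 / 50 * e * (dl l)\<^sup>2 / u l * (a j l / s j)))"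
    by (rule order_trans[OF energy_T]) (intro sum_mono row)
  also have "\<dots> = fT + (\<Sum>l\<in>S. 29 / 50 * e * (dl l)\<^sup>2 / u l * (\<Sum>j\<in>T. a j l / s j))"
    unfolding sum.distrib fT_def by (subst sum.swap) (simp add: sum_distrib_left)
  also have "\<dots> \<le> f + (\<Sum>l\<in>S. g l * W l)"
  proof (intro add_mono sum_mono)
    fix l assume l: "l \<in> S"
    have "29 / 50 * e * (dl l)\<^sup>2 / u l * (\<Sum>j\<in>T. a j l / s j)
        \<le> 29 / 50 * e * (dl l)\<^sup>2 / u l * (g l / ((1 + u l) * (1 + u l - e)))"
      using e(1) u0[of l] by (intro mult_left_mono col l) auto
    then show "29 / 50 * e * (dl l)\<^sup>2 / u l * (\<Sum>j\<in>T. a j l / s j) \<le> g l * W l"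
      by (simp add: W_def mult_ac)
  qed (use f_split fU0 in simp)
  finally have 1: "C * (\<Sum>l\<in>S. g l * gKL 1 ((1 + u l) / (1 + v l))) \<le> f + (\<Sum>l\<in>S. g l * W l)" .
  \<comment> \<open>The energy of a column dominates its share of the excess. For the columns other
    than \<open>i\<close> both are then removed from the balance, and only the share of
    \<open>i\<close> stays.\<close>
  have pay: "W l \<le> C * gKL 1 ((1 + u l) / (1 + v l))" if l: "l \<in> S" for l
  proof -
    have p: "0 < 1 + u l - e" "0 < 1 + u l" "0 < u l" using S2[OF l] small u(1)[OF l] by auto
    show ?thesis
    proof (cases "v l \<le> u l")
      case True
      have "29 / 50 * e * 2 \<le> 27 / 50 * (1 + u l - e)" using S2[OF l] small by simp
      then have "29 / 50 * e * 2 * (1 + u l) \<le> 27 / 50 * (1 + u l - e) * (1 + u l)"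
        using p by (intro mult_right_mono) auto
      also have "\<dots> = 27 / 50 * (1 + u l) * (1 + u l - e)" by (simp only: mult_ac)
      also have "\<dots> \<le> C * u l * (1 + u l - e)"
        using margin[OF l] p by (intro mult_right_mono) auto
      finally have "29 / 50 * e * 2 * (1 + u l) \<le> C * u l * (1 + u l - e)" .
      then have "29 / 50 * e * 2 * (1 + u l) * (1 + u l) \<le> C * u l * (1 + u l - e) * (1 + u l)"
        using p by (intro mult_right_mono) auto
      then have "29 / 50 * e * (2 * (1 + u l)\<^sup>2) \<le> C * (u l * (1 + u l) * (1 + u l - e))"
        by (simp only: power2_eq_square mult_ac)
      then have "29 / 50 * e / (u l * (1 + u l) * (1 + u l - e)) \<le> C / (2 * (1 + u l)\<^sup>2)"
        using p by (subst frac_le_frac_iff) auto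
      then have "(dl l)\<^sup>2 * (29 / 50 * e / (u l * (1 + u l) * (1 + u l - e))) \<le> (dl l)\<^sup>2 * (C / (2 * (1 + u l)\<^sup>2))"
        by (intro mult_left_mono) auto
      then have "W l \<le> C * ((dl l)\<^sup>2 / (2 * (1 + u l)\<^sup>2))" by (simp add: W_def mult_ac)
      also have "\<dots> \<le> C * ((u l - v l)\<^sup>2 / (2 * (1 + u l)\<^sup>2))"
        using C True dl0[of l] e(1) by (intro mult_left_mono divide_right_mono power_mono) (auto simp: dl_def)
      also have "\<dots> \<le> C * gKL 1 ((1 + u l) / (1 + u l - (u l - v l)))"
        using C True v(1)[of l] by (intro mult_left_mono gKL_1_ge_sq) auto
      finally show ?thesis by simp
    next
      case False
      have "0 \<le> C * gKL 1 ((1 + u l) / (1 + v l))" using C p v(1)[of l] by (intro mult_nonneg_nonneg gKL_1_nonneg divide_pos_pos) auto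
      then show ?thesis using False by (simp add: W_def dl_def)
    qed
  qed
  have "(\<Sum>l\<in>S - {i}. g l * W l) \<le> (\<Sum>l\<in>S - {i}. g l * (C * gKL 1 ((1 + u l) / (1 + v l))))"
    using g0 by (intro sum_mono mult_left_mono pay) (auto intro: less_imp_le)
  also have "\<dots> = C * (\<Sum>l\<in>S - {i}. g l * gKL 1 ((1 + u l) / (1 + v l)))"
    by (simp add: sum_distrib_left mult_ac)
  finally have 2: "(\<Sum>l\<in>S - {i}. g l * W l) \<le> C * (\<Sum>l\<in>S - {i}. g l * gKL 1 ((1 + u l) / (1 + v l)))" .
  have "C * (g i * gKL 1 ((1 + u i) / (1 + v i))) \<le> f + g i * W i"
    using 1 2 i by (simp add: sum.remove[of S i] distrib_left)
  then show ?thesis by (simp add: W_def dl_def d_def)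
qed

text \<open>For large noise \<open>FT \<le> f\<close> gives \<open>R \<le> E\<close> outright. For
  small noise, once \<open>R - E\<close> passes the stated margin, the energy surplus is at least
  \<open>d / (4 (1 + u)\<^sup>2)\<close> with \<open>d = u - v\<close>. The third-order excess is
  also at most linear in \<open>d\<close>, because the squared cut-off drop is at most
  \<open>d e\<close>. So \<open>d\<close> cancels and a contradiction between constants
  remains.\<close>

lemma ratio_control:
  assumes i: "i \<in> S" and E: "1 \<le> E" "f \<le> C * g i * gKL 1 E"
  shows "(1 + u i) / (1 + v i) - E \<le> E\<^sup>2 / (2 * (1 + u i))"
proof -
  define R where "R = (1 + u i) / (1 + v i)"
  have ui: "0 < u i" by (rule u(1)[OF i])
  have vi: "0 \<le> v i" by (rule v(1))
  have n: "0 \<le> E\<^sup>2 / (2 * (1 + u i))" using ui by simp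
  have "R - E \<le> E\<^sup>2 / (2 * (1 + u i))"
  proof (cases "3 / 5 \<le> e")
    case True
    have "R \<le> E"
    proof (rule ccontr)
      assume a: "\<not> R \<le> E"
      have "C * (g i * gKL 1 R) \<le> C * (\<Sum>l\<in>S. g l * gKL 1 ((1 + u l) / (1 + v l)))"
        unfolding R_def using C i by (intro mult_left_mono member_le_sum energy_pos) auto
      also have "\<dots> \<le> FT"
      proof -
        have "0 \<le> (\<Sum>j\<in>T. gKL (y j) (s' j))"
          using s'_ge1 by (intro sum_nonneg gKL_nonneg y0 less_le_trans[OF zero_less_one])
        then show ?thesis using energy_T by (simp add: sum_subtractf FT_def)
      qed
      also have "\<dots> \<le> C * (g i * gKL 1 E)" using FT_le_f[OF True] E(2) by simp
      finally have "gKL 1 R \<le> gKL 1 E" using C g0[of i] by (simp add: mult_le_cancel_left)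
      moreover have "0 < (R - E) * (1 - 1 / R) / 2" using a E(1) by simp
      moreover have "(R - E) * (1 - 1 / R) / 2 \<le> gKL 1 R - gKL 1 E"
        using a E(1) by (intro gKL_1_diff_ge) auto
      ultimately show False by linarith
    qed
    then show ?thesis using n by linarith
  next
    case False
    show ?thesis
    proof (rule ccontr)
      assume a: "\<not> ?thesis"
      define d where "d = u i - v i"
      define dd where "dd = max 0 (min d e)"
      define Si where "Si = 1 + u i"
      have Si: "50 / 23 \<le> Si" using S0_facts(1) S0_le(1)[OF i] by (simp add: Si_def)
      have RE: "E < R" using a n by linarith
      then have "1 < R" using E(1) by linarith
      then have d: "0 < d" using vi by (simp add: R_def d_def)
      have R1: "1 - 1 / R = d / Si" using ui vi by (simp add: R_def d_def Si_def field_simps)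
      have dd: "dd\<^sup>2 \<le> d * e" "0 \<le> dd"
        using d e(1) mult_mono[of dd d dd e] by (auto simp: dd_def power2_eq_square)
      have p: "0 < Si - e" "0 < Si" using Si False by auto
      have "1 / (2 * Si) \<le> E\<^sup>2 / (2 * Si)" using p E(1) by (intro divide_right_mono) auto
      then have "1 / (2 * Si) \<le> R - E" using a by (simp add: Si_def)
      then have "1 / (2 * Si) * (d / Si) / 2 \<le> (R - E) * (d / Si) / 2"
        using d p by (intro divide_right_mono mult_right_mono) auto
      also have "\<dots> \<le> gKL 1 R - gKL 1 E" using gKL_1_diff_ge[of E R] RE E(1) R1 by simp
      finally have 1: "d / (4 * Si\<^sup>2) \<le> gKL 1 R - gKL 1 E" by (simp add: power2_eq_square mult_ac)
      have "g i * (C * (gKL 1 R - gKL 1 E)) \<le> g i * (29 / 50 * e * dd\<^sup>2 / (u i * Si * (Si - e)))"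
        using column_energy[OF _ i] False E(2)
        by (simp add: R_def Si_def dd_def d_def algebra_simps)
      then have "C * (gKL 1 R - gKL 1 E) \<le> 29 / 50 * e * dd\<^sup>2 / (u i * Si * (Si - e))"
        using g0[of i] by (simp only: mult_le_cancel_left_pos)
      also have "\<dots> \<le> 29 / 50 * e * (d * e) / (u i * Si * (Si - e))"
        using dd e(1) p ui by (intro divide_right_mono mult_left_mono) auto
      finally have "C * d / (4 * Si\<^sup>2) \<le> 29 / 50 * e * (d * e) / (u i * Si * (Si - e))"
        using mult_left_mono[OF 1, of C] C by simp
      then have "C * d * (u i * Si * (Si - e)) \<le> 29 / 50 * e * (d * e) * (4 * Si\<^sup>2)"
        using p ui by (subst (asm) frac_le_frac_iff) auto
      then have "(d * Si) * (C * u i * (Si - e)) \<le> (d * Si) * (29 / 50 * 4 * e\<^sup>2 * Si)"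
        by (simp only: power2_eq_square mult_ac)
      then have "C * u i * (Si - e) \<le> 29 / 50 * 4 * e\<^sup>2 * Si"
        using mult_pos_pos[OF d p(2)] by (simp only: mult_le_cancel_left_pos)
      then have 2: "C * u i * (Si - e) \<le> 58 / 25 * e\<^sup>2 * Si" by simp
      have "27 / 50 * (Si - e) * Si = 27 / 50 * Si * (Si - e)" by (simp only: mult_ac)
      also have "\<dots> \<le> C * u i * (Si - e)"
        using margin[OF i] p by (intro mult_right_mono) (auto simp: Si_def)
      finally have "27 / 50 * (Si - e) * Si \<le> C * u i * (Si - e)" .
      then have "27 / 50 * (Si - e) * Si \<le> 58 / 25 * e\<^sup>2 * Si" using 2 by linarith
      then have 3: "27 / 50 * (Si - e) \<le> 58 / 25 * e\<^sup>2" using p by (simp only: mult_le_cancel_right_pos)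
      \<comment> \<open>The final margin is thin: \<open>27/50 (50/23 - 3/5)\<close> is about
        \<open>0.850\<close>, and \<open>58/25 (3/5)^2\<close> about \<open>0.835\<close>.\<close>
      have "e\<^sup>2 \<le> (3 / 5)\<^sup>2" using False e(1) by (intro power_mono) auto
      then show False using 3 Si False by (simp add: power2_eq_square)
    qed
  qed
  then show ?thesis by (simp add: R_def)
qed

text \<open>With \<open>R\<close> the actual ratio,
  \<open>rt - \<rho> = C / (1 + u) (R - E)\<close>. By \<open>ratio_control\<close> and
  \<open>1 - \<rho> \<le> C\<close>, \<open>(rt - \<rho>) (1 - \<rho>)\<close> is at most half the
  square of \<open>C E / (1 + u)\<close>, and this number is at most \<open>\<rho>\<close>: exactly
  the excess that \<open>ratio_bound\<close> tolerates.\<close>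

lemma support_threshold:
  assumes i: "i \<in> S" and E: "1 \<le> E" "f \<le> C * g i * gKL 1 E"
    and r: "0 < r" and rho: "\<rho> = 1 - C + C * min 1 (E / (1 + u i))"
    and up: "1 - exp (- \<rho>) < r * exp (- r)"
  shows "1 - r < C * (v i / (1 + v i))"
proof -
  define Si where "Si = 1 + u i"
  have Si: "0 < Si" using u0[of i] by (simp add: Si_def)
  have vi: "0 \<le> v i" by (rule v(1))
  have r46: "\<rho> < 23 / 50" by (rule rho_bound[OF up])
  have min: "min 1 (E / Si) = E / Si"
  proof (rule ccontr)
    assume "min 1 (E / Si) \<noteq> E / Si"
    then have "min 1 (E / Si) = 1" by (auto simp: min_def)
    then show False using rho r46 by (simp add: Si_def)
  qed
  have rho': "\<rho> = 1 - C + C * (E / Si)" using rho min by (simp add: Si_def)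
  have ES: "0 \<le> E / Si" using E Si by simp
  have CE0: "0 \<le> C * (E / Si)" using C ES by (intro mult_nonneg_nonneg) auto
  then have rho0: "0 \<le> \<rho>" "C * (E / Si) \<le> \<rho>" "1 - \<rho> \<le> C" using rho' C by linarith+
  define rt where "rt = 1 - C + C * (1 / (1 + v i))"
  have "rt < r"
  proof (rule ratio_bound[OF up r])
    have "1 / (1 + v i) \<le> 1" using vi by simp
    then have "C * (1 / (1 + v i)) \<le> C * 1" using C by (intro mult_left_mono) auto
    then show "rt \<le> 1" by (simp add: rt_def)
    show "0 \<le> \<rho>" by (rule rho0)
    define R where "R = Si / (1 + v i)"
    have "R - E \<le> E\<^sup>2 / (2 * Si)" using ratio_control[OF i E] by (simp add: R_def Si_def)
    then have "C / Si * (R - E) \<le> C / Si * (E\<^sup>2 / (2 * Si))" using C Si by (intro mult_left_mono) auto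
    moreover have "rt - \<rho> = C / Si * (R - E)" using Si vi by (simp add: rt_def rho' R_def right_diff_distrib)
    ultimately have D: "rt - \<rho> \<le> C / Si * (E\<^sup>2 / (2 * Si))" by simp
    have "1 - \<rho> \<le> C" "0 \<le> 1 - \<rho>" using rho0 r46 by auto
    have "(rt - \<rho>) * (1 - \<rho>) \<le> C / Si * (E\<^sup>2 / (2 * Si)) * (1 - \<rho>)"
      using D \<open>0 \<le> 1 - \<rho>\<close> by (rule mult_right_mono)
    also have "\<dots> \<le> C / Si * (E\<^sup>2 / (2 * Si)) * C"
      using \<open>1 - \<rho> \<le> C\<close> C Si by (intro mult_left_mono) auto
    also have "\<dots> = (C * (E / Si))\<^sup>2 / 2" by (simp add: power2_eq_square mult_ac)
    also have "\<dots> \<le> \<rho>\<^sup>2 / 2" using rho0(2) CE0 by (intro divide_right_mono power_mono) auto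
    finally show "(rt - \<rho>) * (1 - \<rho>) \<le> \<rho>\<^sup>2 / 2" .
  qed
  moreover have "v i / (1 + v i) = 1 - 1 / (1 + v i)" using vi by (simp add: field_simps)
  ultimately show ?thesis by (simp add: rt_def right_diff_distrib)
qed

text \<open>Move from the oracle by \<open>tt\<close> along column \<open>i\<close>. In the rows
  with data above the mean, nonnegativity of the KL cost after the move bounds slope times
  \<open>tt\<close> by the present cost plus a curvature term; the other rows have a nonpositive
  slope. The curvature terms sum to at most \<open>G (w - log(1 + w))\<close>, and the best
  \<open>w\<close> produces the conjugate function, to be compared with
  \<open>157/100 f\<close>.\<close>

lemma off_support_gradient:
  assumes Z: "Z = (\<Sum>j\<in>UNIV. (a j i)\<^sup>2 * y j / (s' j)\<^sup>2)" "C * g i \<le> Z"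
    and k: "0 \<le> \<kappa>" "\<kappa> < 1" "2 * Z * f \<le> (\<kappa> * C * g i)\<^sup>2"
    and t: "0 < \<tau>" "\<tau> < 1" "- ln (1 - \<kappa>) < - ln (1 - \<tau>) - \<tau>"
  shows "(\<Sum>j\<in>UNIV. a j i * (y j / s' j - 1)) < C * g i * \<tau>"
proof (rule ccontr)
  assume neg: "\<not> ?thesis"
  define G where "G = g i"
  define z where "z = Z / G"
  have G: "0 < G" using g0 by (simp add: G_def)
  have CG: "C * G \<le> Z" using Z(2) by (simp add: G_def)
  have Z0: "0 < Z" using CG mult_pos_pos[OF C(1) G] by linarith
  have "Z \<le> (\<Sum>j\<in>UNIV. (a j i)\<^sup>2 * y j)"
    unfolding Z(1)
  proof (rule sum_mono)
    fix j
    have "1 \<le> (s' j)\<^sup>2" "s' j \<noteq> 0" using s'_ge1[of j] by auto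
    then show "(a j i)\<^sup>2 * y j / (s' j)\<^sup>2 \<le> (a j i)\<^sup>2 * y j"
      using y0[of j] divide_left_mono[of 1 "(s' j)\<^sup>2" "(a j i)\<^sup>2 * y j"] by simp
  qed
  then have "Z < G" using g[of i] by (simp add: G_def)
  then have z: "0 < z" "z < 1" "C \<le> z" using Z0 G CG by (auto simp: z_def pos_le_divide_eq)
  have zG: "Z = z * G" using G by (simp add: z_def)
  define q where "q = sqrt z"
  have q: "0 < q" "q < 1" "q\<^sup>2 = z" "z \<le> q"
  proof -
    show "0 < q" "q < 1" "q\<^sup>2 = z" using z by (auto simp: q_def)
    then have "q * q \<le> q * 1" by (intro mult_left_mono) auto
    then show "z \<le> q" using \<open>q\<^sup>2 = z\<close> by (simp add: power2_eq_square)
  qed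
  \<comment> \<open>Chosen so that slope times move, \<open>C \<tau> tt\<close>, becomes
    \<open>x w\<close> with \<open>x = n \<tau>\<close>.\<close>
  define n where "n = C / q"
  have n: "27 / 50 \<le> n" "n < 1"
  proof -
    have "C \<le> n" using q C by (simp add: n_def pos_le_divide_eq mult_le_cancel_left1)
    then show "27 / 50 \<le> n" using S0_facts(3) by linarith
    have "C \<le> q" using z q by simp
    moreover have "C \<noteq> q" using z(3) q by (auto simp: power2_eq_square)
    ultimately show "n < 1" using q by (simp add: n_def)
  qed
  define x where "x = n * \<tau>"
  have x: "0 < x" "x < 1" using n t mult_strict_mono[of n 1 \<tau> 1] by (auto simp: x_def)
  \<comment> \<open>The maximiser of \<open>x w - (w - log(1 + w))\<close>. Dividing by
    \<open>q\<close> to get \<open>tt\<close> gives the relative moves \<open>tt / s' j\<close>,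
    with weights \<open>(a j i)\<^sup>2 y j\<close>, the second moment
    \<open>Z tt\<^sup>2 = G w\<^sup>2\<close>.\<close>
  define w where "w = x / (1 - x)"
  have w: "0 < w" using x by (simp add: w_def)
  define tt where "tt = w / q"
  have tt: "0 < tt" "q * tt = w" using w q by (auto simp: tt_def)
  define FP where "FP = (\<Sum>j | s' j < y j. gKL (y j) (s' j))"
  have psi: "(\<Sum>j\<in>UNIV. y j * (a j i * tt / s' j - ln (1 + a j i * tt / s' j))) \<le> G * (w - ln (1 + w))"
  proof -
    \<comment> \<open>Jensen's inequality in the squared variable: the tangent at
      \<open>w\<^sup>2\<close> is summed over weights of total mass at most \<open>G\<close> and
      second moment \<open>G w\<^sup>2\<close>.\<close>
    define D where "D = tt\<^sup>2 / (2 * (1 + w))"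
    have D0: "0 \<le> D" using w by (simp add: D_def)
    define ps where "ps = w - ln (1 + w)"
    have ps: "z * D \<le> ps"
      using psi0_ge[of w] w q by (simp add: ps_def D_def tt(2)[symmetric] power_mult_distrib)
    have row: "y j * (a j i * tt / s' j - ln (1 + a j i * tt / s' j))
        \<le> (a j i)\<^sup>2 * y j * (ps - z * D) + (a j i)\<^sup>2 * y j / (s' j)\<^sup>2 * D" for j
    proof (cases "a j i = 0")
      case False
      then have a1: "1 \<le> a j i" using a01[of j i] by simp
      have s1: "1 \<le> s' j" by (rule s'_ge1)
      have "a j i * tt / s' j - ln (1 + a j i * tt / s' j) \<le> (a j i)\<^sup>2 * (tt / s' j - ln (1 + tt / s' j))"
        using psi0_scale[OF a1, of "tt / s' j"] tt s1 by simp
      also have "\<dots> \<le> (a j i)\<^sup>2 * (w - ln (1 + w) + ((tt / s' j)\<^sup>2 - w\<^sup>2) / (2 * (1 + w)))"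
        using tt s1 w by (intro mult_left_mono ln_trapezoid_gen) auto
      also have "w - ln (1 + w) + ((tt / s' j)\<^sup>2 - w\<^sup>2) / (2 * (1 + w)) = ps - z * D + D / (s' j)\<^sup>2"
        by (simp add: ps_def D_def tt(2)[symmetric] power_mult_distrib q(3) power_divide diff_divide_distrib)
      finally have "y j * (a j i * tt / s' j - ln (1 + a j i * tt / s' j)) \<le> y j * ((a j i)\<^sup>2 * (ps - z * D + D / (s' j)\<^sup>2))"
        using y0 by (intro mult_left_mono)
      then show ?thesis by (simp add: algebra_simps)
    qed simp
    have "(\<Sum>j\<in>UNIV. y j * (a j i * tt / s' j - ln (1 + a j i * tt / s' j)))
        \<le> (\<Sum>j\<in>UNIV. (a j i)\<^sup>2 * y j * (ps - z * D) + (a j i)\<^sup>2 * y j / (s' j)\<^sup>2 * D)"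
      by (intro sum_mono row)
    also have "\<dots> = (\<Sum>j\<in>UNIV. (a j i)\<^sup>2 * y j) * (ps - z * D) + Z * D"
      by (simp add: sum.distrib sum_distrib_right Z(1))
    also have "\<dots> \<le> G * (ps - z * D) + Z * D"
      using ps g[of i] by (intro add_right_mono mult_right_mono) (auto simp: G_def)
    also have "\<dots> = G * ps" by (simp add: zG algebra_simps)
    finally show ?thesis by (simp add: ps_def)
  qed
  have rowP: "a j i * (y j / s' j - 1) * tt \<le> (if s' j < y j then gKL (y j) (s' j) else 0)
      + y j * (a j i * tt / s' j - ln (1 + a j i * tt / s' j))" for j
  proof -
    have s1: "1 \<le> s' j" by (rule s'_ge1)
    have at: "0 \<le> a j i * tt" using a0 tt by simp
    have l: "0 \<le> a j i * tt / s' j - ln (1 + a j i * tt / s' j)"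
      using ln_add_one_self_le_self[of "a j i * tt / s' j"] at s1 by simp
    show ?thesis
    proof (cases "s' j < y j")
      case True
      have "gKL (y j) (s' j + a j i * tt) - gKL (y j) (s' j)
          = a j i * tt - y j * ln ((s' j + a j i * tt) / s' j)"
        using gKL_diff[of "y j" "s' j + a j i * tt" "s' j"] y0 s1 at by simp
      also have "(s' j + a j i * tt) / s' j = 1 + a j i * tt / s' j" using s1 by (simp add: add_divide_distrib)
      finally have "0 \<le> gKL (y j) (s' j) + a j i * tt - y j * ln (1 + a j i * tt / s' j)"
        using gKL_nonneg[of "y j" "s' j + a j i * tt"] y0 s1 at by simp
      then show ?thesis using True by (simp add: algebra_simps)
    next
      case False
      have "y j / s' j - 1 \<le> 0" using False s1 by (simp add: divide_le_eq)
      then have "a j i * (y j / s' j - 1) * tt \<le> 0"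
        using a0[of j i] tt by (simp add: mult_nonneg_nonpos mult_nonpos_nonneg)
      moreover have "0 \<le> y j * (a j i * tt / s' j - ln (1 + a j i * tt / s' j))" using l y0 by simp
      ultimately show ?thesis using False by simp
    qed
  qed
  have "(\<Sum>j\<in>UNIV. a j i * (y j / s' j - 1)) * tt \<le> FP + G * (w - ln (1 + w))"
  proof -
    have "(\<Sum>j\<in>UNIV. a j i * (y j / s' j - 1)) * tt \<le> (\<Sum>j\<in>UNIV. (if s' j < y j then gKL (y j) (s' j) else 0)
      + y j * (a j i * tt / s' j - ln (1 + a j i * tt / s' j)))"
      unfolding sum_distrib_right by (intro sum_mono rowP)
    also have "\<dots> = FP + (\<Sum>j\<in>UNIV. y j * (a j i * tt / s' j - ln (1 + a j i * tt / s' j)))"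
      by (simp add: sum.distrib FP_def sum.If_cases)
    finally show ?thesis using psi by simp
  qed
  moreover have "C * G * \<tau> * tt \<le> (\<Sum>j\<in>UNIV. a j i * (y j / s' j - 1)) * tt"
    using neg tt by (intro mult_right_mono) (auto simp: G_def)
  ultimately have 1: "C * G * \<tau> * tt \<le> FP + G * (w - ln (1 + w))" by linarith
  have "C * G * \<tau> * tt = G * (x * w)" using q by (simp add: tt_def x_def n_def)
  moreover have "x * w - (w - ln (1 + w)) = - ln (1 - x) - x"
  proof -
    have "1 + w = 1 / (1 - x)" using x by (simp add: w_def field_simps)
    then have "ln (1 + w) = - ln (1 - x)" using x by (simp add: ln_div)
    moreover have "w * (1 - x) = x" using x by (simp add: w_def)
    then have "w - x * w = x" by (simp add: algebra_simps)
    ultimately show ?thesis by linarith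
  qed
  then have "G * (x * w) - G * (w - ln (1 + w)) = G * (- ln (1 - x) - x)" by (simp only: right_diff_distrib[symmetric])
  ultimately have 2: "G * (- ln (1 - x) - x) \<le> FP" using 1 by linarith
  have "\<kappa> \<le> \<tau>\<^sup>2" using kappa_less_tau_sq[OF t(1,2) k(2) t(3)] by simp
  then have "157 / 200 * n\<^sup>2 * \<kappa>\<^sup>2 < - ln (1 - x) - x"
    unfolding x_def by (rule conjugate_bound[OF t(1,2) k(1) _ n])
  then have "G * (157 / 200 * n\<^sup>2 * \<kappa>\<^sup>2) < FP" using 2 mult_strict_left_mono[OF _ G] by (meson less_le_trans)
  also have "FP \<le> 157 / 100 * f" unfolding FP_def by (rule positive_rows_bound)
  finally have 3: "G * (n\<^sup>2 * \<kappa>\<^sup>2) < 2 * f" by (simp add: mult_ac)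
  have "2 * (z * G) * f \<le> (\<kappa> * C * G)\<^sup>2" using k(3) by (simp add: zG G_def)
  also have "\<dots> = z * G * (G * (n\<^sup>2 * \<kappa>\<^sup>2))"
  proof -
    have nz: "C\<^sup>2 = z * n\<^sup>2" using z(1) by (simp add: n_def power_divide q(3))
    show ?thesis unfolding power_mult_distrib nz by (simp only: power2_eq_square[of G] mult_ac)
  qed
  finally have "z * G * (2 * f) \<le> z * G * (G * (n\<^sup>2 * \<kappa>\<^sup>2))" by (simp add: mult_ac)
  then have "2 * f \<le> G * (n\<^sup>2 * \<kappa>\<^sup>2)" using mult_pos_pos[OF z(1) G] by (simp only: mult_le_cancel_left_pos)
  then show False using 3 by simp
qed

end

section \<open>The Poisson setting\<close>

lemma gKL_three_point:
  assumes "0 \<le> y" "0 < s" "0 < s'"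
  shows "gKL y s' - gKL y s = (1 - y / s) * (s' - s) + y * gKL 1 (s' / s)"
proof -
  have "y * gKL 1 (s' / s) = y * (s' - s) / s - y * ln (s' / s)"
    using assms by (simp add: gKL_1 diff_divide_distrib algebra_simps)
  then show ?thesis using gKL_diff[of y s' s] assms by (simp add: algebra_simps)
qed

text \<open>Along the segment, the derivative at \<open>t\<close> of either Bregman distance is the
  symmetric distance between \<open>x\<close> and the point at \<open>t\<close>, divided by
  \<open>t\<close>. The difference of the two sides starts at 0 and therefore never
  decreases.\<close>

lemma bregman_from_symmetric:
  fixes a :: "'m::finite \<Rightarrow> 'n::finite \<Rightarrow> real" and x z :: "'n \<Rightarrow> real"
  assumes x: "\<And>i. 0 \<le> x i" and z: "\<And>i. 0 \<le> z i"
    and pos: "\<And>j. 0 < aff a b x j" "\<And>j. 0 < aff a b z j"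
    and H: "\<And>t. 0 < t \<Longrightarrow> t \<le> 1 \<Longrightarrow>
      C * (\<Sum>i\<in>UNIV. g i * ((t * (z i - x i))\<^sup>2 / ((1 + x i) * (1 + (x i + t * (z i - x i))))))
      \<le> (\<Sum>j\<in>UNIV. y j * ((t * (aff a b z j - aff a b x j))\<^sup>2 / (aff a b x j * (aff a b x j + t * (aff a b z j - aff a b x j)))))"
  shows "C * (\<Sum>i\<in>UNIV. g i * gKL 1 ((1 + z i) / (1 + x i))) \<le> (\<Sum>j\<in>UNIV. y j * gKL 1 (aff a b z j / aff a b x j))"
proof -
  define p where "p j = (aff a b z j - aff a b x j) / aff a b x j" for j
  define q where "q i = (z i - x i) / (1 + x i)" for i
  have conv: "0 < 1 + t * ((zz - xx) / xx)" if "0 < xx" "0 < zz" "0 \<le> t" "t \<le> 1" for xx zz t :: real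
  proof -
    have "0 < (1 - t) * xx + t * zz"
      using that by (cases "t = 1") (auto intro: add_pos_nonneg)
    moreover have "1 + t * ((zz - xx) / xx) = ((1 - t) * xx + t * zz) / xx" using that by (simp add: field_simps)
    ultimately show ?thesis using that by simp
  qed
  have pp: "0 < 1 + t * p j" if "0 \<le> t" "t \<le> 1" for t j
    unfolding p_def using conv pos that by blast
  have qq: "0 < 1 + t * q i" if "0 \<le> t" "t \<le> 1" for t i
    using conv[of "1 + x i" "1 + z i" t] x[of i] z[of i] that by (simp add: q_def)
  have "0 \<le> (\<Sum>j\<in>UNIV. y j * (1 * p j - ln (1 + 1 * p j))) - C * (\<Sum>i\<in>UNIV. g i * (1 * q i - ln (1 + 1 * q i)))"
  proof (rule nonneg_by_deriv[where a = 0 and x = 1 and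
      f = "\<lambda>t. (\<Sum>j\<in>UNIV. y j * (t * p j - ln (1 + t * p j))) - C * (\<Sum>i\<in>UNIV. g i * (t * q i - ln (1 + t * q i)))" and
      f' = "\<lambda>t. (\<Sum>j\<in>UNIV. y j * (p j - p j / (1 + t * p j))) - C * (\<Sum>i\<in>UNIV. g i * (q i - q i / (1 + t * q i)))"])
    fix t :: real assume t: "0 \<le> t" "t \<le> 1"
    have 1: "((\<lambda>t. w * (t * r - ln (1 + t * r))) has_real_derivative w * (r - r / (1 + t * r))) (at t)"
      if "0 < 1 + t * r" for w r using that by (auto intro!: derivative_eq_intros)
    show "((\<lambda>t. (\<Sum>j\<in>UNIV. y j * (t * p j - ln (1 + t * p j))) - C * (\<Sum>i\<in>UNIV. g i * (t * q i - ln (1 + t * q i))))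
      has_real_derivative (\<Sum>j\<in>UNIV. y j * (p j - p j / (1 + t * p j))) - C * (\<Sum>i\<in>UNIV. g i * (q i - q i / (1 + t * q i)))) (at t)"
      by (intro DERIV_diff DERIV_sum DERIV_cmult 1 pp qq t)
    show "0 \<le> (\<Sum>j\<in>UNIV. y j * (p j - p j / (1 + t * p j))) - C * (\<Sum>i\<in>UNIV. g i * (q i - q i / (1 + t * q i)))"
    proof (cases "t = 0")
      case False
      then have t0: "0 < t" using t by simp
      have e: "t * (r - r / (1 + t * r)) = (t * (zz - xx))\<^sup>2 / (xx * (xx + t * (zz - xx)))"
        if "r = (zz - xx) / xx" "0 < xx" "0 < 1 + t * r" for r xx zz
      proof -
        have rx: "zz - xx = r * xx" using that by simp
        have "xx + t * (r * xx) = xx * (1 + t * r)" by (simp add: algebra_simps)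
        then have "(t * (zz - xx))\<^sup>2 / (xx * (xx + t * (zz - xx))) = (xx * xx) * (t * r)\<^sup>2 / ((xx * xx) * (1 + t * r))"
          by (simp only: rx power2_eq_square mult_ac)
        also have "\<dots> = (t * r)\<^sup>2 / (1 + t * r)" using that by (intro nonzero_mult_divide_mult_cancel_left) auto
        also have "\<dots> = t * (r - r / (1 + t * r))"
          using that(3) by (simp add: field_simps power2_eq_square)
        finally show ?thesis by (rule sym)
      qed
      have "t * (C * (\<Sum>i\<in>UNIV. g i * (q i - q i / (1 + t * q i))))
          = C * (\<Sum>i\<in>UNIV. g i * (t * (q i - q i / (1 + t * q i))))"
        by (simp add: sum_distrib_left mult_ac)
      also have "\<dots> = C * (\<Sum>i\<in>UNIV. g i * ((t * (z i - x i))\<^sup>2 / ((1 + x i) * (1 + (x i + t * (z i - x i))))))"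
      proof -
        have "t * (q i - q i / (1 + t * q i)) = (t * (z i - x i))\<^sup>2 / ((1 + x i) * (1 + (x i + t * (z i - x i))))" for i
          using e[of "q i" "1 + z i" "1 + x i"] qq[OF t] x[of i] by (simp add: q_def add.assoc)
        then show ?thesis by simp
      qed
      also have "\<dots> \<le> (\<Sum>j\<in>UNIV. y j * ((t * (aff a b z j - aff a b x j))\<^sup>2 / (aff a b x j * (aff a b x j + t * (aff a b z j - aff a b x j)))))"
        by (rule H[OF t0 t(2)])
      also have "\<dots> = (\<Sum>j\<in>UNIV. y j * (t * (p j - p j / (1 + t * p j))))"
        using e[OF p_def pos(1) pp[OF t]] by simp
      also have "\<dots> = t * (\<Sum>j\<in>UNIV. y j * (p j - p j / (1 + t * p j)))"
        by (simp add: sum_distrib_left mult_ac)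
      finally show ?thesis using t0 by (simp only: mult_le_cancel_left_pos diff_ge_0_iff_ge)
    qed simp
  qed auto
  moreover have "gKL 1 (aff a b z j / aff a b x j) = p j - ln (1 + p j)" for j
  proof -
    have "1 + p j = aff a b z j / aff a b x j" using pos(1)[of j] by (simp add: p_def field_simps)
    moreover have "p j = aff a b z j / aff a b x j - 1" using pos(1)[of j] by (simp add: p_def field_simps)
    ultimately show ?thesis using pos by (simp add: gKL_1)
  qed
  moreover have "gKL 1 ((1 + z i) / (1 + x i)) = q i - ln (1 + q i)" for i
  proof -
    have n: "0 < 1 + x i" "0 < 1 + z i" using x[of i] z[of i] by auto
    have "1 + q i = (1 + z i) / (1 + x i)" using n by (simp add: q_def field_simps)
    moreover have "q i = (1 + z i) / (1 + x i) - 1" using n by (simp add: q_def field_simps)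
    ultimately show ?thesis using n by (simp add: gKL_1)
  qed
  ultimately show ?thesis by simp
qed

lemma le_of_le_all_factors:
  fixes l c d :: real
  assumes "\<And>t. 0 < t \<Longrightarrow> l \<le> c + t * d"
  shows "l \<le> c"
proof (rule field_le_epsilon)
  fix \<epsilon> :: real assume e: "0 < \<epsilon>"
  have "l \<le> c + \<epsilon> / (\<bar>d\<bar> + 1) * d" by (rule assms) (use e in auto)
  also have "\<epsilon> / (\<bar>d\<bar> + 1) * d \<le> \<epsilon> / (\<bar>d\<bar> + 1) * (\<bar>d\<bar> + 1)" using e by (intro mult_left_mono) auto
  finally show "l \<le> c + \<epsilon>" by simp
qed

text \<open>Division by \<open>t\<^sup>2\<close> and \<open>t\<close> tending to 0: a comparison of
  second derivatives along one coordinate.\<close>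

lemma symmetric_limit_0:
  fixes a s y :: "'m::finite \<Rightarrow> real"
  assumes H: "\<And>t. 0 < t \<Longrightarrow> C * (g * (t\<^sup>2 / ((1 + x) * (1 + (x + t))))) \<le> (\<Sum>j\<in>UNIV. y j * ((a j * t)\<^sup>2 / (s j * (s j + a j * t))))"
    and x: "0 \<le> x" and a: "\<And>j. 0 \<le> a j" and s: "\<And>j. 0 < s j" and y: "\<And>j. 0 \<le> y j"
  shows "C * g \<le> (1 + x)\<^sup>2 * (\<Sum>j\<in>UNIV. (a j)\<^sup>2 * y j / (s j)\<^sup>2)"
proof (rule le_of_le_all_factors[where d = "(1 + x) * (\<Sum>j\<in>UNIV. (a j)\<^sup>2 * y j / (s j)\<^sup>2)"])
  fix t :: real assume t: "0 < t"
  have "C * (g * (t\<^sup>2 / ((1 + x) * (1 + (x + t))))) \<le> (\<Sum>j\<in>UNIV. y j * ((a j * t)\<^sup>2 / (s j * (s j + a j * t))))" by (rule H[OF t])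
  also have "\<dots> \<le> (\<Sum>j\<in>UNIV. y j * ((a j * t)\<^sup>2 / (s j * s j)))"
    using a s t y by (intro sum_mono mult_left_mono divide_left_mono mult_left_mono) (auto intro!: mult_pos_pos add_pos_nonneg simp: less_imp_le)
  also have "\<dots> = t\<^sup>2 * (\<Sum>j\<in>UNIV. (a j)\<^sup>2 * y j / (s j)\<^sup>2)"
    unfolding sum_distrib_left by (intro sum.cong) (auto simp: power2_eq_square mult_ac)
  finally have "t\<^sup>2 * (C * g / ((1 + x) * (1 + x + t))) \<le> t\<^sup>2 * (\<Sum>j\<in>UNIV. (a j)\<^sup>2 * y j / (s j)\<^sup>2)" by (simp add: mult_ac add.assoc)
  then have "C * g / ((1 + x) * (1 + x + t)) \<le> (\<Sum>j\<in>UNIV. (a j)\<^sup>2 * y j / (s j)\<^sup>2)"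
    using zero_less_power[OF t, of 2] by (simp only: mult_le_cancel_left_pos)
  then show "C * g \<le> (1 + x)\<^sup>2 * (\<Sum>j\<in>UNIV. (a j)\<^sup>2 * y j / (s j)\<^sup>2) + t * ((1 + x) * (\<Sum>j\<in>UNIV. (a j)\<^sup>2 * y j / (s j)\<^sup>2))"
    using x t by (simp add: pos_divide_le_eq) (simp add: algebra_simps power2_eq_square)
qed

text \<open>Division by \<open>t\<close> and \<open>t = 1 / r\<close> tending to infinity: a
  comparison of the total increase of the two derivatives along a ray.\<close>

lemma symmetric_limit_infinity:
  fixes a s y :: "'m::finite \<Rightarrow> real"
  assumes H: "\<And>t. 0 < t \<Longrightarrow> C * (g * (t\<^sup>2 / (1 + t))) \<le> (\<Sum>j\<in>UNIV. y j * ((a j * t)\<^sup>2 / (s j * (s j + a j * t))))"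
    and a: "\<And>j. 0 \<le> a j" and s: "\<And>j. 0 < s j" and y: "\<And>j. 0 \<le> y j"
  shows "C * g \<le> (\<Sum>j\<in>UNIV. a j * y j / s j)"
proof (rule le_of_le_all_factors[where d = "\<Sum>j\<in>UNIV. a j * y j / s j"])
  fix r :: real assume r: "0 < r"
  define t where "t = 1 / r"
  have t: "0 < t" using r by (simp add: t_def)
  have "C * (g * (t\<^sup>2 / (1 + t))) \<le> (\<Sum>j\<in>UNIV. y j * ((a j * t)\<^sup>2 / (s j * (s j + a j * t))))" by (rule H[OF t])
  also have "\<dots> \<le> (\<Sum>j\<in>UNIV. t * (a j * y j / s j))"
  proof (rule sum_mono)
    fix j
    have "(a j * t)\<^sup>2 / (s j * (s j + a j * t)) = a j * t / s j * (a j * t / (s j + a j * t))" by (simp add: power2_eq_square)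
    also have "\<dots> \<le> a j * t / s j * 1"
      using a[of j] s[of j] t by (intro mult_left_mono) (auto simp: divide_le_eq add_pos_nonneg)
    finally show "y j * ((a j * t)\<^sup>2 / (s j * (s j + a j * t))) \<le> t * (a j * y j / s j)"
      using mult_left_mono[OF _ y[of j]] by (fastforce simp: mult_ac)
  qed
  also have "\<dots> = t * (\<Sum>j\<in>UNIV. a j * y j / s j)" by (simp add: sum_distrib_left)
  finally have "t * (C * g * (t / (1 + t))) \<le> t * (\<Sum>j\<in>UNIV. a j * y j / s j)" by (simp add: power2_eq_square mult_ac)
  then have 1: "C * g * (t / (1 + t)) \<le> (\<Sum>j\<in>UNIV. a j * y j / s j)" using t by (simp only: mult_le_cancel_left_pos)
  have "t / (1 + t) = 1 / (1 + r)" using r by (simp add: t_def field_simps)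
  then have "C * g / (1 + r) \<le> (\<Sum>j\<in>UNIV. a j * y j / s j)" using 1 by simp
  then show "C * g \<le> (\<Sum>j\<in>UNIV. a j * y j / s j) + r * (\<Sum>j\<in>UNIV. a j * y j / s j)"
    using r by (simp add: pos_divide_le_eq algebra_simps)
qed

section \<open>Gradients of the fidelity and of the generating function\<close>

lemma gradient_eqI: "GDERIV f x :> d \<Longrightarrow> gradient f x = d"
proof -
  assume d: "GDERIV f x :> d"
  have "d' = d" if "GDERIV f x :> d'" for d'
  proof -
    have "(\<lambda>h. h \<bullet> d') = (\<lambda>h. h \<bullet> d)"
      using has_derivative_unique that d unfolding gderiv_def by blast
    then show ?thesis by (metis vector_eq_ldot)
  qed
  then show ?thesis unfolding gradient_def using d by (intro the_equality)
qed

lemma DERIV_gKL: "0 \<le> y \<Longrightarrow> 0 < z \<Longrightarrow> DERIV (gKL y) z :> 1 - y / z"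
proof (cases "y = 0")
  case True
  then have "gKL y = (\<lambda>z. z)" by (auto simp: gKL_0)
  then show ?thesis using True by simp
next
  case False
  assume a: "0 \<le> y" "0 < z"
  show ?thesis unfolding gKL_def[abs_def] using a False
    by (auto intro!: derivative_eq_intros simp: field_simps power2_eq_square)
qed

lemma GDERIV_Fid:
  assumes "\<And>j. 0 < (A *v x) $ j + b $ j"
  shows "GDERIV (Fid A y b) x :> (\<Sum>j\<in>UNIV. (1 - real (y $ j) / ((A *v x) $ j + b $ j)) *\<^sub>R A $ j)"
proof -
  have "((\<lambda>x. gKL (real (y $ j)) ((A *v x) $ j + b $ j)) has_derivative
      (\<lambda>h. (A $ j \<bullet> h) * (1 - real (y $ j) / ((A *v x) $ j + b $ j)))) (at x)" for j
    using assms by (intro DERIV_compose_FDERIV DERIV_gKL)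
      (auto simp: matrix_vector_mul_component intro!: derivative_eq_intros)
  then have "((\<lambda>x. \<Sum>j\<in>UNIV. gKL (real (y $ j)) ((A *v x) $ j + b $ j)) has_derivative
      (\<lambda>h. \<Sum>j\<in>UNIV. (A $ j \<bullet> h) * (1 - real (y $ j) / ((A *v x) $ j + b $ j)))) (at x)"
    by (intro has_derivative_sum)
  moreover have "Fid A y b = (\<lambda>x. \<Sum>j\<in>UNIV. gKL (real (y $ j)) ((A *v x) $ j + b $ j))"
    by (auto simp: Fid_def GKL_def)
  moreover have "(\<lambda>h. \<Sum>j\<in>UNIV. (A $ j \<bullet> h) * (1 - real (y $ j) / ((A *v x) $ j + b $ j)))
     = (\<lambda>h. h \<bullet> (\<Sum>j\<in>UNIV. (1 - real (y $ j) / ((A *v x) $ j + b $ j)) *\<^sub>R A $ j))"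
    by (auto simp: inner_sum_right inner_commute mult.commute)
  ultimately show ?thesis unfolding gderiv_def by simp
qed

lemma DERIV_psi:
  assumes "0 < \<xi>" "0 \<le> cmin A i * t"
  shows "DERIV (psi A \<xi> \<gamma> i) t :> \<gamma> $ i * cmin A i * (cmin A i * t / (cmin A i * t + \<xi>))"
proof -
  have p: "0 < cmin A i * t + \<xi>" using assms by simp
  have "((\<lambda>t. \<gamma> $ i * gKL \<xi> (cmin A i * t + \<xi>)) has_real_derivative
      \<gamma> $ i * ((1 - \<xi> / (cmin A i * t + \<xi>)) * cmin A i)) (at t)"
    using assms p by (intro DERIV_cmult DERIV_chain'[where g = "gKL \<xi>"] DERIV_gKL) (auto intro!: derivative_eq_intros)
  moreover have "1 - \<xi> / (cmin A i * t + \<xi>) = cmin A i * t / (cmin A i * t + \<xi>)" using p by (simp add: field_simps)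
  ultimately show ?thesis unfolding psi_def[abs_def] by (simp add: mult_ac)
qed

lemma GDERIV_Psi:
  assumes "0 < \<xi>" "\<And>i. 0 \<le> cmin A i * x $ i"
  shows "GDERIV (Psi A \<xi> \<gamma>) x :> (\<chi> i. \<gamma> $ i * cmin A i * (cmin A i * x $ i / (cmin A i * x $ i + \<xi>)))"
proof -
  have "((\<lambda>x. psi A \<xi> \<gamma> i (x $ i)) has_derivative
     (\<lambda>h. h $ i * (\<gamma> $ i * cmin A i * (cmin A i * x $ i / (cmin A i * x $ i + \<xi>))))) (at x)" for i
    by (rule DERIV_compose_FDERIV[where g' = "\<lambda>h. h $ i" and g = "\<lambda>x. x $ i", OF DERIV_psi])
      (use assms in \<open>auto intro!: bounded_linear_imp_has_derivative bounded_linear_vec_nth\<close>)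
  then have "((\<lambda>x. \<Sum>i\<in>UNIV. psi A \<xi> \<gamma> i (x $ i)) has_derivative
     (\<lambda>h. \<Sum>i\<in>UNIV. h $ i * (\<gamma> $ i * cmin A i * (cmin A i * x $ i / (cmin A i * x $ i + \<xi>))))) (at x)"
    by (intro has_derivative_sum)
  moreover have "Psi A \<xi> \<gamma> = (\<lambda>x. \<Sum>i\<in>UNIV. psi A \<xi> \<gamma> i (x $ i))" by (auto simp: Psi_def)
  ultimately show ?thesis unfolding gderiv_def by (simp add: inner_vec_def)
qed

section \<open>Normalised coordinates\<close>

locale poisson_setting =
  fixes A :: "real^'n^'m" and b :: "real^'m" and y :: "nat^'m" and \<xi> :: real and \<gamma> :: "real^'n"
  assumes A_nonneg: "\<And>j i. 0 \<le> A $ j $ i"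
    and A_col: "\<And>i. column i A \<noteq> 0"
    and xi: "0 < \<xi>" "\<And>j. \<xi> \<le> b $ j"
    and gamma_gt: "\<And>i. (\<Sum>j\<in>UNIV. (A $ j $ i)\<^sup>2 * real (y $ j)) / ((cmin A i)\<^sup>2 * \<xi>) < \<gamma> $ i"
begin

abbreviation "c \<equiv> cmin A"

text \<open>Dividing the columns by \<open>c\<^sub>i\<close>, data and background by \<open>\<xi>\<close>, and measuring \<open>x\<^sub>i\<close> in units of
  \<open>\<xi> / c\<^sub>i\<close> reduces to \<open>\<xi> = 1\<close>, \<open>c\<^sub>i = 1\<close>; then nonzero entries and backgrounds are at least 1.\<close>

definition na :: "'m \<Rightarrow> 'n \<Rightarrow> real" where "na j i = A $ j $ i / c i"
definition nb :: "'m \<Rightarrow> real" where "nb j = b $ j / \<xi>"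
definition ny :: "'m \<Rightarrow> real" where "ny j = real (y $ j) / \<xi>"
definition nx :: "real^'n \<Rightarrow> 'n \<Rightarrow> real" where "nx x i = c i * x $ i / \<xi>"

abbreviation "sg x \<equiv> aff na nb (nx x)"

lemma cmin: "0 < c i" "A $ j $ i \<noteq> 0 \<Longrightarrow> c i \<le> A $ j $ i"
proof -
  define M where "M = {A $ j $ i | j. A $ j $ i \<noteq> 0}"
  have fin: "finite M" by (simp add: M_def)
  have "\<exists>j. A $ j $ i \<noteq> 0" using A_col[of i] by (auto simp: column_def vec_eq_iff)
  then have "M \<noteq> {}" by (auto simp: M_def)
  then have "c i \<in> M" using Min_in[OF fin] by (simp add: cmin_def M_def)
  then show "0 < c i" using A_nonneg by (auto simp: M_def less_le)
  show "A $ j $ i \<noteq> 0 \<Longrightarrow> c i \<le> A $ j $ i"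
    unfolding cmin_def M_def[symmetric] by (rule Min_le[OF fin]) (auto simp: M_def)
qed

lemma na01: "na j i = 0 \<or> 1 \<le> na j i"
  using cmin(1)[of i] cmin(2)[of j i] by (cases "A $ j $ i = 0") (auto simp: na_def)

lemma na0: "0 \<le> na j i" using na01[of j i] by auto

lemma nb1: "1 \<le> nb j" using xi by (simp add: nb_def)

lemma ny0: "0 \<le> ny j" using xi by (simp add: ny_def)

lemma ng: "(\<Sum>j\<in>UNIV. (na j i)\<^sup>2 * ny j) < \<gamma> $ i"
proof -
  have "(\<Sum>j\<in>UNIV. (na j i)\<^sup>2 * ny j) = (\<Sum>j\<in>UNIV. (A $ j $ i)\<^sup>2 * real (y $ j)) / ((c i)\<^sup>2 * \<xi>)"
    unfolding sum_divide_distrib by (intro sum.cong) (auto simp: na_def ny_def power_divide)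
  then show ?thesis using gamma_gt[of i] by simp
qed

lemma gamma_pos: "0 < \<gamma> $ i"
  using ng[of i] sum_nonneg[of UNIV "\<lambda>j. (na j i)\<^sup>2 * ny j"] ny0 by simp

lemma nx0: "0 \<le> x \<Longrightarrow> 0 \<le> nx x i"
  using cmin(1)[of i] xi by (simp add: nx_def less_eq_vec_def)

lemma sg: "sg x j = ((A *v x) $ j + b $ j) / \<xi>"
proof -
  have "(\<Sum>i\<in>UNIV. na j i * nx x i) = (\<Sum>i\<in>UNIV. A $ j $ i * x $ i) / \<xi>"
    unfolding sum_divide_distrib using cmin(1) by (intro sum.cong) (auto simp: na_def nx_def less_le)
  then show ?thesis by (simp add: aff_def nb_def matrix_vector_mult_def add_divide_distrib)
qed

lemma sg_ge1: "0 \<le> x \<Longrightarrow> 1 \<le> sg x j"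
  using nb1[of j] na0 nx0 by (auto simp: aff_def intro!: add_increasing2 sum_nonneg mult_nonneg_nonneg)

lemma z_pos: "0 \<le> x \<Longrightarrow> 0 < (A *v x) $ j + b $ j"
  using sg_ge1[of x j] xi(1) by (simp add: sg pos_le_divide_eq)

lemma gKL_scale: "0 < r \<Longrightarrow> gKL (p / r) (z / r) = gKL p z / r"
  by (simp add: gKL_def diff_divide_distrib add_divide_distrib)

lemma Fid_eq: "Fid A y b x = \<xi> * (\<Sum>j\<in>UNIV. gKL (ny j) (sg x j))"
  using xi(1) by (simp add: Fid_def GKL_def sg ny_def gKL_scale sum_divide_distrib[symmetric])

lemma Fid_nonneg: "0 \<le> x \<Longrightarrow> 0 \<le> Fid A y b x"
  unfolding Fid_eq using xi(1) sg_ge1[of x] ny0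
  by (intro mult_nonneg_nonneg sum_nonneg gKL_nonneg) (auto intro: less_le_trans[OF zero_less_one])

lemma gradient_Fid: "0 \<le> x \<Longrightarrow> gradient (Fid A y b) x = (\<Sum>j\<in>UNIV. (1 - ny j / sg x j) *\<^sub>R A $ j)"
  using GDERIV_Fid[of A x b y] z_pos[of x] xi(1) by (simp add: gradient_eqI ny_def sg)

lemma gradient_Fid_component: "0 \<le> x \<Longrightarrow>
    gradient (Fid A y b) x $ i = - c i * (\<Sum>j\<in>UNIV. na j i * (ny j / sg x j - 1))"
proof -
  assume x: "0 \<le> x"
  have "gradient (Fid A y b) x $ i = (\<Sum>j\<in>UNIV. (1 - ny j / sg x j) * A $ j $ i)"
    by (simp add: gradient_Fid[OF x])
  also have "\<dots> = (\<Sum>j\<in>UNIV. - c i * (na j i * (ny j / sg x j - 1)))"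
    using cmin(1)[of i] by (intro sum.cong) (auto simp: na_def algebra_simps)
  finally show ?thesis by (simp add: sum_distrib_left)
qed

lemma inner_row: "A $ j \<bullet> (x' - x) = \<xi> * (sg x' j - sg x j)"
  using xi(1) by (simp add: sg inner_diff_right matrix_vector_mul_component[symmetric] diff_divide_distrib[symmetric])

lemma Fid_expand:
  assumes "0 \<le> x" "0 \<le> x'"
  shows "Fid A y b x' - Fid A y b x = gradient (Fid A y b) x \<bullet> (x' - x) + \<xi> * (\<Sum>j\<in>UNIV. ny j * gKL 1 (sg x' j / sg x j))"
proof -
  have "Fid A y b x' - Fid A y b x = \<xi> * (\<Sum>j\<in>UNIV. gKL (ny j) (sg x' j) - gKL (ny j) (sg x j))"
    by (simp add: Fid_eq sum_subtractf right_diff_distrib)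
  also have "\<dots> = \<xi> * (\<Sum>j\<in>UNIV. (1 - ny j / sg x j) * (sg x' j - sg x j) + ny j * gKL 1 (sg x' j / sg x j))"
  proof -
    have "gKL (ny j) (sg x' j) - gKL (ny j) (sg x j) = (1 - ny j / sg x j) * (sg x' j - sg x j) + ny j * gKL 1 (sg x' j / sg x j)" for j
      using sg_ge1[OF assms(1), of j] sg_ge1[OF assms(2), of j] ny0 by (intro gKL_three_point) auto
    then show ?thesis by simp
  qed
  also have "\<dots> = (\<Sum>j\<in>UNIV. (1 - ny j / sg x j) * (A $ j \<bullet> (x' - x))) + \<xi> * (\<Sum>j\<in>UNIV. ny j * gKL 1 (sg x' j / sg x j))"
    by (simp add: sum.distrib distrib_left inner_row sum_distrib_left mult_ac)
  finally show ?thesis by (simp add: gradient_Fid[OF assms(1)] inner_sum_left)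
qed

lemma sym_bregman_Fid:
  assumes "0 \<le> x" "0 \<le> x'"
  shows "sym_bregman (Fid A y b) x x' = \<xi> * (\<Sum>j\<in>UNIV. ny j * ((sg x' j - sg x j)\<^sup>2 / (sg x j * sg x' j)))"
proof -
  have "sym_bregman (Fid A y b) x x' = (\<Sum>j\<in>UNIV. ((1 - ny j / sg x' j) - (1 - ny j / sg x j)) * (A $ j \<bullet> (x' - x)))"
    unfolding sym_bregman_def gradient_Fid[OF assms(1)] gradient_Fid[OF assms(2)] sum_subtractf[symmetric]
      scaleR_diff_left[symmetric] inner_sum_left by simp
  also have "\<dots> = (\<Sum>j\<in>UNIV. \<xi> * (ny j * ((sg x' j - sg x j)\<^sup>2 / (sg x j * sg x' j))))"
  proof (rule sum.cong)
    fix j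
    have p: "0 < sg x j" "0 < sg x' j" using sg_ge1[OF assms(1), of j] sg_ge1[OF assms(2), of j] by auto
    have "(1 - ny j / sg x' j) - (1 - ny j / sg x j) = ny j * ((sg x' j - sg x j) / (sg x j * sg x' j))"
      using p by (simp add: field_simps)
    then show "((1 - ny j / sg x' j) - (1 - ny j / sg x j)) * (A $ j \<bullet> (x' - x)) = \<xi> * (ny j * ((sg x' j - sg x j)\<^sup>2 / (sg x j * sg x' j)))"
      by (simp add: inner_row power2_eq_square)
  qed simp
  finally show ?thesis by (simp add: sum_distrib_left)
qed

definition dpsi :: "'n \<Rightarrow> real \<Rightarrow> real" where
  "dpsi i t = \<gamma> $ i * c i * (c i * t / \<xi> / (1 + c i * t / \<xi>))"

lemma ratio_nx: "0 \<le> t \<Longrightarrow> c i * t / (c i * t + \<xi>) = c i * t / \<xi> / (1 + c i * t / \<xi>)"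
proof -
  assume t: "0 \<le> t"
  have "1 + c i * t / \<xi> = (c i * t + \<xi>) / \<xi>" using xi(1) by (simp add: field_simps)
  then show ?thesis using xi(1) by simp
qed

lemma DERIV_psi': "0 \<le> t \<Longrightarrow> DERIV (psi A \<xi> \<gamma> i) t :> dpsi i t"
  using DERIV_psi[of \<xi> A i t \<gamma>] cmin(1)[of i] xi(1) by (simp add: dpsi_def ratio_nx)

lemma deriv_psi: "0 \<le> t \<Longrightarrow> deriv (psi A \<xi> \<gamma> i) t = dpsi i t"
  by (rule DERIV_imp_deriv[OF DERIV_psi'])

lemma gradient_Psi: "0 \<le> x \<Longrightarrow> gradient (Psi A \<xi> \<gamma>) x = (\<chi> i. dpsi i (x $ i))"
proof -
  assume x: "0 \<le> x"
  then have x': "0 \<le> x $ i" for i by (simp add: less_eq_vec_def)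
  then have "gradient (Psi A \<xi> \<gamma>) x = (\<chi> i. \<gamma> $ i * c i * (c i * x $ i / (c i * x $ i + \<xi>)))"
    using cmin(1) xi(1) by (intro gradient_eqI GDERIV_Psi) (auto intro: mult_nonneg_nonneg less_imp_le)
  then show ?thesis using x' by (simp add: dpsi_def ratio_nx)
qed

lemma sym_bregman_Psi:
  assumes "0 \<le> x" "0 \<le> x'"
  shows "sym_bregman (Psi A \<xi> \<gamma>) x x' = \<xi> * (\<Sum>i\<in>UNIV. \<gamma> $ i * ((nx x' i - nx x i)\<^sup>2 / ((1 + nx x i) * (1 + nx x' i))))"
proof -
  have "sym_bregman (Psi A \<xi> \<gamma>) x x' = (\<Sum>i\<in>UNIV. (dpsi i (x' $ i) - dpsi i (x $ i)) * (x' $ i - x $ i))"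
    unfolding sym_bregman_def gradient_Psi[OF assms(1)] gradient_Psi[OF assms(2)] by (simp add: inner_vec_def)
  also have "\<dots> = (\<Sum>i\<in>UNIV. \<xi> * (\<gamma> $ i * ((nx x' i - nx x i)\<^sup>2 / ((1 + nx x i) * (1 + nx x' i)))))"
  proof (rule sum.cong)
    fix i
    have p: "0 < 1 + nx x i" "0 < 1 + nx x' i" using nx0[OF assms(1), of i] nx0[OF assms(2), of i] by auto
    have "dpsi i (x' $ i) - dpsi i (x $ i) = \<gamma> $ i * c i * (nx x' i / (1 + nx x' i) - nx x i / (1 + nx x i))"
      by (simp add: dpsi_def nx_def right_diff_distrib)
    also have "nx x' i / (1 + nx x' i) - nx x i / (1 + nx x i) = (nx x' i - nx x i) / ((1 + nx x i) * (1 + nx x' i))"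
      using p by (simp add: divide_simps) (simp add: algebra_simps)
    finally have "dpsi i (x' $ i) - dpsi i (x $ i) = \<gamma> $ i * c i * ((nx x' i - nx x i) / ((1 + nx x i) * (1 + nx x' i)))" .
    moreover have "c i * (x' $ i - x $ i) = \<xi> * (nx x' i - nx x i)" using xi(1) by (simp add: nx_def right_diff_distrib)
    ultimately show "(dpsi i (x' $ i) - dpsi i (x $ i)) * (x' $ i - x $ i) = \<xi> * (\<gamma> $ i * ((nx x' i - nx x i)\<^sup>2 / ((1 + nx x i) * (1 + nx x' i))))"
      by (simp add: power2_eq_square mult_ac)
  qed simp
  finally show ?thesis by (simp add: sum_distrib_left)
qed

lemma psi_eq: "0 \<le> t \<Longrightarrow> psi A \<xi> \<gamma> i t = \<gamma> $ i * \<xi> * (c i * t / \<xi> - ln (1 + c i * t / \<xi>))"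
proof -
  assume t: "0 \<le> t"
  have p: "0 < c i * t + \<xi>" using t cmin(1)[of i] xi(1) by (simp add: add_nonneg_pos)
  have "1 + c i * t / \<xi> = (c i * t + \<xi>) / \<xi>" using xi(1) by (simp add: add_divide_distrib add.commute)
  then have L: "ln (\<xi> / (c i * t + \<xi>)) = - ln (1 + c i * t / \<xi>)" using p xi(1) by (simp add: ln_div)
  show ?thesis unfolding psi_def gKL_def L using xi(1) by (simp add: right_diff_distrib)
qed

lemma bregman_psi:
  assumes "0 \<le> t" "0 \<le> t'"
  shows "bregman1 (psi A \<xi> \<gamma> i) t t' = \<gamma> $ i * \<xi> * gKL 1 ((1 + c i * t / \<xi>) / (1 + c i * t' / \<xi>))"
proof -
  define n where "n = c i * t / \<xi>" define n' where "n' = c i * t' / \<xi>"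
  have p: "0 < 1 + n" "0 < 1 + n'" using assms cmin(1)[of i] xi(1) by (auto simp: n_def n'_def add_pos_nonneg)
  have D: "dpsi i t' * (t - t') = \<gamma> $ i * \<xi> * (n' / (1 + n') * (n - n'))"
  proof -
    have "\<xi> * (n - n') = c i * (t - t')" using xi(1) by (simp add: n_def n'_def right_diff_distrib)
    moreover have "dpsi i t' * (t - t') = \<gamma> $ i * (n' / (1 + n')) * (c i * (t - t'))"
      by (simp add: dpsi_def n'_def)
    ultimately show ?thesis by simp
  qed
  have "bregman1 (psi A \<xi> \<gamma> i) t t' = \<gamma> $ i * \<xi> * (n - ln (1 + n) - (n' - ln (1 + n')) - n' / (1 + n') * (n - n'))"
    unfolding bregman1_def deriv_psi[OF assms(2)] D
      psi_eq[OF assms(1), of i, folded n_def] psi_eq[OF assms(2), of i, folded n'_def]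
    by (simp only: right_diff_distrib)
  also have "n - ln (1 + n) - (n' - ln (1 + n')) - n' / (1 + n') * (n - n') = gKL 1 ((1 + n) / (1 + n'))"
  proof -
    have "n - n' - n' / (1 + n') * (n - n') = (1 + n) / (1 + n') - 1"
      using p by (simp add: divide_simps) (simp add: algebra_simps)
    then show ?thesis using p by (simp add: gKL_1 ln_div)
  qed
  finally show ?thesis by (simp add: n_def n'_def)
qed

section \<open>Restricted strong convexity at one base point\<close>

definition brsc_at :: "real \<Rightarrow> nat \<Rightarrow> real^'n \<Rightarrow> bool" where
  "brsc_at C K x \<longleftrightarrow> 0 \<le> x \<and> (\<forall>x'. 0 \<le> x' \<longrightarrow> x' \<noteq> x \<longrightarrow> l0norm (x - x') \<le> K \<longrightarrow>
     C * sym_bregman (Psi A \<xi> \<gamma>) x x' \<le> sym_bregman (Fid A y b) x x')"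

lemma brsc_sym:
  assumes "brsc_at C K x" "0 \<le> x'" "l0norm (x - x') \<le> K"
  shows "C * (\<Sum>i\<in>UNIV. \<gamma> $ i * ((nx x' i - nx x i)\<^sup>2 / ((1 + nx x i) * (1 + nx x' i))))
    \<le> (\<Sum>j\<in>UNIV. ny j * ((sg x' j - sg x j)\<^sup>2 / (sg x j * sg x' j)))"
proof (cases "x' = x")
  case False
  have x: "0 \<le> x" using assms by (simp add: brsc_at_def)
  have "C * sym_bregman (Psi A \<xi> \<gamma>) x x' \<le> sym_bregman (Fid A y b) x x'"
    using assms False by (simp add: brsc_at_def)
  then have "\<xi> * (C * (\<Sum>i\<in>UNIV. \<gamma> $ i * ((nx x' i - nx x i)\<^sup>2 / ((1 + nx x i) * (1 + nx x' i)))))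
    \<le> \<xi> * (\<Sum>j\<in>UNIV. ny j * ((sg x' j - sg x j)\<^sup>2 / (sg x j * sg x' j)))"
    by (simp add: sym_bregman_Psi[OF x assms(2)] sym_bregman_Fid[OF x assms(2)] mult_ac)
  then show ?thesis using xi(1) by (simp only: mult_le_cancel_left_pos)
qed simp

lemma l0norm_scaleR_le: "l0norm (t *\<^sub>R x) \<le> l0norm x"
  unfolding l0norm_def supp_def by (intro card_mono) auto

lemma l0norm_minus: "l0norm (- x) = l0norm x"
  by (simp add: l0norm_def supp_def)

lemma nx_segment: "nx (x + t *\<^sub>R (z - x)) i = nx x i + t * (nx z i - nx x i)"
  by (simp add: nx_def add_divide_distrib algebra_simps diff_divide_distrib)

lemma sg_segment: "sg (x + t *\<^sub>R (z - x)) j = sg x j + t * (sg z j - sg x j)"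
proof -
  have "(\<Sum>i\<in>UNIV. na j i * nx (x + t *\<^sub>R (z - x)) i) = (\<Sum>i\<in>UNIV. na j i * nx x i + t * (na j i * nx z i - na j i * nx x i))"
    unfolding nx_segment by (intro sum.cong) (auto simp: algebra_simps)
  then show ?thesis by (simp add: aff_def sum.distrib sum_distrib_left[symmetric] sum_subtractf)
qed

lemma segment_nonneg:
  assumes "0 \<le> x" "0 \<le> (z::real^'n)" "0 \<le> t" "t \<le> 1" shows "0 \<le> x + t *\<^sub>R (z - x)"
proof -
  have "0 \<le> x $ i + t * (z $ i - x $ i)" for i
  proof -
    have "0 \<le> (1 - t) * x $ i + t * z $ i" using assms by (auto simp: less_eq_vec_def)
    then show ?thesis by (simp add: algebra_simps)
  qed
  then show ?thesis by (simp add: less_eq_vec_def)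
qed

text \<open>Scaling a difference does not enlarge its support, so the sparsity bound holds along the
  whole segment and the symmetric inequality can be integrated.\<close>

lemma brsc_bregman:
  assumes "brsc_at C K x" "0 \<le> z" "l0norm (x - z) \<le> K"
  shows "C * (\<Sum>i\<in>UNIV. \<gamma> $ i * gKL 1 ((1 + nx z i) / (1 + nx x i))) \<le> (\<Sum>j\<in>UNIV. ny j * gKL 1 (sg z j / sg x j))"
proof (rule bregman_from_symmetric)
  have x: "0 \<le> x" using assms by (simp add: brsc_at_def)
  show "0 \<le> nx x i" "0 \<le> nx z i" for i using x assms by (auto intro: nx0)
  show "0 < sg x j" "0 < sg z j" for j using sg_ge1[OF x, of j] sg_ge1[OF assms(2), of j] by auto
  fix t :: real assume t: "0 < t" "t \<le> 1"
  have e: "x - (x + t *\<^sub>R (z - x)) = t *\<^sub>R (x - z)" by (simp add: algebra_simps)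
  have "l0norm (x - (x + t *\<^sub>R (z - x))) \<le> K"
    unfolding e using l0norm_scaleR_le[of t "x - z"] assms(3) by simp
  from brsc_sym[OF assms(1) segment_nonneg[OF x assms(2)] this] t
  show "C * (\<Sum>i\<in>UNIV. \<gamma> $ i * ((t * (nx z i - nx x i))\<^sup>2 / ((1 + nx x i) * (1 + (nx x i + t * (nx z i - nx x i))))))
      \<le> (\<Sum>j\<in>UNIV. ny j * ((t * (sg z j - sg x j))\<^sup>2 / (sg x j * (sg x j + t * (sg z j - sg x j)))))"
    by (simp add: nx_segment sg_segment)
qed

lemma brsc_axis:
  assumes "brsc_at C K x" "1 \<le> K" "0 < t"
  shows "C * (\<gamma> $ i * (t\<^sup>2 / ((1 + nx x i) * (1 + (nx x i + t)))))
    \<le> (\<Sum>j\<in>UNIV. ny j * ((na j i * t)\<^sup>2 / (sg x j * (sg x j + na j i * t))))"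
proof -
  have x: "0 \<le> x" using assms by (simp add: brsc_at_def)
  \<comment> \<open>The length makes this a move by exactly \<open>t\<close> in the normalised
    coordinate.\<close>
  define x' where "x' = x + axis i (\<xi> * t / c i)"
  have ax: "axis i r $ k = (if k = i then r else 0)" for k and r :: real by (simp add: axis_def)
  have x': "0 \<le> x'" using x cmin(1)[of i] xi(1) assms(3) by (auto simp: less_eq_vec_def x'_def ax add_nonneg_nonneg)
  have nx': "nx x' k = nx x k + (if k = i then t else 0)" for k
    using cmin(1)[of i] xi(1) by (simp add: x'_def nx_def ax distrib_left add_divide_distrib)
  have sg': "sg x' j = sg x j + na j i * t" for j
  proof -
    have "(\<Sum>k\<in>UNIV. na j k * nx x' k) = (\<Sum>k\<in>UNIV. na j k * nx x k + (if k = i then na j i * t else 0))"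
      by (intro sum.cong) (auto simp: nx' distrib_left)
    then show ?thesis by (simp add: aff_def sum.distrib)
  qed
  have "supp (x - x') \<subseteq> {i}" by (auto simp: supp_def x'_def ax split: if_splits)
  then have "l0norm (x - x') \<le> 1" unfolding l0norm_def using card_mono[of "{i}"] by fastforce
  then have "C * (\<Sum>k\<in>UNIV. \<gamma> $ k * ((nx x' k - nx x k)\<^sup>2 / ((1 + nx x k) * (1 + nx x' k))))
    \<le> (\<Sum>j\<in>UNIV. ny j * ((sg x' j - sg x j)\<^sup>2 / (sg x j * sg x' j)))"
    using brsc_sym[OF assms(1) x'] assms(2) by simp
  moreover have "(\<Sum>k\<in>UNIV. \<gamma> $ k * ((nx x' k - nx x k)\<^sup>2 / ((1 + nx x k) * (1 + nx x' k))))
    = (\<Sum>k\<in>UNIV. if k = i then \<gamma> $ i * (t\<^sup>2 / ((1 + nx x i) * (1 + (nx x i + t)))) else 0)"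
    by (intro sum.cong) (auto simp: nx')
  ultimately show ?thesis by (simp add: sg')
qed

lemma brsc_limit_0:
  assumes "brsc_at C K x" "1 \<le> K"
  shows "C * \<gamma> $ i \<le> (1 + nx x i)\<^sup>2 * (\<Sum>j\<in>UNIV. (na j i)\<^sup>2 * ny j / (sg x j)\<^sup>2)"
proof (rule symmetric_limit_0[OF brsc_axis[OF assms]])
  have x: "0 \<le> x" using assms by (simp add: brsc_at_def)
  show "0 \<le> nx x i" using x by (rule nx0)
  show "0 < sg x j" for j using sg_ge1[OF x, of j] by simp
qed (use na0 ny0 in auto)

lemma brsc_limit_infinity:
  assumes "brsc_at C K x" "1 \<le> K" "x $ i = 0"
  shows "C * \<gamma> $ i \<le> (\<Sum>j\<in>UNIV. na j i * ny j / sg x j)"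
proof (rule symmetric_limit_infinity)
  have x: "0 \<le> x" using assms by (simp add: brsc_at_def)
  show "0 < sg x j" for j using sg_ge1[OF x, of j] by simp
  show "C * (\<gamma> $ i * (t\<^sup>2 / (1 + t))) \<le> (\<Sum>j\<in>UNIV. ny j * ((na j i * t)\<^sup>2 / (sg x j * (sg x j + na j i * t))))"
    if "0 < t" for t using brsc_axis[OF assms(1,2) that, of i] assms(3) by (simp add: nx_def)
qed (use na0 ny0 in auto)

text \<open>A single coordinate move already forces \<open>C < 1\<close>, because \<open>\<gamma>\<close> dominates the coordinatewise curvature of the fidelity.\<close>

lemma brsc_C_less_1:
  assumes "brsc_at C K x" "1 \<le> K" shows "C < 1"
proof -
  fix i :: 'n
  have x: "0 \<le> x" using assms by (simp add: brsc_at_def)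
  have p: "1 \<le> 1 + nx x i" using nx0[OF x, of i] by simp
  have "C * \<gamma> $ i \<le> (1 + nx x i)\<^sup>2 * (\<Sum>j\<in>UNIV. (na j i)\<^sup>2 * ny j / (sg x j)\<^sup>2)" by (rule brsc_limit_0[OF assms])
  also have "\<dots> = (\<Sum>j\<in>UNIV. (na j i)\<^sup>2 * ny j * ((1 + nx x i)\<^sup>2 / (sg x j)\<^sup>2))"
    unfolding sum_distrib_left by (intro sum.cong) (auto simp: mult_ac)
  also have "\<dots> \<le> (\<Sum>j\<in>UNIV. (na j i)\<^sup>2 * ny j)"
  proof (rule sum_mono)
    fix j
    show "(na j i)\<^sup>2 * ny j * ((1 + nx x i)\<^sup>2 / (sg x j)\<^sup>2) \<le> (na j i)\<^sup>2 * ny j"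
    proof (cases "na j i = 0")
      case False
      then have "nx x i \<le> na j i * nx x i" using na01[of j i] nx0[OF x, of i] by (simp add: mult_le_cancel_right1)
      also have "\<dots> \<le> (\<Sum>i\<in>UNIV. na j i * nx x i)" using na0 nx0[OF x] by (intro member_le_sum) auto
      finally have "1 + nx x i \<le> sg x j" using nb1[of j] by (simp add: aff_def)
      then have "(1 + nx x i)\<^sup>2 \<le> (sg x j)\<^sup>2" using p by (intro power_mono) auto
      then have "(1 + nx x i)\<^sup>2 / (sg x j)\<^sup>2 \<le> 1" using sg_ge1[OF x, of j] by (simp add: divide_le_eq)
      then show ?thesis using ny0[of j] by (intro mult_left_le) auto
    qed simp
  qed
  also have "\<dots> < \<gamma> $ i" by (rule ng)
  finally have "C * \<gamma> $ i < 1 * \<gamma> $ i" by simp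
  then show ?thesis using gamma_pos[of i] by (simp only: mult_less_cancel_right_pos)
qed

lemma first_order:
  assumes x: "0 \<le> x" and z: "0 \<le> z" and min: "\<And>t. 0 < t \<Longrightarrow> t < 1 \<Longrightarrow> Fid A y b x \<le> Fid A y b (x + t *\<^sub>R (z - x))"
  shows "0 \<le> gradient (Fid A y b) x \<bullet> (z - x)"
proof (rule ccontr)
  assume n: "\<not> ?thesis"
  have G: "(Fid A y b has_derivative (\<lambda>h. h \<bullet> gradient (Fid A y b) x)) (at x)"
    using GDERIV_Fid[OF z_pos[OF x], of y] gradient_eqI[OF GDERIV_Fid[OF z_pos[OF x], of y]]
    by (simp add: gderiv_def)
  have "((\<lambda>t. Fid A y b (x + t *\<^sub>R (z - x))) has_derivative (\<lambda>t. (t *\<^sub>R (z - x)) \<bullet> gradient (Fid A y b) x)) (at 0)"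
    by (rule has_derivative_compose[of "\<lambda>t. x + t *\<^sub>R (z - x)" "\<lambda>t. t *\<^sub>R (z - x)"])
      (use G in \<open>auto intro!: derivative_eq_intros\<close>)
  then have "DERIV (\<lambda>t. Fid A y b (x + t *\<^sub>R (z - x))) 0 :> gradient (Fid A y b) x \<bullet> (z - x)"
    by (simp add: has_field_derivative_def inner_commute mult_commute_abs)
  from DERIV_neg_dec_right[OF this] n obtain d where d: "0 < d"
    "\<And>h. 0 < h \<Longrightarrow> h < d \<Longrightarrow> Fid A y b (x + h *\<^sub>R (z - x)) < Fid A y b x" by auto
  have "Fid A y b (x + min (d / 2) (1 / 2) *\<^sub>R (z - x)) < Fid A y b x" using d(1) by (intro d(2)) (auto simp: min_def)
  moreover have "Fid A y b x \<le> Fid A y b (x + min (d / 2) (1 / 2) *\<^sub>R (z - x))" using d(1) by (intro min) (auto simp: min_def)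
  ultimately show False by simp
qed

end

section \<open>The oracle and the safe region\<close>

locale oracle_setting = poisson_setting A b y \<xi> \<gamma>
  for A :: "real^'n^'m" and b :: "real^'m" and y :: "nat^'m" and \<xi> :: real and \<gamma> :: "real^'n" +
  fixes C :: real and K :: nat and S :: "'n set" and xs xo :: "real^'n"
  assumes C_pos: "0 < C"
    and S: "S = supp xs" "S \<noteq> {}"
    and K: "2 * card S \<le> K" "K \<le> CARD('n)"
    and brsc_xs: "brsc_at C K xs" and brsc_xo: "brsc_at C K xo"
    and xo_supp: "supp xo \<subseteq> S"
    and xo_min: "\<And>x. 0 \<le> x \<Longrightarrow> supp x \<subseteq> S \<Longrightarrow> Fid A y b xo \<le> Fid A y b x"
begin

lemma card_S: "1 \<le> card S" using S(2) by (simp add: Suc_leI card_gt_0_iff)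

lemma K1: "1 \<le> K" "card S \<le> K" using K card_S by auto

lemma xs0: "0 \<le> xs" and xo0: "0 \<le> xo" using brsc_xs brsc_xo by (auto simp: brsc_at_def)

lemma C_less_1: "C < 1" by (rule brsc_C_less_1[OF brsc_xs K1(1)])

lemma xs_pos: "i \<in> S \<Longrightarrow> 0 < xs $ i" "i \<notin> S \<Longrightarrow> xs $ i = 0"
  using xs0 by (auto simp: S supp_def less_eq_vec_def less_le)

lemma xo_off: "i \<notin> S \<Longrightarrow> xo $ i = 0" using xo_supp by (auto simp: supp_def)

text \<open>Even the estimates on the support rely on such a column, through
  \<open>untouched_share\<close>.\<close>

lemma off_support_exists: obtains i where "i \<notin> S"
proof -
  have "card S < CARD('n)" using K card_S by simp
  then have "S \<noteq> UNIV" by auto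
  then show ?thesis using that by auto
qed

lemma gradient_xo_variation:
  assumes "0 \<le> z" "supp z \<subseteq> S" shows "0 \<le> gradient (Fid A y b) xo \<bullet> (z - xo)"
proof (rule first_order[OF xo0 assms(1)])
  fix t :: real assume "0 < t" "t < 1"
  moreover have "z $ i = 0" if "i \<notin> S" for i using that assms(2) by (auto simp: supp_def)
  then have "supp (xo + t *\<^sub>R (z - xo)) \<subseteq> S" using xo_off by (force simp: supp_def)
  ultimately show "Fid A y b xo \<le> Fid A y b (xo + t *\<^sub>R (z - xo))"
    using assms(1) by (intro xo_min segment_nonneg xo0) auto
qed

lemma gradient_xo_zero: assumes "i \<in> S" "0 < xo $ i" shows "gradient (Fid A y b) xo $ i = 0"
proof -
  have ax: "axis i r $ k = (if k = i then r else 0)" for k and r :: real by (simp add: axis_def)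
  have "0 \<le> gradient (Fid A y b) xo \<bullet> (xo + axis i r - xo)" if "- (xo $ i) \<le> r" for r
  proof (rule gradient_xo_variation)
    show "0 \<le> xo + axis i r" using xo0 that by (auto simp: less_eq_vec_def ax)
    show "supp (xo + axis i r) \<subseteq> S" using xo_off assms(1) by (auto simp: supp_def ax split: if_splits)
  qed
  then have "0 \<le> gradient (Fid A y b) xo $ i * r" if "- (xo $ i) \<le> r" for r
    using that by (simp add: inner_axis)
  from this[of 1] this[of "- (xo $ i)"] show ?thesis
    using assms(2) by (simp add: mult_le_0_iff)
qed

lemma l0norm_subset: "supp x \<subseteq> S' \<Longrightarrow> l0norm x \<le> card S'"
  unfolding l0norm_def by (intro card_mono) auto

lemma kl_sum_S: "(\<Sum>i\<in>UNIV. \<gamma> $ i * gKL 1 ((1 + nx xs i) / (1 + nx xo i))) = (\<Sum>i\<in>S. \<gamma> $ i * gKL 1 ((1 + nx xs i) / (1 + nx xo i)))"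
  by (rule sum.mono_neutral_right) (auto simp: nx_def xs_pos xo_off gKL_1)

lemma energy: "C * (\<Sum>i\<in>S. \<gamma> $ i * gKL 1 ((1 + nx xs i) / (1 + nx xo i)))
    \<le> (\<Sum>j\<in>UNIV. gKL (ny j) (sg xs j)) - (\<Sum>j\<in>UNIV. gKL (ny j) (sg xo j))"
proof -
  have "supp (xo - xs) \<subseteq> S" using xo_off xs_pos(2) by (force simp: supp_def)
  then have "l0norm (xo - xs) \<le> K" using l0norm_subset K1(2) by (meson order_trans)
  then have "C * (\<Sum>i\<in>UNIV. \<gamma> $ i * gKL 1 ((1 + nx xs i) / (1 + nx xo i))) \<le> (\<Sum>j\<in>UNIV. ny j * gKL 1 (sg xs j / sg xo j))"
    by (rule brsc_bregman[OF brsc_xo xs0])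
  then have "\<xi> * (C * (\<Sum>i\<in>S. \<gamma> $ i * gKL 1 ((1 + nx xs i) / (1 + nx xo i)))) \<le> \<xi> * (\<Sum>j\<in>UNIV. ny j * gKL 1 (sg xs j / sg xo j))"
    unfolding kl_sum_S using xi(1) by (intro mult_left_mono) auto
  also have "\<dots> \<le> Fid A y b xs - Fid A y b xo"
    using Fid_expand[OF xo0 xs0] gradient_xo_variation[OF xs0] by (simp add: S)
  also have "\<dots> = \<xi> * ((\<Sum>j\<in>UNIV. gKL (ny j) (sg xs j)) - (\<Sum>j\<in>UNIV. gKL (ny j) (sg xo j)))"
    by (simp add: Fid_eq right_diff_distrib)
  finally show ?thesis using xi(1) by (simp only: mult_le_cancel_left_pos)
qed

lemma safe: "(\<Sum>i\<in>S. \<gamma> $ i * gKL 1 ((1 + nx xs i) / (1 + nx xo i))) \<le> Fid A y b xs / (\<xi> * C)"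
proof -
  have "0 \<le> (\<Sum>j\<in>UNIV. gKL (ny j) (sg xo j))"
    using Fid_nonneg[OF xo0] xi(1) by (simp add: Fid_eq zero_le_mult_iff)
  then have "C * (\<Sum>i\<in>S. \<gamma> $ i * gKL 1 ((1 + nx xs i) / (1 + nx xo i))) \<le> Fid A y b xs / \<xi>"
    using energy xi(1) by (simp add: Fid_eq)
  then have "(\<Sum>i\<in>S. \<gamma> $ i * gKL 1 ((1 + nx xs i) / (1 + nx xo i))) \<le> Fid A y b xs / \<xi> / C"
    using C_pos by (simp only: pos_le_divide_eq mult.commute)
  then show ?thesis by simp
qed

end

text \<open>The window for \<open>lam\<close> in normalised form. In \<open>upper\<close>,
  \<open>E\<close> stands for the right endpoint of the sublevel interval and enters only through an
  inequality; in \<open>lower\<close>, \<open>\<kappa>\<close> is the number subtracted from 1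
  inside the logarithm of the lower bound.\<close>

locale lambda_window = oracle_setting A b y \<xi> \<gamma> C K S xs xo
  for A :: "real^'n^'m" and b :: "real^'m" and y :: "nat^'m" and \<xi> :: real and \<gamma> :: "real^'n"
    and C K S xs xo +
  fixes \<alpha> :: "real^'n" and lam e f L :: real
  assumes lam: "0 < lam"
    and alpha: "\<And>i. 0 < \<alpha> $ i" "\<And>i. bregman1 (psi A \<xi> \<gamma> i) 0 (\<alpha> $ i) = lam"
    and noise: "0 \<le> e" "\<And>j. \<bar>ny j - sg xs j\<bar> \<le> e" "(\<Sum>j\<in>UNIV. phi (sg xs j) e) \<le> f"
    and L: "\<And>j. ny j \<le> L * (nb j)\<^sup>2"
    and upper: "\<And>l. l \<in> S \<Longrightarrow> \<exists>E\<ge>1. f \<le> C * \<gamma> $ l * gKL 1 E \<and>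
        lam < - \<gamma> $ l * \<xi> * (ln (1 - exp (- (1 - C + C * min 1 (E / (1 + nx xs l))))) + 1)"
    and lower: "\<And>i. i \<notin> S \<Longrightarrow> \<exists>\<kappa><1. (\<kappa> * C * \<gamma> $ i)\<^sup>2 = (\<Sum>j\<in>UNIV. (na j i)\<^sup>2) * (2 * L * f) \<and> 0 \<le> \<kappa> \<and>
        - \<gamma> $ i * \<xi> * ln (1 - \<kappa>) < lam"
begin

definition r where "r i = 1 / (1 + c i * \<alpha> $ i / \<xi>)"

lemma r: "0 < r i" "r i < 1" "gKL 1 (r i) = lam / (\<gamma> $ i * \<xi>)"
proof -
  have p: "0 < c i * \<alpha> $ i / \<xi>" using cmin(1)[of i] alpha(1)[of i] xi(1) by simp
  then show "0 < r i" "r i < 1" by (auto simp: r_def)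
  have "\<gamma> $ i * \<xi> * gKL 1 (r i) = lam"
    using bregman_psi[of 0 "\<alpha> $ i" i] alpha[of i] by (simp add: r_def less_imp_le)
  then show "gKL 1 (r i) = lam / (\<gamma> $ i * \<xi>)" using gamma_pos[of i] xi(1) by (simp add: field_simps)
qed

lemma dpsi_alpha: "dpsi i (\<alpha> $ i) = \<gamma> $ i * c i * (1 - r i)"
proof -
  have p: "0 < c i * \<alpha> $ i / \<xi>" using cmin(1)[of i] alpha(1)[of i] xi(1) by simp
  have "z / (1 + z) = 1 - 1 / (1 + z)" if "0 < z" for z :: real using that by (simp add: field_simps)
  from this[OF p] show ?thesis by (simp only: dpsi_def r_def)
qed

lemma f0: "0 \<le> f"
proof -
  have "0 \<le> (\<Sum>j\<in>UNIV. phi (sg xs j) e)"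
    using sg_ge1[OF xs0] noise(1) by (intro sum_nonneg phi_nonneg) (auto intro: less_le_trans[OF zero_less_one])
  then show ?thesis using noise(3) by simp
qed

text \<open>Exponentiates \<open>r - 1 - log r < - log(1 - exp(-\<rho>)) - 1\<close>. That
  \<open>\<rho>\<close> is positive, so that the logarithm has a genuine argument, comes from
  \<open>C < 1\<close>.\<close>

lemma upper_exp:
  assumes "l \<in> S"
  obtains E where "1 \<le> E" "f \<le> C * \<gamma> $ l * gKL 1 E"
    "1 - exp (- (1 - C + C * min 1 (E / (1 + nx xs l)))) < r l * exp (- r l)"
proof -
  obtain E where E: "1 \<le> E" "f \<le> C * \<gamma> $ l * gKL 1 E"
    "lam < - \<gamma> $ l * \<xi> * (ln (1 - exp (- (1 - C + C * min 1 (E / (1 + nx xs l))))) + 1)"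
    using upper[OF assms] by auto
  define \<rho> where "\<rho> = 1 - C + C * min 1 (E / (1 + nx xs l))"
  have "0 \<le> C * min 1 (E / (1 + nx xs l))" using C_pos E(1) nx0[OF xs0, of l] by simp
  then have "0 < \<rho>" using C_less_1 by (simp add: \<rho>_def)
  then have q: "0 < 1 - exp (- \<rho>)" by simp
  have gx: "0 < \<gamma> $ l * \<xi>" using gamma_pos[of l] xi(1) by simp
  have "lam = \<gamma> $ l * \<xi> * gKL 1 (r l)"
    unfolding r(3) using gamma_pos[of l] xi(1) by simp
  moreover have "lam < \<gamma> $ l * \<xi> * (- (ln (1 - exp (- \<rho>)) + 1))"
    using E(3) by (simp only: \<rho>_def mult_minus_left mult_minus_right)
  ultimately have "\<gamma> $ l * \<xi> * gKL 1 (r l) < \<gamma> $ l * \<xi> * (- (ln (1 - exp (- \<rho>)) + 1))" by simp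
  then have "gKL 1 (r l) < - (ln (1 - exp (- \<rho>)) + 1)" using gx by (simp only: mult_less_cancel_left_pos)
  then have "ln (1 - exp (- \<rho>)) < ln (r l) - r l" using r(1)[of l] by (simp add: gKL_1)
  then have "exp (ln (1 - exp (- \<rho>))) < exp (ln (r l) - r l)" by (simp only: exp_less_cancel_iff)
  then have "1 - exp (- \<rho>) < r l * exp (- r l)" using q r(1)[of l] by (simp add: exp_diff exp_minus divide_inverse)
  then show ?thesis using that E \<rho>_def by blast
qed

lemma margin: assumes "l \<in> S" shows "27 / 50 * (1 + nx xs l) \<le> C * nx xs l"
proof -
  obtain E where E: "1 \<le> E" "f \<le> C * \<gamma> $ l * gKL 1 E"
    "1 - exp (- (1 - C + C * min 1 (E / (1 + nx xs l)))) < r l * exp (- r l)" by (rule upper_exp[OF assms])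
  have n: "0 \<le> nx xs l" by (rule nx0[OF xs0])
  have "1 - C + C * min 1 (E / (1 + nx xs l)) < 23 / 50" by (rule rho_bound[OF E(3)])
  moreover have "1 / (1 + nx xs l) \<le> min 1 (E / (1 + nx xs l))" using n E(1) by (simp add: divide_right_mono)
  then have "C * (1 / (1 + nx xs l)) \<le> C * min 1 (E / (1 + nx xs l))" using C_pos by (intro mult_left_mono) auto
  ultimately have "27 / 50 \<le> C - C * (1 / (1 + nx xs l))" by linarith
  then have "27 / 50 * (1 + nx xs l) \<le> (C - C * (1 / (1 + nx xs l))) * (1 + nx xs l)"
    using n by (intro mult_right_mono) auto
  also have "\<dots> = C * (1 + nx xs l) - C * (1 / (1 + nx xs l) * (1 + nx xs l))"
    by (simp only: left_diff_distrib mult.assoc)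
  also have "1 / (1 + nx xs l) * (1 + nx xs l) = 1" using n by simp
  also have "C * (1 + nx xs l) - C * 1 = C * nx xs l" by (simp add: distrib_left)
  finally show ?thesis .
qed

text \<open>The sum is the normalised curvature of the fidelity at the oracle along the column. It
  is bounded above through \<open>L\<close>, since means never fall below the background, and below
  by \<open>C \<gamma>\<close> through restricted strong convexity; the latter cancels one factor
  and bounds \<open>f\<close> itself.\<close>

lemma lower_facts:
  assumes "i \<notin> S"
  obtains \<kappa> where "0 \<le> \<kappa>" "\<kappa> < 1" "- ln (1 - \<kappa>) < lam / (\<gamma> $ i * \<xi>)"
    "C * \<gamma> $ i \<le> (\<Sum>j\<in>UNIV. (na j i)\<^sup>2 * ny j / (sg xo j)\<^sup>2)"
    "2 * (\<Sum>j\<in>UNIV. (na j i)\<^sup>2 * ny j / (sg xo j)\<^sup>2) * f \<le> (\<kappa> * C * \<gamma> $ i)\<^sup>2" "2 * f \<le> \<kappa>\<^sup>2 * (C * \<gamma> $ i)"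
proof -
  obtain \<kappa> where k: "\<kappa> < 1" "0 \<le> \<kappa>" "(\<kappa> * C * \<gamma> $ i)\<^sup>2 = (\<Sum>j\<in>UNIV. (na j i)\<^sup>2) * (2 * L * f)"
    "- \<gamma> $ i * \<xi> * ln (1 - \<kappa>) < lam" using lower[OF assms] by auto
  define Z where "Z = (\<Sum>j\<in>UNIV. (na j i)\<^sup>2 * ny j / (sg xo j)\<^sup>2)"
  have gx: "0 < \<gamma> $ i * \<xi>" using gamma_pos[of i] xi(1) by simp
  have 1: "- ln (1 - \<kappa>) < lam / (\<gamma> $ i * \<xi>)" using k(4) gx by (simp add: pos_less_divide_eq mult_ac)
  have 2: "C * \<gamma> $ i \<le> Z" using brsc_limit_0[OF brsc_xo K1(1), of i] xo_off[OF assms] by (simp add: Z_def nx_def)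
  have "Z \<le> (\<Sum>j\<in>UNIV. (na j i)\<^sup>2 * L)"
    unfolding Z_def
  proof (rule sum_mono)
    fix j
    have "(\<Sum>i\<in>UNIV. na j i * nx xo i) \<ge> 0" using na0 nx0[OF xo0] by (intro sum_nonneg) auto
    then have "nb j \<le> sg xo j" by (simp add: aff_def)
    then have nb: "(nb j)\<^sup>2 \<le> (sg xo j)\<^sup>2" using nb1[of j] by (intro power_mono) auto
    have p: "0 < (nb j)\<^sup>2" using nb1[of j] by simp
    have "0 \<le> L * (nb j)\<^sup>2" using L[of j] ny0[of j] by linarith
    then have "0 \<le> L" using p by (simp add: zero_le_mult_iff)
    then have "ny j \<le> L * (sg xo j)\<^sup>2" using L[of j] mult_left_mono[OF nb, of L] by linarith
    moreover have "0 < (sg xo j)\<^sup>2" using nb p by linarith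
    ultimately have "ny j / (sg xo j)\<^sup>2 \<le> L" by (simp only: pos_divide_le_eq)
    then have "(na j i)\<^sup>2 * (ny j / (sg xo j)\<^sup>2) \<le> (na j i)\<^sup>2 * L" by (intro mult_left_mono) auto
    then show "(na j i)\<^sup>2 * ny j / (sg xo j)\<^sup>2 \<le> (na j i)\<^sup>2 * L" by simp
  qed
  also have "\<dots> = (\<Sum>j\<in>UNIV. (na j i)\<^sup>2) * L" by (simp add: sum_distrib_right)
  finally have "2 * f * Z \<le> 2 * f * ((\<Sum>j\<in>UNIV. (na j i)\<^sup>2) * L)" using f0 by (intro mult_left_mono) auto
  then have 3: "2 * Z * f \<le> (\<kappa> * C * \<gamma> $ i)\<^sup>2" using k(3) by (simp add: mult_ac)
  have g: "0 < C * \<gamma> $ i" using C_pos gamma_pos[of i] by simp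
  have "(C * \<gamma> $ i) * (2 * f) \<le> Z * (2 * f)" using 2 f0 by (intro mult_right_mono) auto
  also have "\<dots> \<le> (C * \<gamma> $ i) * (\<kappa>\<^sup>2 * (C * \<gamma> $ i))" using 3 by (simp add: power_mult_distrib power2_eq_square mult_ac)
  finally have "2 * f \<le> \<kappa>\<^sup>2 * (C * \<gamma> $ i)" using g by (simp only: mult_le_cancel_left_pos)
  then show ?thesis using that k 1 2 3 by (simp add: Z_def)
qed

lemma noisy: assumes "oc \<notin> S" shows "noisy_oracle na nb ny (\<lambda>i. \<gamma> $ i) C e f S (nx xs) (nx xo) oc"
proof
  obtain \<kappa> where k: "0 \<le> \<kappa>" "\<kappa> < 1" "- ln (1 - \<kappa>) < lam / (\<gamma> $ oc * \<xi>)"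
    "C * \<gamma> $ oc \<le> (\<Sum>j\<in>UNIV. (na j oc)\<^sup>2 * ny j / (sg xo j)\<^sup>2)"
    "2 * (\<Sum>j\<in>UNIV. (na j oc)\<^sup>2 * ny j / (sg xo j)\<^sup>2) * f \<le> (\<kappa> * C * \<gamma> $ oc)\<^sup>2" "2 * f \<le> \<kappa>\<^sup>2 * (C * \<gamma> $ oc)" by (rule lower_facts[OF assms])
  have "0 < C * \<gamma> $ oc" using C_pos gamma_pos[of oc] by simp
  moreover have "\<kappa>\<^sup>2 < 1" using k by (simp add: power_less_one_iff abs_square_less_1)
  ultimately have "\<kappa>\<^sup>2 * (C * \<gamma> $ oc) < 1 * (C * \<gamma> $ oc)" by (intro mult_strict_right_mono) auto
  then show "2 * f < C * \<gamma> $ oc" using k(6) by simp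
  show "C * \<gamma> $ oc \<le> (\<Sum>j\<in>UNIV. na j oc * ny j / aff na nb (nx xs) j)"
    by (rule brsc_limit_infinity[OF brsc_xs K1(1) xs_pos(2)[OF assms]])
  show "0 < nx xs i" if "i \<in> S" for i using xs_pos(1)[OF that] cmin(1)[of i] xi(1) by (simp add: nx_def)
  show "nx xs i = 0" if "i \<notin> S" for i using xs_pos(2)[OF that] by (simp add: nx_def)
  show "nx xo i = 0" if "i \<notin> S" for i using xo_off[OF that] by (simp add: nx_def)
  show "C * (\<Sum>l\<in>S. \<gamma> $ l * gKL 1 ((1 + nx xs l) / (1 + nx xo l)))
      \<le> (\<Sum>j\<in>UNIV. gKL (ny j) (sg xs j)) - (\<Sum>j\<in>UNIV. gKL (ny j) (sg xo j))" by (rule energy)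
qed (fact na01 nb1 ny0 ng S(2) nx0[OF xo0] C_pos less_imp_le[OF C_less_1] noise margin assms)+

lemma dpsi_xo: "dpsi i (xo $ i) = \<gamma> $ i * c i * (nx xo i / (1 + nx xo i))"
  by (simp add: dpsi_def nx_def)

lemma support_slope: assumes "l \<in> S" shows "dpsi l (\<alpha> $ l) < C * dpsi l (xo $ l)"
proof -
  obtain oc where oc: "oc \<notin> S" by (rule off_support_exists)
  interpret N: noisy_oracle na nb ny "\<lambda>i. \<gamma> $ i" C e f S "nx xs" "nx xo" oc by (rule noisy[OF oc])
  obtain E where E: "1 \<le> E" "f \<le> C * \<gamma> $ l * gKL 1 E"
    "1 - exp (- (1 - C + C * min 1 (E / (1 + nx xs l)))) < r l * exp (- r l)" by (rule upper_exp[OF assms])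
  have "1 - r l < C * (nx xo l / (1 + nx xo l))"
    by (rule N.support_threshold[OF assms E(1,2) r(1) refl E(3)])
  then have "\<gamma> $ l * c l * (1 - r l) < \<gamma> $ l * c l * (C * (nx xo l / (1 + nx xo l)))"
    using gamma_pos[of l] cmin(1)[of l] by (intro mult_strict_left_mono) auto
  then show ?thesis by (simp add: dpsi_alpha dpsi_xo mult_ac)
qed

lemma off_support_slope: assumes "i \<notin> S" shows "- gradient (Fid A y b) xo $ i < C * dpsi i (\<alpha> $ i)"
proof -
  interpret N: noisy_oracle na nb ny "\<lambda>i. \<gamma> $ i" C e f S "nx xs" "nx xo" i by (rule noisy[OF assms])
  obtain \<kappa> where k: "0 \<le> \<kappa>" "\<kappa> < 1" "- ln (1 - \<kappa>) < lam / (\<gamma> $ i * \<xi>)"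
    "C * \<gamma> $ i \<le> (\<Sum>j\<in>UNIV. (na j i)\<^sup>2 * ny j / (sg xo j)\<^sup>2)"
    "2 * (\<Sum>j\<in>UNIV. (na j i)\<^sup>2 * ny j / (sg xo j)\<^sup>2) * f \<le> (\<kappa> * C * \<gamma> $ i)\<^sup>2" "2 * f \<le> \<kappa>\<^sup>2 * (C * \<gamma> $ i)" by (rule lower_facts[OF assms])
  have "- ln (1 - \<kappa>) < - ln (1 - (1 - r i)) - (1 - r i)"
    using k(3) r[of i] by (simp add: gKL_1)
  then have "(\<Sum>j\<in>UNIV. na j i * (ny j / sg xo j - 1)) < C * \<gamma> $ i * (1 - r i)"
    using r[of i] by (intro N.off_support_gradient[OF refl k(4) k(1,2) k(5)]) auto
  then have "c i * (\<Sum>j\<in>UNIV. na j i * (ny j / sg xo j - 1)) < c i * (C * \<gamma> $ i * (1 - r i))"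
    using cmin(1)[of i] by (intro mult_strict_left_mono)
  then show ?thesis by (simp add: gradient_Fid_component[OF xo0] dpsi_alpha mult_ac)
qed

text \<open>\<open>- log(1 - \<kappa>) \<ge> \<kappa> + \<kappa>\<^sup>2 / 2 \<ge> 3/2
  \<kappa>\<^sup>2\<close> matches the factor 3 of \<open>fidelity_le_3f\<close> combined with
  \<open>2 f \<le> \<kappa>\<^sup>2 C \<gamma>\<close>.\<close>

lemma Fid_xs_less: "Fid A y b xs < lam"
proof -
  obtain oc where oc: "oc \<notin> S" by (rule off_support_exists)
  interpret N: noisy_oracle na nb ny "\<lambda>i. \<gamma> $ i" C e f S "nx xs" "nx xo" oc by (rule noisy[OF oc])
  obtain \<kappa> where k: "0 \<le> \<kappa>" "\<kappa> < 1" "- ln (1 - \<kappa>) < lam / (\<gamma> $ oc * \<xi>)"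
    "C * \<gamma> $ oc \<le> (\<Sum>j\<in>UNIV. (na j oc)\<^sup>2 * ny j / (sg xo j)\<^sup>2)"
    "2 * (\<Sum>j\<in>UNIV. (na j oc)\<^sup>2 * ny j / (sg xo j)\<^sup>2) * f \<le> (\<kappa> * C * \<gamma> $ oc)\<^sup>2" "2 * f \<le> \<kappa>\<^sup>2 * (C * \<gamma> $ oc)" by (rule lower_facts[OF oc])
  have gx: "0 < \<gamma> $ oc * \<xi>" using gamma_pos[of oc] xi(1) by simp
  have "\<kappa> + \<kappa>\<^sup>2 / 2 \<le> - ln (1 - \<kappa>)"
  proof -
    have "0 \<le> \<kappa> ^ 3 / 3 + \<kappa> ^ 4 / 4" using k by simp
    then show ?thesis using neg_ln_one_minus_ge4[OF k(1,2)] by linarith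
  qed
  moreover have "\<kappa>\<^sup>2 \<le> \<kappa>" using k by (simp add: power2_eq_square mult_left_le)
  ultimately have "3 / 2 * \<kappa>\<^sup>2 < lam / (\<gamma> $ oc * \<xi>)" using k(3) by linarith
  then have 1: "3 / 2 * \<kappa>\<^sup>2 * (\<gamma> $ oc * \<xi>) < lam" using gx by (simp only: pos_less_divide_eq)
  have "Fid A y b xs \<le> \<xi> * (3 * f)"
    unfolding Fid_eq using xi(1) N.fidelity_le_3f by (intro mult_left_mono) auto
  also have "\<dots> \<le> \<xi> * (3 / 2 * (\<kappa>\<^sup>2 * (C * \<gamma> $ oc)))" using k(6) xi(1) by (intro mult_left_mono) (auto simp: mult_ac)
  also have "\<dots> = C * (3 / 2 * \<kappa>\<^sup>2 * (\<gamma> $ oc * \<xi>))" by simp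
  also have "\<dots> \<le> 3 / 2 * \<kappa>\<^sup>2 * (\<gamma> $ oc * \<xi>)" using C_less_1 C_pos gx by (intro mult_left_le_one_le) auto
  finally show ?thesis using 1 by simp
qed

end

section \<open>Minimisers and critical points\<close>

text \<open>Concavity is given on the open interval only. By continuity the midpoint inequality
  survives between \<open>t\<close> and an endpoint; the two midpoints so obtained are interior,
  have values at least \<open>f t\<close>, and strict concavity between them is
  contradicted.\<close>

lemma strictly_concave_gt_min:
  fixes f :: "real \<Rightarrow> real"
  assumes sc: "strictly_concave_on {0<..<a} f" and cont: "continuous_on {0..a} f" and t: "0 < t" "t < a"
  shows "min (f 0) (f a) < f t"
proof (rule ccontr)
  assume n: "\<not> ?thesis"
  have half: "f t \<le> f ((p + t) / 2)" if p: "p = 0 \<or> p = a" for p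
  proof -
    have pm: "p \<in> {0..a}" "(p + t) / 2 \<in> {0..a}" "f t \<le> f p" using p t n by auto
    define w where "w n = inverse (real (Suc (Suc n)))" for n
    define s where "s n = p + (t - p) * w n" for n
    have s: "s n \<in> {0<..<a}" "s n \<noteq> t" "(s n + t) / 2 \<in> {0..a}" for n
    proof -
      have "1 < real (Suc (Suc n))" by simp
      then have w: "0 < w n" "w n < 1" unfolding w_def by (simp, subst inverse_less_1_iff) auto
      have sn: "s n = (1 - w n) * p + w n * t" by (simp add: s_def algebra_simps)
      have 1: "0 < w n * t" "w n * t < t" using w t by auto
      have 2: "(1 - w n) * t < (1 - w n) * a" "w n * t < w n * a" using w t by (auto intro: mult_strict_left_mono)
      have "(1 - w n) * t + w n * t = t" "(1 - w n) * a + w n * a = a" by (simp_all add: algebra_simps)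
      then have 3: "t < (1 - w n) * a + w n * t" "(1 - w n) * a + w n * t < a" using 2 by linarith+
      have "0 < s n \<and> s n < a \<and> s n \<noteq> t" using p
      proof
        have "w n * t < a" using 1 t by linarith
        moreover assume "p = 0" ultimately show ?thesis using 1 w by (simp add: sn)
      next
        assume "p = a" then show ?thesis using 3 t by (simp add: sn)
      qed
      then show "s n \<in> {0<..<a}" "s n \<noteq> t" "(s n + t) / 2 \<in> {0..a}" using t by auto
    qed
    have lim: "s \<longlonglongrightarrow> p"
    proof -
      have "w \<longlonglongrightarrow> 0" unfolding w_def by (rule LIMSEQ_Suc[OF LIMSEQ_inverse_real_of_nat])
      then have "(\<lambda>n. p + (t - p) * w n) \<longlonglongrightarrow> p + (t - p) * 0" by (intro tendsto_intros)
      then show ?thesis unfolding s_def[abs_def] by simp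
    qed
    have "f (s n) / 2 + f t / 2 \<le> f ((s n + t) / 2)" for n
    proof -
      have "t \<in> {0<..<a}" using t by simp
      then have "\<forall>\<theta>. 0 < \<theta> \<longrightarrow> \<theta> < 1 \<longrightarrow> (1 - \<theta>) * f (s n) + \<theta> * f t < f ((1 - \<theta>) * s n + \<theta> * t)"
        using sc s[of n] unfolding strictly_concave_on_def by blast
      from this[rule_format, of "1 / 2"]
      have "(1 - 1 / 2) * f (s n) + 1 / 2 * f t < f ((1 - 1 / 2) * s n + 1 / 2 * t)" by simp
      then show ?thesis by (simp add: add_divide_distrib)
    qed
    moreover have "(\<lambda>n. f (s n) / 2 + f t / 2) \<longlonglongrightarrow> f p / 2 + f t / 2"
    proof (intro tendsto_intros)
      show "(\<lambda>n. f (s n)) \<longlonglongrightarrow> f p"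
        by (rule continuous_on_tendsto_compose[OF cont lim pm(1)]) (use s in \<open>auto simp: less_imp_le\<close>)
    qed auto
    moreover have "(\<lambda>n. f ((s n + t) / 2)) \<longlonglongrightarrow> f ((p + t) / 2)"
      by (rule continuous_on_tendsto_compose[OF cont _ pm(2)]) (use s(3) in \<open>auto intro!: tendsto_intros lim\<close>)
    ultimately have "f p / 2 + f t / 2 \<le> f ((p + t) / 2)" by (intro LIMSEQ_le) auto
    then show ?thesis using pm(3) by linarith
  qed
  define l where "l = (0 + t) / 2"
  define r where "r = (a + t) / 2"
  define \<theta> where "\<theta> = (t - l) / (r - l)"
  have lr: "l \<in> {0<..<a}" "r \<in> {0<..<a}" "l \<noteq> r" "l < t" "t < r" using t by (auto simp: l_def r_def)
  have th: "0 < \<theta>" "\<theta> < 1" using lr by (auto simp: \<theta>_def)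
  have "\<theta> * (r - l) = t - l" using lr by (simp add: \<theta>_def)
  then have "(1 - \<theta>) * l + \<theta> * r = t" by (simp add: algebra_simps)
  moreover have "(1 - \<theta>) * f l + \<theta> * f r < f ((1 - \<theta>) * l + \<theta> * r)"
    using sc lr(1,2,3) th unfolding strictly_concave_on_def by blast
  moreover have "(1 - \<theta>) * f t \<le> (1 - \<theta>) * f l" "\<theta> * f t \<le> \<theta> * f r"
    using half[of 0] half[of a] th by (auto simp: l_def r_def intro!: mult_left_mono)
  ultimately show False by (simp add: algebra_simps)
qed

context lambda_window
begin

section \<open>The relaxed penalty, coordinate by coordinate\<close>

abbreviation "JP \<equiv> JPsi A y b \<xi> \<gamma> \<alpha> lam"
abbreviation "bt i \<equiv> beta (psi A \<xi> \<gamma> i) (\<alpha> $ i) lam"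

lemma psi_0: "psi A \<xi> \<gamma> i 0 = 0" by (simp add: psi_eq)

lemma dpsi_0: "dpsi i 0 = 0" by (simp add: dpsi_def)

lemma dpsi_strict_mono: "0 \<le> t \<Longrightarrow> t < t' \<Longrightarrow> dpsi i t < dpsi i t'"
proof -
  assume t: "0 \<le> t" "t < t'"
  define n where "n = c i * t / \<xi>" define n' where "n' = c i * t' / \<xi>"
  have n: "0 \<le> n" "n < n'" using t cmin(1)[of i] xi(1) by (auto simp: n_def n'_def divide_strict_right_mono)
  then have "n / (1 + n) < n' / (1 + n')" by (simp add: field_simps)
  then show ?thesis unfolding dpsi_def n_def[symmetric] n'_def[symmetric]
    using gamma_pos[of i] cmin(1)[of i] by (intro mult_strict_left_mono) auto
qed

lemma dpsi_mono: "0 \<le> t \<Longrightarrow> t \<le> t' \<Longrightarrow> dpsi i t \<le> dpsi i t'"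
  using dpsi_strict_mono[of t t' i] by (cases "t = t'") auto

lemma dpsi_nonneg: "0 \<le> t \<Longrightarrow> 0 \<le> dpsi i t"
  using dpsi_mono[of 0 t i] by (simp add: dpsi_0)

lemma bregman_eq: "0 \<le> t' \<Longrightarrow> bregman1 (psi A \<xi> \<gamma> i) t t' = psi A \<xi> \<gamma> i t - psi A \<xi> \<gamma> i t' - dpsi i t' * (t - t')"
  by (simp add: bregman1_def deriv_psi)

lemma bregman_nonneg: "0 \<le> t \<Longrightarrow> 0 \<le> t' \<Longrightarrow> 0 \<le> bregman1 (psi A \<xi> \<gamma> i) t t'"
  unfolding bregman_psi using gamma_pos[of i] xi(1) cmin(1)[of i]
  by (intro mult_nonneg_nonneg gKL_1_nonneg divide_pos_pos) (auto intro!: add_pos_nonneg)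

lemma bregman_pos:
  assumes "0 \<le> t" "0 \<le> t'" "t \<noteq> t'" shows "0 < bregman1 (psi A \<xi> \<gamma> i) t t'"
proof -
  define q where "q = (1 + c i * t / \<xi>) / (1 + c i * t' / \<xi>)"
  have p: "0 < 1 + c i * t / \<xi>" "0 < 1 + c i * t' / \<xi>" using assms cmin(1)[of i] xi(1) by (auto intro!: add_pos_nonneg)
  then have q: "0 < q" by (simp add: q_def)
  have "1 + c i * t / \<xi> \<noteq> 1 + c i * t' / \<xi>" using assms(3) cmin(1)[of i] xi(1) by simp
  then have "q \<noteq> 1" using p by (simp add: q_def)
  then have "ln q \<noteq> q - 1" using ln_eq_minus_one[OF q] by blast
  then have "0 < gKL 1 q" using gKL_1_nonneg[OF q] gKL_1[OF q] by linarith
  then show ?thesis unfolding bregman_psi[OF assms(1,2)] q_def using gamma_pos[of i] xi(1) by simp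
qed

lemma alpha0: "0 \<le> \<alpha> $ i" using alpha(1)[of i] by simp

lemma lam_eq: "lam = dpsi i (\<alpha> $ i) * \<alpha> $ i - psi A \<xi> \<gamma> i (\<alpha> $ i)"
  using alpha(2)[of i] bregman_eq[OF alpha0, of i 0] by (simp add: psi_0)

lemma beta_low: "t \<le> \<alpha> $ i \<Longrightarrow> bt i t = dpsi i (\<alpha> $ i) * t - psi A \<xi> \<gamma> i t"
  by (simp add: beta_def psi_0 deriv_psi alpha0)

lemma beta_low': "t \<le> \<alpha> $ i \<Longrightarrow> bt i t = lam - bregman1 (psi A \<xi> \<gamma> i) t (\<alpha> $ i)"
  by (subst lam_eq[of i]) (simp add: beta_low bregman_eq alpha0 algebra_simps)

lemma beta_high: "\<alpha> $ i \<le> t \<Longrightarrow> bt i t = lam"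
proof (cases "t = \<alpha> $ i")
  case True
  have "bt i t = dpsi i (\<alpha> $ i) * t - psi A \<xi> \<gamma> i t" by (rule beta_low) (simp add: True)
  also have "\<dots> = lam" using lam_eq[of i] True by simp
  finally show "bt i t = lam" .
qed (simp add: beta_def)

lemma beta_0: "bt i 0 = 0" by (simp add: beta_low alpha0 psi_0)

lemma beta_le: "0 \<le> t \<Longrightarrow> bt i t \<le> lam"
  using beta_low'[of t i] bregman_nonneg[OF _ alpha0, of t i] beta_high[of i t] by (cases "t \<le> \<alpha> $ i") auto

lemma psi_le: "0 \<le> t \<Longrightarrow> psi A \<xi> \<gamma> i t \<le> dpsi i t * t"
  using bregman_nonneg[of 0 t i] by (simp add: bregman_eq psi_0)

lemma alpha_less_xo: assumes "i \<in> S" shows "\<alpha> $ i < xo $ i"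
proof (rule ccontr)
  assume "\<not> ?thesis"
  then have "dpsi i (xo $ i) \<le> dpsi i (\<alpha> $ i)" using xo0 by (intro dpsi_mono) (auto simp: less_eq_vec_def)
  moreover have "C * dpsi i (xo $ i) \<le> 1 * dpsi i (xo $ i)"
    using C_less_1 xo0 by (intro mult_right_mono dpsi_nonneg) (auto simp: less_eq_vec_def)
  ultimately show False using support_slope[OF assms] by linarith
qed

lemma xo_ge0: "0 \<le> xo $ i" using xo0 by (simp add: less_eq_vec_def)

lemma supp_xo: "supp xo = S"
proof
  show "S \<subseteq> supp xo"
  proof
    fix i assume "i \<in> S"
    then show "i \<in> supp xo" using alpha_less_xo[of i] alpha0[of i] by (auto simp: supp_def)
  qed
qed (rule xo_supp)

lemma gradient_xo_support: "i \<in> S \<Longrightarrow> gradient (Fid A y b) xo $ i = 0"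
  using alpha_less_xo[of i] alpha0[of i] by (intro gradient_xo_zero) auto

text \<open>\<open>G\<close> is the contribution of one coordinate to a lower bound for the increase
  of the relaxed objective. Below \<open>\<alpha>\<close> the penalty contains \<open>-psi\<close>,
  which the Bregman term compensates only with weight \<open>C\<close>; monotonicity and convexity
  of \<open>psi\<close> bound the remaining part \<open>1 - C\<close> by the slope at
  \<open>\<alpha>\<close>, and what is left has the sign given by the two slope conditions.\<close>

lemma coordinate_gain:
  fixes i :: 'n and t :: real
  assumes t: "0 \<le> t"
  defines "G \<equiv> gradient (Fid A y b) xo $ i * (t - xo $ i) + C * bregman1 (psi A \<xi> \<gamma> i) t (xo $ i) + bt i t - bt i (xo $ i)"
  shows "0 \<le> G" "t \<noteq> xo $ i \<Longrightarrow> 0 < G"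
proof -
  have pos: "0 < G" if ne: "t \<noteq> xo $ i"
  proof (cases "i \<in> S")
    case True
    have u: "\<alpha> $ i < xo $ i" by (rule alpha_less_xo[OF True])
    have B: "0 < C * bregman1 (psi A \<xi> \<gamma> i) t (xo $ i)" using C_pos bregman_pos[OF t xo_ge0 ne] by simp
    have G: "G = C * bregman1 (psi A \<xi> \<gamma> i) t (xo $ i) + bt i t - lam"
      using u by (simp add: G_def gradient_xo_support[OF True] beta_high)
    show ?thesis
    proof (cases "\<alpha> $ i \<le> t")
      case True
      then show ?thesis using G B by (simp add: beta_high)
    next
      case False
      define P where "P = psi A \<xi> \<gamma> i"
      define al where "al = \<alpha> $ i"
      have al: "0 \<le> al" "t < al" "al < xo $ i" using alpha0 False u by (auto simp: al_def)
      have "P t - P al \<le> 0"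
      proof -
        have "0 \<le> dpsi i t * (al - t)" using dpsi_nonneg[OF t, of i] al(2) by (intro mult_nonneg_nonneg) auto
        moreover have "0 \<le> P al - P t - dpsi i t * (al - t)"
          using bregman_nonneg[OF al(1) t, of i] unfolding bregman_eq[OF t] P_def .
        ultimately show ?thesis by linarith
      qed
      then have 1: "(1 - C) * (P t - P al + dpsi i al * (al - t)) \<le> (1 - C) * (dpsi i al * (al - t))"
        using C_less_1 by (intro mult_left_mono) auto
      have 2: "0 < C * bregman1 P al (xo $ i)"
        unfolding P_def using C_pos al by (intro mult_pos_pos bregman_pos xo_ge0) auto
      have 3: "0 < (al - t) * (C * dpsi i (xo $ i) - dpsi i al)"
        using support_slope[OF True] al by (simp add: al_def)
      have "G = C * bregman1 P t (xo $ i) - bregman1 P t al"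
        using G False by (simp add: beta_low' P_def al_def)
      \<comment> \<open>Three-point identity through the intermediate point
        \<open>al\<close>.\<close>
      also have "\<dots> = C * bregman1 P al (xo $ i) + (al - t) * (C * dpsi i (xo $ i) - C * dpsi i al)
          - (1 - C) * (P t - P al + dpsi i al * (al - t))"
      proof -
        have bx: "bregman1 P q (xo $ i) = P q - P (xo $ i) - dpsi i (xo $ i) * (q - xo $ i)" for q
          unfolding P_def by (rule bregman_eq[OF xo_ge0])
        have ba: "bregman1 P t al = P t - P al - dpsi i al * (t - al)"
          unfolding P_def by (rule bregman_eq[OF al(1)])
        show ?thesis unfolding bx ba by (simp add: algebra_simps)
      qed
      also have "\<dots> \<ge> C * bregman1 P al (xo $ i) + (al - t) * (C * dpsi i (xo $ i) - C * dpsi i al)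
          - (1 - C) * (dpsi i al * (al - t))" using 1 by simp
      also have "C * bregman1 P al (xo $ i) + (al - t) * (C * dpsi i (xo $ i) - C * dpsi i al)
          - (1 - C) * (dpsi i al * (al - t)) = C * bregman1 P al (xo $ i) + (al - t) * (C * dpsi i (xo $ i) - dpsi i al)"
        by (simp add: algebra_simps)
      finally show ?thesis using 2 3 by linarith
    qed
  next
    case False
    define P where "P = psi A \<xi> \<gamma> i"
    define al where "al = \<alpha> $ i"
    define gr where "gr = gradient (Fid A y b) xo $ i"
    have xi0: "xo $ i = 0" by (rule xo_off[OF False])
    have t0: "0 < t" using t ne xi0 by simp
    have sl: "0 < C * dpsi i al + gr" using off_support_slope[OF False] by (simp add: al_def gr_def)
    have G: "G = gr * t + C * P t + bt i t"
      by (simp add: G_def xi0 beta_0 bregman_eq dpsi_0 psi_0 gr_def P_def)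
    have st: "0 < (C * dpsi i al + gr) * t" using sl t0 by simp
    show ?thesis
    proof (cases "t \<le> al")
      case True
      have "P t \<le> dpsi i t * t" unfolding P_def by (rule psi_le[OF t])
      also have "\<dots> \<le> dpsi i al * t" using True t by (intro mult_right_mono dpsi_mono) auto
      finally have "(1 - C) * P t \<le> (1 - C) * (dpsi i al * t)" using C_less_1 by (intro mult_left_mono) auto
      moreover have "G = gr * t + C * P t + (dpsi i al * t - P t)" using G True by (simp add: beta_low al_def P_def)
      ultimately show ?thesis using st by (simp add: algebra_simps)
    next
      case False
      have al: "0 \<le> al" using alpha0 by (simp add: al_def)
      have "C * (P al + dpsi i al * (t - al)) \<le> C * P t"
        using bregman_nonneg[OF t al, of i] C_pos by (intro mult_left_mono) (auto simp: bregman_eq al P_def)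
      moreover have "(1 - C) * P al \<le> (1 - C) * (dpsi i al * al)"
        unfolding P_def using C_less_1 by (intro mult_left_mono psi_le al) auto
      moreover have "G = gr * t + C * P t + (dpsi i al * al - P al)"
      proof -
        have "bt i t = lam" using False by (intro beta_high) (simp add: al_def)
        moreover have "lam = dpsi i al * al - P al" unfolding al_def P_def by (rule lam_eq)
        ultimately show ?thesis using G by linarith
      qed
      ultimately show ?thesis using st by (simp add: algebra_simps)
    qed
  qed
  then show "t \<noteq> xo $ i \<Longrightarrow> 0 < G" .
  show "0 \<le> G"
  proof (cases "t = xo $ i")
    case True
    have "bregman1 (psi A \<xi> \<gamma> i) t t = 0" by (simp add: bregman1_def)
    then show ?thesis using True by (simp add: G_def)
  qed (use pos in \<open>auto intro: less_imp_le\<close>)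
qed

lemma sum_pos_if_vec_ne:
  fixes x' :: "real^'n"
  assumes "x' \<noteq> xo" "\<And>i. 0 \<le> G i" "\<And>i. x' $ i \<noteq> xo $ i \<Longrightarrow> (0::real) < G i"
  shows "0 < (\<Sum>i\<in>UNIV. G i)"
proof -
  obtain i where "x' $ i \<noteq> xo $ i" using assms(1) by (auto simp: vec_eq_iff)
  then show ?thesis using assms by (intro sum_pos2[of _ i]) auto
qed

lemma sparse_gain:
  assumes "0 \<le> x'" "x' \<noteq> xo" "l0norm (xo - x') \<le> K"
  shows "JP xo < JP x'"
proof -
  define gr where "gr = gradient (Fid A y b) xo"
  have x': "0 \<le> x' $ i" for i using assms(1) by (simp add: less_eq_vec_def)
  have "\<xi> * (C * (\<Sum>i\<in>UNIV. \<gamma> $ i * gKL 1 ((1 + nx x' i) / (1 + nx xo i)))) \<le> \<xi> * (\<Sum>j\<in>UNIV. ny j * gKL 1 (sg x' j / sg xo j))"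
    using brsc_bregman[OF brsc_xo assms(1,3)] xi(1) by (intro mult_left_mono) auto
  moreover have "\<xi> * (C * (\<Sum>i\<in>UNIV. \<gamma> $ i * gKL 1 ((1 + nx x' i) / (1 + nx xo i))))
      = (\<Sum>i\<in>UNIV. C * bregman1 (psi A \<xi> \<gamma> i) (x' $ i) (xo $ i))"
    by (simp add: bregman_psi x' xo_ge0 nx_def sum_distrib_left mult_ac)
  moreover have "gr \<bullet> (x' - xo) = (\<Sum>i\<in>UNIV. gr $ i * (x' $ i - xo $ i))" by (simp add: inner_vec_def)
  moreover have "0 < (\<Sum>i\<in>UNIV. gr $ i * (x' $ i - xo $ i) + C * bregman1 (psi A \<xi> \<gamma> i) (x' $ i) (xo $ i) + bt i (x' $ i) - bt i (xo $ i))"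
    unfolding gr_def by (intro sum_pos_if_vec_ne[OF assms(2)] coordinate_gain x')
  ultimately show ?thesis using Fid_expand[OF xo0 assms(1)]
    by (simp add: JPsi_def gr_def sum.distrib sum_subtractf)
qed

section \<open>Rounding, and minimality of the oracle\<close>

definition rounded :: "real^'n \<Rightarrow> bool" where
  "rounded x \<longleftrightarrow> 0 \<le> x \<and> (\<forall>i. x $ i = 0 \<or> \<alpha> $ i \<le> x $ i)"

lemma JP_rounded: "rounded x \<Longrightarrow> JP x = Fid A y b x + lam * real (l0norm x)"
proof -
  assume x: "rounded x"
  have "(\<Sum>i\<in>UNIV. bt i (x $ i)) = (\<Sum>i\<in>UNIV. if i \<in> supp x then lam else 0)"
  proof (rule sum.cong)
    fix i show "bt i (x $ i) = (if i \<in> supp x then lam else 0)"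
      using x by (auto simp: rounded_def supp_def beta_0 beta_high)
  qed simp
  then show ?thesis by (simp add: JPsi_def l0norm_def sum.If_cases)
qed

lemma JP_le_J0: "0 \<le> x \<Longrightarrow> JP x \<le> J0 A y b lam x"
proof -
  assume x: "0 \<le> x"
  have "(\<Sum>i\<in>UNIV. bt i (x $ i)) \<le> (\<Sum>i\<in>UNIV. if i \<in> supp x then lam else 0)"
    using x by (intro sum_mono) (auto simp: supp_def beta_0 beta_le less_eq_vec_def)
  then show ?thesis by (simp add: JPsi_def J0_def l0norm_def sum.If_cases mult.commute)
qed

lemma xo_rounded: "rounded xo"
  using xo0 xo_off alpha_less_xo by (force simp: rounded_def intro: less_imp_le)

lemma continuous_on_Fid: "continuous_on {0..} (Fid A y b)"
proof (rule continuous_at_imp_continuous_on, rule ballI)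
  fix x :: "real^'n" assume "x \<in> {0..}"
  then show "isCont (Fid A y b) x"
    using GDERIV_Fid[OF z_pos, of x y] has_derivative_continuous by (auto simp: gderiv_def)
qed

lemma round_coordinate:
  assumes conc: "strictly_concave_on {0<..<\<alpha> $ i} (\<lambda>t. JP (\<chi> k. if k = i then t else x $ k))"
    and x: "0 \<le> x" and bad: "0 < x $ i" "x $ i < \<alpha> $ i"
  shows "\<exists>t\<in>{0, \<alpha> $ i}. JP (\<chi> k. if k = i then t else x $ k) < JP x"
proof -
  define X where "X t = (\<chi> k. if k = i then t else x $ k)" for t
  have split: "(\<Sum>k\<in>UNIV. bt k (X t $ k)) = bt i t + (\<Sum>k\<in>UNIV - {i}. bt k (x $ k))" for t
    by (simp add: X_def sum.remove[of UNIV i])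
  have "continuous_on {0..\<alpha> $ i} (\<lambda>t. Fid A y b (X t) + ((dpsi i (\<alpha> $ i) * t - psi A \<xi> \<gamma> i t) + (\<Sum>k\<in>UNIV - {i}. bt k (x $ k))))"
  proof (intro continuous_intros)
    have "continuous_on {0..\<alpha> $ i} X"
    proof (rule continuous_on_vec_lambda[of _ "\<lambda>k t. if k = i then t else x $ k", folded X_def])
      fix k show "continuous_on {0..\<alpha> $ i} (\<lambda>t. if k = i then t else x $ k)" by (cases "k = i") auto
    qed
    moreover have "X ` {0..\<alpha> $ i} \<subseteq> {0..}" using x by (auto simp: X_def less_eq_vec_def)
    ultimately show "continuous_on {0..\<alpha> $ i} (\<lambda>t. Fid A y b (X t))"
      using continuous_on_compose2[OF continuous_on_Fid] by blast
    show "continuous_on {0..\<alpha> $ i} (psi A \<xi> \<gamma> i)"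
      by (rule DERIV_continuous_on[OF has_field_derivative_at_within[OF DERIV_psi']]) auto
  qed
  then have "continuous_on {0..\<alpha> $ i} (\<lambda>t. JP (X t))"
    by (rule continuous_on_cong[THEN iffD1, rotated 2]) (auto simp: JPsi_def split beta_low)
  moreover have "strictly_concave_on {0<..<\<alpha> $ i} (\<lambda>t. JP (X t))" using conc by (simp add: X_def)
  ultimately have "min (JP (X 0)) (JP (X (\<alpha> $ i))) < JP (X (x $ i))" using bad by (intro strictly_concave_gt_min)
  moreover have "X (x $ i) = x" by (simp add: X_def vec_eq_iff)
  ultimately show ?thesis by (auto simp: min_def X_def split: if_splits)
qed

context
  assumes concavity: "\<And>x i. 0 \<le> x \<Longrightarrow>
          strictly_concave_on {0<..<\<alpha> $ i} (\<lambda>t. JP (\<chi> k. if k = i then t else x $ k))"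
begin

text \<open>Each step sends one entry from the open interval to an endpoint, lowers the objective
  strictly and shrinks the set of entries still to be moved.\<close>

lemma rounding:
  "0 \<le> x \<Longrightarrow> \<exists>x'. rounded x' \<and> (x' = x \<or> JP x' < JP x)"
proof (induction "card {i. x $ i \<noteq> 0 \<and> x $ i < \<alpha> $ i}" arbitrary: x rule: less_induct)
  case less
  show ?case
  proof (cases "rounded x")
    case False
    then obtain i where i: "x $ i \<noteq> 0" "x $ i < \<alpha> $ i" using less.prems by (auto simp: rounded_def not_le)
    have "0 < x $ i" using i(1) less.prems by (simp add: less_eq_vec_def less_le)
    then obtain t where t: "t \<in> {0, \<alpha> $ i}" "JP (\<chi> k. if k = i then t else x $ k) < JP x"
      using round_coordinate[OF concavity[OF less.prems] less.prems] i(2) by blast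
    define x1 where "x1 = (\<chi> k. if k = i then t else x $ k)"
    have "{k. x1 $ k \<noteq> 0 \<and> x1 $ k < \<alpha> $ k} \<subset> {k. x $ k \<noteq> 0 \<and> x $ k < \<alpha> $ k}"
      using t(1) i by (auto simp: x1_def split: if_splits)
    then have "card {k. x1 $ k \<noteq> 0 \<and> x1 $ k < \<alpha> $ k} < card {k. x $ k \<noteq> 0 \<and> x $ k < \<alpha> $ k}"
      by (intro psubset_card_mono) auto
    moreover have "0 \<le> x1" using less.prems t(1) alpha0 by (auto simp: x1_def less_eq_vec_def)
    ultimately obtain x' where "rounded x'" "x' = x1 \<or> JP x' < JP x1" using less.hyps by blast
    moreover have "JP x1 < JP x" using t(2) by (simp add: x1_def)
    ultimately show ?thesis by auto
  qed auto
qed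

lemma xo_strict_minimum:
  assumes "0 \<le> x" "x \<noteq> xo" shows "JP xo < JP x"
proof -
  obtain x' where x': "rounded x'" "x' = x \<or> JP x' < JP x" using rounding[OF assms(1)] by auto
  have "JP xo < JP x'" if ne: "x' \<noteq> xo"
  proof (cases "l0norm (xo - x') \<le> K")
    case True
    then show ?thesis using x'(1) ne by (intro sparse_gain) (auto simp: rounded_def)
  next
    case False
    have "supp (xo - x') \<subseteq> S \<union> supp x'" using xo_supp by (auto simp: supp_def)
    then have "l0norm (xo - x') \<le> card (S \<union> supp x')" by (rule l0norm_subset)
    also have "\<dots> \<le> card S + l0norm x'" by (simp add: l0norm_def card_Un_le)
    finally have "card S + 1 \<le> l0norm x'" using False K(1) by linarith
    then have "lam * real (card S + 1) \<le> lam * real (l0norm x')" using lam by (intro mult_left_mono) (auto simp: of_nat_mono)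
    moreover have "0 \<le> Fid A y b x'" using x'(1) by (intro Fid_nonneg) (simp add: rounded_def)
    moreover have "Fid A y b xo \<le> Fid A y b xs" by (rule xo_min[OF xs0]) (simp add: S)
    moreover have "JP xo = Fid A y b xo + lam * real (card S)" using JP_rounded[OF xo_rounded] supp_xo by (simp add: l0norm_def)
    ultimately show ?thesis using JP_rounded[OF x'(1)] Fid_xs_less by (simp add: algebra_simps)
  qed
  then show ?thesis using x'(2) assms(2) by (cases "x' = xo") auto
qed

text \<open>\<open>J0\<close> dominates the relaxation and agrees with it at the oracle, so it
  inherits the strict minimum.\<close>

lemma minimizers:
  "{x. is_arg_min JP (\<lambda>x. 0 \<le> x) x} = {xo}" "{x. is_arg_min (J0 A y b lam) (\<lambda>x. 0 \<le> x) x} = {xo}"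
proof -
  have J0: "J0 A y b lam xo < J0 A y b lam x" if "0 \<le> x" "x \<noteq> xo" for x
    using xo_strict_minimum[OF that] JP_le_J0[OF that(1)] JP_rounded[OF xo_rounded] by (simp add: J0_def)
  have *: "{x. is_arg_min H (\<lambda>x. 0 \<le> x) x} = {xo}"
    if "\<And>x. 0 \<le> x \<Longrightarrow> x \<noteq> xo \<Longrightarrow> H xo < H x" for H :: "real^'n \<Rightarrow> real"
  proof (intro set_eqI iffI; clarsimp)
    fix x assume "is_arg_min H (\<lambda>x. 0 \<le> x) x"
    then show "x = xo" using that[of x] xo0 by (auto simp: is_arg_min_def)
  next
    show "is_arg_min H (\<lambda>x. 0 \<le> x) xo" using that xo0 by (auto simp: is_arg_min_def intro: order.asym)
  qed
  show "{x. is_arg_min JP (\<lambda>x. 0 \<le> x) x} = {xo}" by (rule *[of JP, OF xo_strict_minimum])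
  show "{x. is_arg_min (J0 A y b lam) (\<lambda>x. 0 \<le> x) x} = {xo}" by (rule *[of "J0 A y b lam", OF J0])
qed

end

text \<open>Criticality prescribes the gradient:
  \<open>dpsi i (x' $ i) - dpsi i (\<alpha> $ i)\<close> up to the threshold and 0 above it. With
  this the slope conditions make every differing coordinate violate the symmetric inequality
  strictly.\<close>

lemma critical_far:
  assumes crit: "critical_point A y b \<xi> \<gamma> \<alpha> x'" and ne: "x' \<noteq> xo"
  shows "K < l0norm (x' - xo)"
proof (rule ccontr)
  assume "\<not> ?thesis"
  then have l: "l0norm (xo - x') \<le> K" using l0norm_minus[of "x' - xo"] by simp
  have x': "0 \<le> x'" using crit by (simp add: critical_point_def)
  have x'i: "0 \<le> x' $ i" for i using x' by (simp add: less_eq_vec_def)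
  define gr where "gr = gradient (Fid A y b) xo"
  define gr' where "gr' = gradient (Fid A y b) x'"
  have gr': "gr' $ i = (if x' $ i \<le> \<alpha> $ i then dpsi i (x' $ i) - dpsi i (\<alpha> $ i) else 0)" for i
  proof -
    have "dpsi i (x' $ i) - gr' $ i \<in> subdiff_h (psi A \<xi> \<gamma> i) (\<alpha> $ i) (x' $ i)"
      using crit x' by (simp add: critical_point_def gradient_Psi gr'_def)
    then show ?thesis by (auto simp: subdiff_h_def deriv_psi alpha0 x'i split: if_splits)
  qed
  have C1: "0 \<le> 1 - C" using C_less_1 by simp
  have tm: "(gr' $ i - gr $ i) * (x' $ i - xo $ i) < C * (dpsi i (x' $ i) - dpsi i (xo $ i)) * (x' $ i - xo $ i)"
    if d: "x' $ i \<noteq> xo $ i" for i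
  proof (cases "i \<in> S")
    case True
    have g0: "gr $ i = 0" unfolding gr_def by (rule gradient_xo_support[OF True])
    have u: "\<alpha> $ i < xo $ i" by (rule alpha_less_xo[OF True])
    show ?thesis
    proof (cases "x' $ i \<le> \<alpha> $ i")
      case True
      have "0 \<le> (1 - C) * dpsi i (x' $ i)" using C1 dpsi_nonneg[OF x'i] by simp
      then have "C * (dpsi i (x' $ i) - dpsi i (xo $ i)) < gr' $ i"
        using support_slope[OF \<open>i \<in> S\<close>] True by (simp add: gr' algebra_simps)
      then show ?thesis using g0 u True by (simp add: mult_less_cancel_right)
    next
      case False
      have "0 < (dpsi i (x' $ i) - dpsi i (xo $ i)) * (x' $ i - xo $ i)"
        using dpsi_strict_mono[OF x'i, of i "xo $ i" i] dpsi_strict_mono[OF xo_ge0, of i "x' $ i" i] d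
        by (cases "x' $ i < xo $ i") (auto intro: mult_pos_pos mult_neg_neg)
      then show ?thesis using False g0 C_pos by (simp add: gr' mult.assoc)
    qed
  next
    case False
    have xi0: "xo $ i = 0" by (rule xo_off[OF False])
    have t: "0 < x' $ i" using x'i[of i] d xi0 by simp
    have "gr' $ i - gr $ i < C * dpsi i (x' $ i)"
    proof (cases "x' $ i \<le> \<alpha> $ i")
      case True
      have "(1 - C) * dpsi i (x' $ i) \<le> (1 - C) * dpsi i (\<alpha> $ i)"
        using True C1 by (intro mult_left_mono dpsi_mono x'i) auto
      then show ?thesis using True off_support_slope[OF False] by (simp add: gr' gr_def algebra_simps)
    next
      case F: False
      have "C * dpsi i (\<alpha> $ i) \<le> C * dpsi i (x' $ i)" using F C_pos by (intro mult_left_mono dpsi_mono alpha0) auto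
      then show ?thesis using F off_support_slope[OF False] by (simp add: gr' gr_def)
    qed
    then show ?thesis using t by (simp add: xi0 dpsi_0)
  qed
  have "C * sym_bregman (Psi A \<xi> \<gamma>) xo x' \<le> sym_bregman (Fid A y b) xo x'"
    using brsc_xo x' ne l by (simp add: brsc_at_def)
  moreover have "sym_bregman (Fid A y b) xo x' = (\<Sum>i\<in>UNIV. (gr' $ i - gr $ i) * (x' $ i - xo $ i))"
    by (simp add: sym_bregman_def inner_vec_def gr_def gr'_def)
  moreover have "C * sym_bregman (Psi A \<xi> \<gamma>) xo x' = (\<Sum>i\<in>UNIV. C * (dpsi i (x' $ i) - dpsi i (xo $ i)) * (x' $ i - xo $ i))"
    by (simp add: sym_bregman_def gradient_Psi[OF xo0] gradient_Psi[OF x'] inner_vec_def sum_distrib_left mult.assoc)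
  moreover have "0 < (\<Sum>i\<in>UNIV. C * (dpsi i (x' $ i) - dpsi i (xo $ i)) * (x' $ i - xo $ i) - (gr' $ i - gr $ i) * (x' $ i - xo $ i))"
  proof (rule sum_pos_if_vec_ne[OF ne])
    fix i
    show "0 \<le> C * (dpsi i (x' $ i) - dpsi i (xo $ i)) * (x' $ i - xo $ i) - (gr' $ i - gr $ i) * (x' $ i - xo $ i)"
      using tm[of i] by (cases "x' $ i = xo $ i") auto
    show "0 < C * (dpsi i (x' $ i) - dpsi i (xo $ i)) * (x' $ i - xo $ i) - (gr' $ i - gr $ i) * (x' $ i - xo $ i)"
      if "x' $ i \<noteq> xo $ i" using tm[OF that] by simp
  qed
  ultimately show False by (simp add: sum_subtractf)
qed

end

section \<open>The functions \<open>h\<^sub>i\<close>\<close>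

text \<open>The endpoint as a function of the level alone; its dependence on noise and signal then
  goes through \<open>f\<close> only.\<close>

definition klset :: "real \<Rightarrow> real set" where "klset q = {t. 0 < t \<and> gKL 1 t \<le> q}"
definition Eval :: "real \<Rightarrow> real" where "Eval q = Sup (klset q)"

lemma gKL_1_ge_half: "0 < t \<Longrightarrow> t / 2 - 1 \<le> gKL 1 t"
proof -
  assume t: "0 < t"
  have "ln (t / 2) \<le> t / 2 - 1" using t by (intro ln_le_minus_one) auto
  moreover have "ln (2::real) \<le> 1" using ln_le_minus_one[of "2::real"] by simp
  ultimately show ?thesis using t by (simp add: gKL_1 ln_div)
qed

lemma klset_bdd: "bdd_above (klset q)"
proof (rule bdd_aboveI)
  fix t assume "t \<in> klset q"
  then show "t \<le> 2 * q + 2" using gKL_1_ge_half[of t] by (auto simp: klset_def)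
qed

lemma one_in_klset: "0 \<le> q \<Longrightarrow> 1 \<in> klset q" by (simp add: klset_def gKL_1)

lemma Eval_ge: "0 < t \<Longrightarrow> gKL 1 t \<le> q \<Longrightarrow> t \<le> Eval q"
  unfolding Eval_def by (rule cSup_upper[OF _ klset_bdd]) (simp add: klset_def)

lemma Eval_ge_1: "0 \<le> q \<Longrightarrow> 1 \<le> Eval q"
  by (rule Eval_ge) (auto simp: gKL_1)

lemma Eval_mono: "0 \<le> q \<Longrightarrow> q \<le> q' \<Longrightarrow> Eval q \<le> Eval q'"
  unfolding Eval_def
proof (rule cSup_subset_mono[OF _ klset_bdd])
  assume "0 \<le> q" then show "klset q \<noteq> {}" using one_in_klset[of q] by auto
next
  assume "q \<le> q'" then show "klset q \<subseteq> klset q'" by (auto simp: klset_def)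
qed

lemma Eval_le: "1 \<le> t \<Longrightarrow> 0 \<le> q \<Longrightarrow> q < gKL 1 t \<Longrightarrow> Eval q \<le> t"
  unfolding Eval_def
proof (rule cSup_least)
  assume a: "1 \<le> t" "0 \<le> q" "q < gKL 1 t"
  show "klset q \<noteq> {}" using one_in_klset[OF a(2)] by auto
  fix x assume x: "x \<in> klset q"
  show "x \<le> t"
  proof (rule ccontr)
    assume "\<not> x \<le> t"
    then have "gKL 1 t \<le> gKL 1 x" using a(1) by (intro gKL_1_mono) auto
    then show False using x a(3) by (simp add: klset_def)
  qed
qed

text \<open>As \<open>ln\<close> increases, \<open>gKL 1 (t + d) \<le> gKL 1 t + d\<close> for
  \<open>t, d > 0\<close>; if the level were not reached at the supremum, the supremum could be
  enlarged.\<close>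

lemma gKL_1_Eval: "0 \<le> q \<Longrightarrow> q \<le> gKL 1 (Eval q)"
proof (rule ccontr)
  assume q: "0 \<le> q" and n: "\<not> q \<le> gKL 1 (Eval q)"
  have E: "1 \<le> Eval q" by (rule Eval_ge_1[OF q])
  define d where "d = q - gKL 1 (Eval q)"
  have d: "0 < d" using n by (simp add: d_def)
  have "gKL 1 (Eval q + d) \<le> gKL 1 (Eval q) + d"
  proof -
    have "ln (Eval q) \<le> ln (Eval q + d)" using E d by simp
    then show ?thesis using E d by (simp add: gKL_1)
  qed
  then have "Eval q + d \<le> Eval q" using E d by (intro Eval_ge) (auto simp: d_def)
  then show False using d by simp
qed

lemma Eval_tendsto:
  assumes "(g \<longlongrightarrow> 0) F" "eventually (\<lambda>x. 0 \<le> g x) F" shows "((\<lambda>x. Eval (g x)) \<longlongrightarrow> 1) F"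
proof (rule order_tendstoI)
  fix l :: real assume "l < 1"
  then show "eventually (\<lambda>x. l < Eval (g x)) F"
    by (intro eventually_mono[OF assms(2)]) (use Eval_ge_1 in force)
next
  fix h :: real assume h: "1 < h"
  define t where "t = (1 + h) / 2"
  have t: "1 < t" "t < h" using h by (auto simp: t_def)
  have "ln t \<noteq> t - 1" using ln_eq_minus_one[of t] t by auto
  then have "0 < gKL 1 t" using gKL_1_nonneg[of t] t by (simp add: gKL_1)
  then have "eventually (\<lambda>x. g x < gKL 1 t) F" using order_tendstoD(2)[OF assms(1)] by auto
  then show "eventually (\<lambda>x. Eval (g x) < h) F"
    using assms(2)
  proof eventually_elim
    case (elim x)
    then show ?case using Eval_le[of t "g x"] t by simp
  qed
qed

lemma fnoise_phi: "fnoise A b S e x = (\<Sum>j\<in>UNIV. phi (abar A S j * x + b $ j) e)"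
  by (simp add: fnoise_def phi_def)

section \<open>Monotonicity and limits of \<open>f\<close> and of the \<open>h\<close>
  functions\<close>

context poisson_setting
begin

lemma abar0: "0 \<le> abar A S j" using A_nonneg by (simp add: abar_def sum_nonneg)

lemma b0: "0 < b $ j" using xi(1) xi(2)[of j] by simp

lemma base_point_pos: "0 \<le> x \<Longrightarrow> 0 < abar A S j * x + b $ j"
  using abar0[of S j] b0[of j] by (intro add_nonneg_pos mult_nonneg_nonneg)

lemma fnoise_nonneg: "0 \<le> e \<Longrightarrow> 0 \<le> x \<Longrightarrow> 0 \<le> fnoise A b S e x"
  unfolding fnoise_phi by (intro sum_nonneg phi_nonneg base_point_pos)

lemma fnoise_mono: "0 \<le> e \<Longrightarrow> e \<le> e' \<Longrightarrow> 0 \<le> x \<Longrightarrow> fnoise A b S e x \<le> fnoise A b S e' x"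
  unfolding fnoise_phi by (intro sum_mono phi_mono base_point_pos)

lemma fnoise_antimono: "0 \<le> e \<Longrightarrow> 0 \<le> x \<Longrightarrow> x \<le> x' \<Longrightarrow> fnoise A b S e x' \<le> fnoise A b S e x"
  unfolding fnoise_phi using abar0 by (intro sum_mono phi_antimono base_point_pos) (auto intro: mult_left_mono)

lemma fnoise_tendsto_0: "0 \<le> x \<Longrightarrow> ((\<lambda>e. fnoise A b S e x) \<longlongrightarrow> 0) (at_right 0)"
proof -
  assume x: "0 \<le> x"
  have "((\<lambda>e. phi s e) \<longlongrightarrow> phi s 0) (at_right 0)" if "0 < s" for s
    unfolding phi_def using that by (intro tendsto_intros) auto
  from this[OF base_point_pos[OF x]]
  have "((\<lambda>e. fnoise A b S e x) \<longlongrightarrow> (\<Sum>j\<in>UNIV. phi (abar A S j * x + b $ j) 0)) (at_right 0)"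
    unfolding fnoise_phi by (intro tendsto_sum)
  moreover have "phi s 0 = 0" if "0 < s" for s using that by (simp add: phi_def)
  ultimately show ?thesis using base_point_pos[OF x] by simp
qed

definition qf :: "'n set \<Rightarrow> real \<Rightarrow> 'n \<Rightarrow> real \<Rightarrow> real \<Rightarrow> real" where
  "qf S C i e x = fnoise A b S e x / (\<gamma> $ i * \<xi> * C)"

lemma E_end_eq: "E_end A b S \<xi> \<gamma> C i e x = Eval (qf S C i e x)"
  by (simp add: E_end_def Eval_def klset_def qf_def)

context
  fixes C :: real and S :: "'n set"
  assumes C: "0 < C" "C < 1"
begin

lemma gxC: "0 < \<gamma> $ i * \<xi> * C" using gamma_pos[of i] xi(1) C by simp

lemma qf_nonneg: "0 \<le> e \<Longrightarrow> 0 \<le> x \<Longrightarrow> 0 \<le> qf S C i e x"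
  using fnoise_nonneg gxC[of i] by (simp add: qf_def)

lemma E_end_ge_1: "0 \<le> e \<Longrightarrow> 0 \<le> x \<Longrightarrow> 1 \<le> E_end A b S \<xi> \<gamma> C i e x"
  by (simp add: E_end_eq Eval_ge_1 qf_nonneg)

lemma E_end_mono: "0 \<le> e \<Longrightarrow> e \<le> e' \<Longrightarrow> 0 \<le> x \<Longrightarrow> E_end A b S \<xi> \<gamma> C i e x \<le> E_end A b S \<xi> \<gamma> C i e' x"
  unfolding E_end_eq using gxC[of i]
  by (intro Eval_mono qf_nonneg) (auto simp: qf_def intro!: divide_right_mono fnoise_mono)

lemma E_end_antimono: "0 \<le> e \<Longrightarrow> 0 \<le> x \<Longrightarrow> x \<le> x' \<Longrightarrow> E_end A b S \<xi> \<gamma> C i e x' \<le> E_end A b S \<xi> \<gamma> C i e x"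
  unfolding E_end_eq using gxC[of i]
  by (intro Eval_mono qf_nonneg) (auto simp: qf_def intro!: divide_right_mono fnoise_antimono)

text \<open>\<open>g1\<close> is affine in the ratio \<open>\<xi> / (c t + \<xi>)\<close>, and
  \<open>h\<close> is minus that ratio at the preimage of \<open>v\<close>. Solving gives the ratio
  \<open>w = 1 - C (1 - v)\<close>; \<open>v \<le> 1\<close> and \<open>C < 1\<close> place it in
  \<open>(0, 1]\<close>, so the preimage \<open>al\<close> exists in \<open>{0..}\<close> and
  \<open>inv_into\<close> returns it.\<close>

lemma hfun_eq:
  assumes "0 \<le> u" "0 \<le> e" "0 \<le> x"
  shows "hfun A b S \<xi> \<gamma> C i u e x = - (1 - C + C * min 1 (E_end A b S \<xi> \<gamma> C i e x / (1 + c i * u / \<xi>)))"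
proof -
  define E where "E = E_end A b S \<xi> \<gamma> C i e x"
  define v where "v = min 1 (\<xi> * E / (c i * u + \<xi>))"
  have E: "1 \<le> E" unfolding E_def by (rule E_end_ge_1[OF assms(2,3)])
  have p: "0 < c i * u + \<xi>" using assms(1) cmin(1)[of i] xi(1) by (simp add: add_nonneg_pos)
  have v: "0 < v" "v \<le> 1" using E xi(1) p by (auto simp: v_def)
  define w where "w = 1 - C * (1 - v)"
  have w: "0 < w" "w \<le> 1"
  proof -
    have "C * (1 - v) \<le> C * 1" using v C by (intro mult_left_mono) auto
    then show "0 < w" using C unfolding w_def by linarith
    have "0 \<le> C * (1 - v)" using v C by (intro mult_nonneg_nonneg) auto
    then show "w \<le> 1" by (simp add: w_def)
  qed
  define al where "al = \<xi> * (1 - w) / (c i * w)"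
  have al0: "0 \<le> al" using w xi(1) cmin(1)[of i] by (simp add: al_def)
  have cal: "c i * al + \<xi> = \<xi> / w"
  proof -
    have "c i * al = \<xi> * (1 - w) / w" using cmin(1)[of i] by (simp add: al_def)
    then show ?thesis using w by (simp add: field_simps)
  qed
  have g1e: "g1 (c i) \<xi> C t = 1 - (1 - \<xi> / (c i * t + \<xi>)) / C" if "0 \<le> t" for t
  proof -
    have "0 < c i * t + \<xi>" using that cmin(1)[of i] xi(1) by (simp add: add_nonneg_pos)
    then have "c i * t / (c i * t + \<xi>) = 1 - \<xi> / (c i * t + \<xi>)" by (simp add: field_simps)
    then have "c i * t / (c i * t + \<xi>) / C = (1 - \<xi> / (c i * t + \<xi>)) / C" by simp
    then show ?thesis by (simp add: g1_def mult.commute)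
  qed
  have inj: "inj_on (g1 (c i) \<xi> C) {0..}"
  proof (rule inj_onI)
    fix t t' assume t: "t \<in> {0..}" "t' \<in> {0..}" "g1 (c i) \<xi> C t = g1 (c i) \<xi> C t'"
    have "0 < c i * t + \<xi>" "0 < c i * t' + \<xi>" using t cmin(1)[of i] xi(1) by (auto intro!: add_nonneg_pos)
    moreover have "\<xi> / (c i * t + \<xi>) = \<xi> / (c i * t' + \<xi>)" using t C by (simp add: g1e)
    ultimately have "c i * t = c i * t'" using xi(1) by (simp add: field_simps)
    then show "t = t'" using cmin(1)[of i] by simp
  qed
  have "g1 (c i) \<xi> C al = v"
    using w xi(1) C by (simp add: g1e[OF al0] cal) (simp add: w_def)
  then have "inv_into {0..} (g1 (c i) \<xi> C) v = al"
    using inv_into_f_f[OF inj, of al] al0 by simp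
  then have "hfun A b S \<xi> \<gamma> C i u e x = - \<xi> / (c i * al + \<xi>)"
    using C by (simp add: hfun_def Let_def E_def[symmetric] v_def)
  also have "\<dots> = - w" using cal w xi(1) by simp
  also have "v = min 1 (E / (1 + c i * u / \<xi>))"
  proof -
    have "1 + c i * u / \<xi> = (c i * u + \<xi>) / \<xi>" using xi(1) by (simp add: field_simps)
    then show ?thesis by (simp add: v_def mult.commute)
  qed
  then have "- w = - (1 - C + C * min 1 (E / (1 + c i * u / \<xi>)))" by (simp add: w_def algebra_simps)
  finally show ?thesis by (simp add: E_def)
qed

lemma hfun_nonpos: "0 \<le> u \<Longrightarrow> 0 \<le> e \<Longrightarrow> 0 \<le> x \<Longrightarrow> hfun A b S \<xi> \<gamma> C i u e x \<le> 0"
proof -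
  assume a: "0 \<le> u" "0 \<le> e" "0 \<le> x"
  have "0 \<le> 1 + c i * u / \<xi>" using a(1) cmin(1)[of i] xi(1) by simp
  then have "0 \<le> E_end A b S \<xi> \<gamma> C i e x / (1 + c i * u / \<xi>)"
    using order_trans[OF zero_le_one E_end_ge_1[OF a(2,3), of i]] by (intro divide_nonneg_nonneg)
  then have "0 \<le> C * min 1 (E_end A b S \<xi> \<gamma> C i e x / (1 + c i * u / \<xi>))"
    using C by (intro mult_nonneg_nonneg) auto
  then show ?thesis using C by (simp add: hfun_eq[OF a])
qed

lemma hfun_mono:
  assumes "0 \<le> u" "u \<le> u'" "0 \<le> e'" "e' \<le> e" "0 \<le> x" "x \<le> x'"
  shows "hfun A b S \<xi> \<gamma> C i u e x \<le> hfun A b S \<xi> \<gamma> C i u' e' x'"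
proof -
  have "E_end A b S \<xi> \<gamma> C i e' x' \<le> E_end A b S \<xi> \<gamma> C i e x"
    using assms by (intro order_trans[OF E_end_antimono E_end_mono]) auto
  moreover have "1 \<le> E_end A b S \<xi> \<gamma> C i e' x'" using assms by (intro E_end_ge_1) auto
  moreover have "0 \<le> c i * u / \<xi>" "c i * u / \<xi> \<le> c i * u' / \<xi>"
    using assms cmin(1)[of i] xi(1) by (auto intro!: divide_right_mono mult_left_mono)
  ultimately have "E_end A b S \<xi> \<gamma> C i e' x' / (1 + c i * u' / \<xi>) \<le> E_end A b S \<xi> \<gamma> C i e x / (1 + c i * u / \<xi>)"
    by (intro frac_le) auto
  then have "C * min 1 (E_end A b S \<xi> \<gamma> C i e' x' / (1 + c i * u' / \<xi>)) \<le> C * min 1 (E_end A b S \<xi> \<gamma> C i e x / (1 + c i * u / \<xi>))"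
    using C by (intro mult_left_mono min.mono) auto
  then show ?thesis using assms by (simp add: hfun_eq)
qed

lemma hfun_tendsto_noise:
  assumes "0 \<le> u" "0 \<le> x"
  shows "((\<lambda>e. hfun A b S \<xi> \<gamma> C i u e x) \<longlongrightarrow> (c i * u * (C - 1) - \<xi>) / (c i * u + \<xi>)) (at_right 0)"
proof -
  define s where "s = 1 + c i * u / \<xi>"
  have "0 \<le> c i * u / \<xi>" using assms(1) cmin(1)[of i] xi(1) by simp
  then have s: "1 \<le> s" by (simp add: s_def)
  have q: "((\<lambda>e. qf S C i e x) \<longlongrightarrow> 0) (at_right 0)"
    unfolding qf_def using tendsto_divide_zero[OF fnoise_tendsto_0[OF assms(2)]] by simp
  have "((\<lambda>e. E_end A b S \<xi> \<gamma> C i e x) \<longlongrightarrow> 1) (at_right 0)"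
    unfolding E_end_eq
    by (rule Eval_tendsto[OF q]) (use qf_nonneg assms(2) in \<open>auto simp: eventually_at_right_field intro!: exI[of _ 1]\<close>)
  then have "((\<lambda>e. - (1 - C + C * min 1 (E_end A b S \<xi> \<gamma> C i e x / s))) \<longlongrightarrow> - (1 - C + C * min 1 (1 / s))) (at_right 0)"
    using s by (intro tendsto_intros) auto
  then have "((\<lambda>e. hfun A b S \<xi> \<gamma> C i u e x) \<longlongrightarrow> - (1 - C + C * min 1 (1 / s))) (at_right 0)"
  proof (rule Lim_transform_eventually)
    show "eventually (\<lambda>e. - (1 - C + C * min 1 (E_end A b S \<xi> \<gamma> C i e x / s)) = hfun A b S \<xi> \<gamma> C i u e x) (at_right 0)"
      using hfun_eq[OF assms(1) _ assms(2)] by (auto simp: eventually_at_right_field s_def intro!: exI[of _ 1])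
  qed
  moreover have "- (1 - C + C * min 1 (1 / s)) = (c i * u * (C - 1) - \<xi>) / (c i * u + \<xi>)"
  proof -
    have p: "0 < c i * u + \<xi>" using assms(1) cmin(1)[of i] xi(1) by (simp add: add_nonneg_pos)
    have "s = (c i * u + \<xi>) / \<xi>" using xi(1) by (simp add: s_def field_simps)
    then have "1 / s = \<xi> / (c i * u + \<xi>)" by simp
    moreover have "min 1 (1 / s) = 1 / s" using s by simp
    ultimately have "- (1 - C + C * min 1 (1 / s)) = - (1 - C + C * (\<xi> / (c i * u + \<xi>)))" by (simp only:)
    also have "\<dots> = (c i * u * (C - 1) - \<xi>) / (c i * u + \<xi>)" using p by (simp add: field_simps)
    finally show ?thesis .
  qed
  ultimately show ?thesis by (simp only:)
qed

text \<open>The endpoint never exceeds its value \<open>E0\<close> at signal 0, while its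
  denominator grows at least linearly with the smallest entry of \<open>w\<close>; this squeezes
  \<open>h\<close>.\<close>

lemma hfun_tendsto_signal:
  assumes i: "i \<in> S" and e: "0 \<le> e"
  shows "((\<lambda>w. hfun A b S \<xi> \<gamma> C i (w $ i) e (minpos S w)) \<longlongrightarrow> C - 1)
     (inf (filtercomap (minpos S) at_top) (principal {w. 0 \<le> w \<and> supp w = S}))"
proof -
  define F where "F = inf (filtercomap (minpos S) at_top) (principal {w::real^'n. 0 \<le> w \<and> supp w = S})"
  define E0 where "E0 = E_end A b S \<xi> \<gamma> C i e 0"
  have E0: "1 \<le> E0" unfolding E0_def using e by (intro E_end_ge_1) auto
  have top: "filterlim (minpos S) at_top F"
    unfolding F_def by (rule filterlim_mono[OF filterlim_filtercomap order_refl inf_le1])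
  have "eventually (\<lambda>w. w \<in> {w. 0 \<le> w \<and> supp w = S}) F"
    unfolding F_def by (rule filter_leD[OF inf_le2]) (simp add: eventually_principal)
  then have ev: "eventually (\<lambda>w. C - 1 - C * (E0 / (1 + c i / \<xi> * minpos S w)) \<le> hfun A b S \<xi> \<gamma> C i (w $ i) e (minpos S w)
      \<and> hfun A b S \<xi> \<gamma> C i (w $ i) e (minpos S w) \<le> C - 1) F"
  proof eventually_elim
    case (elim w)
    then have w: "0 \<le> w $ k" "k \<in> S \<Longrightarrow> 0 < w $ k" for k by (auto simp: supp_def less_eq_vec_def less_le)
    have mw: "minpos S w \<le> w $ i" unfolding minpos_def using i by (intro Min_le) auto
    have m0: "0 \<le> minpos S w" unfolding minpos_def using i w by (intro Min.boundedI) auto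
    define E where "E = E_end A b S \<xi> \<gamma> C i e (minpos S w)"
    have E: "1 \<le> E" "E \<le> E0" unfolding E_def E0_def using e m0 by (auto intro: E_end_ge_1 E_end_antimono)
    have cx: "0 \<le> c i / \<xi> * minpos S w" "c i / \<xi> * minpos S w \<le> c i * w $ i / \<xi>"
      using m0 mw cmin(1)[of i] xi(1) by (auto simp: divide_right_mono)
    have "min 1 (E / (1 + c i * w $ i / \<xi>)) \<le> E / (1 + c i * w $ i / \<xi>)" by simp
    also have "\<dots> \<le> E0 / (1 + c i / \<xi> * minpos S w)" using E cx by (intro frac_le) auto
    finally have "C * min 1 (E / (1 + c i * w $ i / \<xi>)) \<le> C * (E0 / (1 + c i / \<xi> * minpos S w))"
      using C by (intro mult_left_mono) auto
    moreover have "0 \<le> C * min 1 (E / (1 + c i * w $ i / \<xi>))"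
    proof -
      have "0 \<le> E / (1 + c i * w $ i / \<xi>)" using E cx by (intro divide_nonneg_nonneg) auto
      then show ?thesis using C by (intro mult_nonneg_nonneg) auto
    qed
    ultimately show ?case using hfun_eq[OF w(1)[of i] e m0, of i] by (simp add: E_def)
  qed
  have "((\<lambda>w. E0 / (1 + c i / \<xi> * minpos S w)) \<longlongrightarrow> 0) F"
  proof (rule tendsto_divide_0[OF tendsto_const])
    have "filterlim (\<lambda>w. c i / \<xi> * minpos S w) at_top F"
      using cmin(1)[of i] xi(1) by (intro filterlim_tendsto_pos_mult_at_top[OF tendsto_const _ top]) auto
    then have "filterlim (\<lambda>w. 1 + c i / \<xi> * minpos S w) at_top F"
      by (intro filterlim_tendsto_add_at_top[OF tendsto_const])
    then show "filterlim (\<lambda>w. 1 + c i / \<xi> * minpos S w) at_infinity F" by (rule filterlim_at_top_imp_at_infinity)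
  qed
  then have "((\<lambda>w. C - 1 - C * (E0 / (1 + c i / \<xi> * minpos S w))) \<longlongrightarrow> C - 1 - C * 0) F"
    by (intro tendsto_intros)
  then have "((\<lambda>w. C - 1 - C * (E0 / (1 + c i / \<xi> * minpos S w))) \<longlongrightarrow> C - 1) F" by simp
  then have "((\<lambda>w. hfun A b S \<xi> \<gamma> C i (w $ i) e (minpos S w)) \<longlongrightarrow> C - 1) F"
    by (rule tendsto_sandwich[rotated 2]) (use ev in \<open>auto elim: eventually_mono\<close>)
  then show ?thesis by (simp add: F_def)
qed

end
end

section \<open>Padding by zeros and the final assembly\<close>

lemma sum_pad: "inj \<sigma> \<Longrightarrow> (\<Sum>i\<in>UNIV. h i * pad_vec \<sigma> u $ i) = (\<Sum>l\<in>UNIV. h (\<sigma> l) * u $ l)"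
  for h :: "'n::finite \<Rightarrow> real" and \<sigma> :: "'k::finite \<Rightarrow> 'n"
proof -
  assume inj: "inj \<sigma>"
  have "(\<Sum>i\<in>UNIV. h i * pad_vec \<sigma> u $ i) = (\<Sum>i\<in>range \<sigma>. h i * pad_vec \<sigma> u $ i)"
    by (rule sum.mono_neutral_right) (auto simp: pad_vec_def)
  also have "\<dots> = (\<Sum>l\<in>UNIV. h (\<sigma> l) * pad_vec \<sigma> u $ \<sigma> l)"
    using inj by (simp add: sum.reindex)
  finally show ?thesis using inj by (simp add: pad_vec_def)
qed

lemma Fid_restrict_cols:
  assumes "inj \<sigma>" shows "Fid (restrict_cols \<sigma> A) y b u = Fid A y b (pad_vec \<sigma> u)"
proof -
  have "(restrict_cols \<sigma> A *v u) $ j = (A *v pad_vec \<sigma> u) $ j" for j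
    by (simp add: matrix_vector_mult_def restrict_cols_def sum_pad[OF assms])
  then show ?thesis by (simp add: Fid_def GKL_def)
qed

lemma pad_restrict: "inj \<sigma> \<Longrightarrow> supp x \<subseteq> range \<sigma> \<Longrightarrow> pad_vec \<sigma> (restrict_vec \<sigma> x) = x"
  by (auto simp: vec_eq_iff pad_vec_def restrict_vec_def supp_def subset_iff f_inv_into_f)

lemma phi_divide: "0 < r \<Longrightarrow> phi (s / r) (e / r) = phi s e / r"
proof -
  assume r: "0 < r"
  have 1: "s / r + e / r = (s + e) / r" by (simp add: add_divide_distrib)
  have 2: "(s + e) / r / (s / r) = (s + e) / s" using r by simp
  show ?thesis unfolding phi_def 1 2 by (simp add: diff_divide_distrib)
qed

theorem corollary6p6:
  fixes A :: "real^'n^'m" and b :: "real^'m" and y :: "nat^'m"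
    and lam \<xi> Lt C :: real and \<gamma> \<alpha> xs :: "real^'n"
    and \<sigma> :: "'k::finite \<Rightarrow> 'n" and uor :: "real^'k" and xor :: "real^'n"
    and K :: nat and X :: "(real^'n) set" and \<epsilon> :: "real^'m"
  assumes A_nonneg: "\<And>j i. 0 \<le> A $ j $ i"
    and A_col: "\<And>i. column i A \<noteq> 0"
    and b_pos: "\<And>j. 0 < b $ j"
    and lam_pos: "0 < lam"
    and xi: "0 < \<xi>" "\<And>j. \<xi> \<le> b $ j"
    and gamma_pos: "\<And>i. 0 < \<gamma> $ i"
    and gamma_gt: "\<And>i. (\<Sum>j\<in>UNIV. (A $ j $ i)\<^sup>2 * real (y $ j)) / ((cmin A i)\<^sup>2 * \<xi>) < \<gamma> $ i"
    and alpha: "\<And>i. 0 < \<alpha> $ i" "\<And>i. bregman1 (psi A \<xi> \<gamma> i) 0 (\<alpha> $ i) = lam"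
    and concavity: "\<And>x i. 0 \<le> x \<Longrightarrow>
          strictly_concave_on {0<..<\<alpha> $ i}
            (\<lambda>t. JPsi A y b \<xi> \<gamma> \<alpha> lam (\<chi> k. if k = i then t else x $ k))"
    and Lt_ge: "Max (range (\<lambda>j. real (y $ j) / (b $ j)\<^sup>2)) \<le> Lt"
    and Lt_bound: "\<And>x. 0 \<le> x \<Longrightarrow>
          norm (gradient (GKL y b) (A *v x)) \<le> sqrt (2 * Lt * GKL y b (A *v x))"
    \<comment> \<open>ground truth and oracle\<close>
    and xs_nonneg: "0 \<le> xs"
    and sigma: "inj \<sigma>" "range \<sigma> = supp xs"
    and full_rank: "rank (restrict_cols \<sigma> A) = min CARD('m) CARD('k)"
    and uor: "is_arg_min (Fid (restrict_cols \<sigma> A) y b) (\<lambda>u. 0 \<le> u) uor"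
    and xor_def: "xor = pad_vec \<sigma> uor"
    \<comment> \<open>BRSC\<close>
    and K: "2 * CARD('k) \<le> K" "K \<le> CARD('n)"
    and X: "X \<subseteq> {0..}" "compact X" "xor \<in> X" "xs \<in> X"
    and C_pos: "0 < C"
    and brsc: "\<And>x x'. x \<in> X \<Longrightarrow> 0 \<le> x' \<Longrightarrow> x' \<noteq> x \<Longrightarrow> l0norm (x - x') \<le> K \<Longrightarrow>
          C * sym_bregman (Psi A \<xi> \<gamma>) x x' \<le> sym_bregman (Fid A y b) x x'"
    \<comment> \<open>noise\<close>
    and eps_def: "\<epsilon> = (\<chi> j. real (y $ j)) - (A *v xs + b)"
  shows
    "uor \<in> safe_region A y b \<xi> \<gamma> C \<sigma> xs \<and>
     (Lambda_lower A b (supp xs) \<xi> \<gamma> C K Lt (infnorm \<epsilon>) (minpos (supp xs) xs) < ereal lam \<longrightarrow>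
      lam < Lambda_upper A b (supp xs) \<xi> \<gamma> C xs (infnorm \<epsilon>) (minpos (supp xs) xs) \<longrightarrow>
        {x. is_arg_min (JPsi A y b \<xi> \<gamma> \<alpha> lam) (\<lambda>x. 0 \<le> x) x} = {xor} \<and>
        {x. is_arg_min (J0 A y b lam) (\<lambda>x. 0 \<le> x) x} = {xor} \<and>
        supp xor = supp xs \<and>
        (\<forall>x'. critical_point A y b \<xi> \<gamma> \<alpha> x' \<longrightarrow> x' \<noteq> xor \<longrightarrow> K < l0norm (x' - xor))) \<and>
     (\<forall>i\<in>supp xs.
        \<comment> \<open>sign and monotonicity of \<open>h\<^sub>i\<close>\<close>
        (\<forall>e\<ge>0. \<forall>x\<ge>0. hfun A b (supp xs) \<xi> \<gamma> C i (xs $ i) e x \<le> 0) \<and>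
        (\<forall>x\<ge>0. antimono_on {0..} (\<lambda>e. hfun A b (supp xs) \<xi> \<gamma> C i (xs $ i) e x)) \<and>
        (\<forall>e\<ge>0. \<forall>u u' x x'. 0 \<le> u \<longrightarrow> u \<le> u' \<longrightarrow> 0 \<le> x \<longrightarrow> x \<le> x' \<longrightarrow>
           hfun A b (supp xs) \<xi> \<gamma> C i u e x \<le> hfun A b (supp xs) \<xi> \<gamma> C i u' e x') \<and>
        \<comment> \<open>limit for vanishing noise\<close>
        (\<forall>x\<ge>0.
           ((\<lambda>e. hfun A b (supp xs) \<xi> \<gamma> C i (xs $ i) e x) \<longlongrightarrow>
              (cmin A i * xs $ i * (min C 1 - 1) - \<xi>) / (cmin A i * xs $ i + \<xi>)) (at_right 0)) \<and>
        \<comment> \<open>limit along ground truths \<open>w\<close> with the given support, as \<open>m(w) \<longlongrightarrow> \<infinity>\<close>\<close>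
        (\<forall>e\<ge>0.
           ((\<lambda>w. hfun A b (supp xs) \<xi> \<gamma> C i (w $ i) e (minpos (supp xs) w)) \<longlongrightarrow> min C 1 - 1)
             (inf (filtercomap (minpos (supp xs)) at_top)
                  (principal {w. 0 \<le> w \<and> supp w = supp xs}))))"
proof -
  interpret P: poisson_setting A b y \<xi> \<gamma>
    by unfold_locales (fact A_nonneg A_col xi gamma_gt)+
  define S where "S = supp xs"
  have ran: "range \<sigma> = S" using sigma(2) by (simp add: S_def)
  have cardS: "card S = CARD('k)" using card_image[OF sigma(1)] by (simp add: ran)
  have uor0: "0 \<le> uor" and uor_min: "\<And>u. 0 \<le> u \<Longrightarrow> Fid A y b xor \<le> Fid A y b (pad_vec \<sigma> u)"
    using uor by (auto simp: is_arg_min_def xor_def Fid_restrict_cols[OF sigma(1)] not_less)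
  interpret O: oracle_setting A b y \<xi> \<gamma> C K S xs xor
  proof
    show "S \<noteq> {}" using ran by auto
    show "P.brsc_at C K xs" "P.brsc_at C K xor" using brsc X by (auto simp: P.brsc_at_def)
    show "supp xor \<subseteq> S" by (auto simp: xor_def supp_def pad_vec_def ran split: if_splits)
    show "Fid A y b xor \<le> Fid A y b x" if "0 \<le> x" "supp x \<subseteq> S" for x
      using uor_min[of "restrict_vec \<sigma> x"] pad_restrict[of \<sigma> x] sigma(1) that
      by (simp add: ran less_eq_vec_def restrict_vec_def)
  qed (use C_pos S_def K cardS in auto)
  have C1: "C < 1" by (rule O.C_less_1)
  have xs_i: "0 \<le> xs $ i" for i using xs_nonneg by (simp add: less_eq_vec_def)
  have ratio: "(P.c i * t + \<xi>) / (P.c i * t' + \<xi>) = (1 + P.c i * t / \<xi>) / (1 + P.c i * t' / \<xi>)" for i t t'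
  proof -
    have "1 + P.c i * q / \<xi> = (P.c i * q + \<xi>) / \<xi>" for q using xi(1) by (simp add: field_simps)
    then show ?thesis using xi(1) by simp
  qed
  have safe: "uor \<in> safe_region A y b \<xi> \<gamma> C \<sigma> xs"
  proof -
    have "(\<Sum>l\<in>UNIV. \<gamma> $ \<sigma> l * gKL 1 ((P.c (\<sigma> l) * restrict_vec \<sigma> xs $ l + \<xi>) / (P.c (\<sigma> l) * uor $ l + \<xi>)))
        = (\<Sum>i\<in>range \<sigma>. \<gamma> $ i * gKL 1 ((1 + P.nx xs i) / (1 + P.nx xor i)))"
      using sigma(1) by (simp add: sum.reindex P.nx_def restrict_vec_def xor_def pad_vec_def ratio)
    also have "\<dots> \<le> Fid A y b xs / (\<xi> * C)" using O.safe by (simp add: ran)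
    also have "Fid A y b xs = Fid (restrict_cols \<sigma> A) y b (restrict_vec \<sigma> xs)"
      using pad_restrict[OF sigma(1), of xs] by (simp add: Fid_restrict_cols[OF sigma(1)] ran S_def)
    finally show ?thesis using uor0 by (simp add: safe_region_def)
  qed
  define en where "en = infnorm \<epsilon>"
  define m where "m = minpos S xs"
  define fn where "fn = fnoise A b S en m"
  have en0: "0 \<le> en" by (simp add: en_def infnorm_pos_le)
  have m: "0 \<le> m" "\<And>i. i \<in> S \<Longrightarrow> m \<le> xs $ i"
    using O.S(2) O.xs_pos(1) xs_i by (auto simp: m_def minpos_def)
  have main: "{x. is_arg_min (JPsi A y b \<xi> \<gamma> \<alpha> lam) (\<lambda>x. 0 \<le> x) x} = {xor} \<and>
        {x. is_arg_min (J0 A y b lam) (\<lambda>x. 0 \<le> x) x} = {xor} \<and>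
        supp xor = S \<and>
        (\<forall>x'. critical_point A y b \<xi> \<gamma> \<alpha> x' \<longrightarrow> x' \<noteq> xor \<longrightarrow> K < l0norm (x' - xor))"
    if lo: "Lambda_lower A b S \<xi> \<gamma> C K Lt en m < ereal lam" and up: "lam < Lambda_upper A b S \<xi> \<gamma> C xs en m"
  proof -
    have fn0: "0 \<le> fn" unfolding fn_def by (rule P.fnoise_nonneg[OF en0 m(1)])
    have Lt: "real (y $ j) / (b $ j)\<^sup>2 \<le> Lt" for j
      by (rule order_trans[OF Max_ge Lt_ge]) auto
    have Lt0: "0 \<le> Lt" using order_trans[OF _ Lt] by (simp add: zero_le_divide_iff)
    \<comment> \<open>Noise level and \<open>f\<close> are divided by \<open>\<xi>\<close>, while
      \<open>Lt\<close> is multiplied by it because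
      \<open>ny / nb\<^sup>2 = \<xi> y / b\<^sup>2\<close>.\<close>
    interpret W: lambda_window A b y \<xi> \<gamma> C K S xs xor \<alpha> lam "en / \<xi>" "fn / \<xi>" "\<xi> * Lt"
    proof
      show "0 \<le> en / \<xi>" using en0 xi(1) by simp
      show "\<bar>P.ny j - P.sg xs j\<bar> \<le> en / \<xi>" for j
      proof -
        have "P.ny j - P.sg xs j = \<epsilon> $ j / \<xi>"
          by (simp add: P.ny_def P.sg eps_def diff_divide_distrib)
        moreover have "\<bar>\<epsilon> $ j\<bar> \<le> en" unfolding en_def by (rule component_le_infnorm_cart)
        ultimately show ?thesis using xi(1) by (simp add: divide_right_mono)
      qed
      show "(\<Sum>j\<in>UNIV. phi (P.sg xs j) (en / \<xi>)) \<le> fn / \<xi>"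
        unfolding fn_def fnoise_phi sum_divide_distrib
      proof (rule sum_mono)
        fix j
        have "abar A S j * m \<le> (\<Sum>i\<in>S. A $ j $ i * xs $ i)"
          unfolding abar_def sum_distrib_right using m A_nonneg by (intro sum_mono mult_left_mono) auto
        also have "\<dots> \<le> (A *v xs) $ j"
          unfolding matrix_vector_mult_def using A_nonneg xs_i by (auto intro!: sum_mono2 mult_nonneg_nonneg)
        finally have "phi ((A *v xs) $ j + b $ j) en \<le> phi (abar A S j * m + b $ j) en"
          using en0 by (intro phi_antimono P.base_point_pos m) auto
        then show "phi (P.sg xs j) (en / \<xi>) \<le> phi (abar A S j * m + b $ j) en / \<xi>"
          using xi(1) by (simp add: P.sg phi_divide divide_right_mono)
      qed
      show "P.ny j \<le> \<xi> * Lt * (P.nb j)\<^sup>2" for j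
      proof -
        have "real (y $ j) \<le> Lt * (b $ j)\<^sup>2" using Lt[of j] b_pos[of j] by (simp add: pos_divide_le_eq)
        then have "real (y $ j) / \<xi> \<le> Lt * (b $ j)\<^sup>2 / \<xi>" using xi(1) by (intro divide_right_mono) auto
        then show ?thesis using xi(1) by (simp add: P.ny_def P.nb_def power_divide power2_eq_square)
      qed
      show "\<exists>E\<ge>1. fn / \<xi> \<le> C * \<gamma> $ l * gKL 1 E \<and>
          lam < - \<gamma> $ l * \<xi> * (ln (1 - exp (- (1 - C + C * min 1 (E / (1 + P.nx xs l))))) + 1)" if l: "l \<in> S" for l
      proof (intro exI[of _ "E_end A b S \<xi> \<gamma> C l en m"] conjI)
        show "1 \<le> E_end A b S \<xi> \<gamma> C l en m" by (rule P.E_end_ge_1[OF C_pos C1 en0 m(1)])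
        have "P.qf S C l en m \<le> gKL 1 (E_end A b S \<xi> \<gamma> C l en m)"
          unfolding P.E_end_eq by (rule gKL_1_Eval[OF P.qf_nonneg[OF C_pos C1 en0 m(1)]])
        then show "fn / \<xi> \<le> C * \<gamma> $ l * gKL 1 (E_end A b S \<xi> \<gamma> C l en m)"
          using P.gxC[OF C_pos C1, of l] xi(1) by (simp add: P.qf_def fn_def pos_divide_le_eq mult_ac)
        have "lam < - \<gamma> $ l * \<xi> * (ln (1 - exp (hfun A b S \<xi> \<gamma> C l (xs $ l) en m)) + 1)"
          by (rule less_le_trans[OF up], unfold Lambda_upper_def, rule Min_le) (use l in auto)
        then show "lam < - \<gamma> $ l * \<xi> * (ln (1 - exp (- (1 - C + C * min 1 (E_end A b S \<xi> \<gamma> C l en m / (1 + P.nx xs l))))) + 1)"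
          unfolding P.hfun_eq[OF C_pos C1 xs_i en0 m(1)] P.nx_def .
      qed
      show "\<exists>\<kappa><1. (\<kappa> * C * \<gamma> $ i)\<^sup>2 = (\<Sum>j\<in>UNIV. (P.na j i)\<^sup>2) * (2 * (\<xi> * Lt) * (fn / \<xi>)) \<and> 0 \<le> \<kappa> \<and>
          - \<gamma> $ i * \<xi> * ln (1 - \<kappa>) < lam" if i: "i \<notin> S" for i
      proof -
        define \<kappa> where "\<kappa> = norm (column i A) * sqrt (2 * Lt * fn) / (C * \<gamma> $ i * P.c i)"
        have gx: "0 < \<gamma> $ i * \<xi>" using gamma_pos[of i] xi(1) by simp
        have "ereal (\<gamma> $ i * \<xi>) * neg_log (1 - \<kappa>) \<le> Lambda_lower A b S \<xi> \<gamma> C K Lt en m"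
          unfolding Lambda_lower_def \<kappa>_def using i C1
          by (intro max.coboundedI2 Max_ge) (auto simp: fn_def min_def)
        then have *: "ereal (\<gamma> $ i * \<xi>) * neg_log (1 - \<kappa>) < ereal lam" using lo by (rule le_less_trans)
        \<comment> \<open>Otherwise \<open>neg_log\<close> makes the lower bound infinite, and no
          real \<open>lam\<close> exceeds it.\<close>
        have k1: "\<kappa> < 1"
        proof (rule ccontr)
          assume "\<not> \<kappa> < 1"
          then have "neg_log (1 - \<kappa>) = \<infinity>" by (simp add: neg_log_def)
          then show False using * gx gamma_pos[of i] xi(1) by auto
        qed
        have "- \<gamma> $ i * \<xi> * ln (1 - \<kappa>) < lam" using * k1 by (simp add: neg_log_def)
        moreover have "0 \<le> \<kappa>" unfolding \<kappa>_def
          using C_pos gamma_pos[of i] P.cmin(1)[of i] Lt0 fn0 by (intro divide_nonneg_nonneg mult_nonneg_nonneg) auto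
        moreover have "(\<kappa> * C * \<gamma> $ i)\<^sup>2 = (\<Sum>j\<in>UNIV. (P.na j i)\<^sup>2) * (2 * (\<xi> * Lt) * (fn / \<xi>))"
        proof -
          have "\<kappa> * C * \<gamma> $ i = norm (column i A) * sqrt (2 * Lt * fn) / P.c i"
            using C_pos gamma_pos[of i] by (simp add: \<kappa>_def)
          moreover have "(norm (column i A))\<^sup>2 = (\<Sum>j\<in>UNIV. (A $ j $ i)\<^sup>2)"
            by (simp add: norm_vec_def L2_set_def column_def sum_nonneg)
          moreover have "(\<Sum>j\<in>UNIV. (P.na j i)\<^sup>2) = (\<Sum>j\<in>UNIV. (A $ j $ i)\<^sup>2) / (P.c i)\<^sup>2"
            by (simp add: P.na_def power_divide sum_divide_distrib)
          ultimately show ?thesis using Lt0 fn0 xi(1) by (simp add: power_divide power_mult_distrib)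
        qed
        ultimately show ?thesis using k1 by auto
      qed
    qed (fact lam_pos alpha)+
    show ?thesis using W.minimizers[OF concavity] W.supp_xo W.critical_far by simp
  qed
  \<comment> \<open>Restricted strong convexity forces \<open>C < 1\<close>, so the functions
    \<open>h\<close> are given by the branch with \<open>g1\<close>.\<close>
  have minC: "min C 1 = C" using C1 by simp
  show ?thesis
    unfolding S_def[symmetric] minC
  proof (intro conjI impI ballI allI)
    show "uor \<in> safe_region A y b \<xi> \<gamma> C \<sigma> xs" by (rule safe)
  next
    fix i e x
    show "0 \<le> e \<Longrightarrow> 0 \<le> x \<Longrightarrow> hfun A b S \<xi> \<gamma> C i (xs $ i) e x \<le> 0"
      by (rule P.hfun_nonpos[OF C_pos C1 xs_i])
  next
    fix i x assume x: "(0::real) \<le> x"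
    show "antimono_on {0..} (\<lambda>e. hfun A b S \<xi> \<gamma> C i (xs $ i) e x)"
      by (rule monotone_onI) (use P.hfun_mono[OF C_pos C1 xs_i] x in auto)
  next
    fix i e u u' x x'
    show "0 \<le> e \<Longrightarrow> 0 \<le> u \<Longrightarrow> u \<le> u' \<Longrightarrow> 0 \<le> x \<Longrightarrow> x \<le> x' \<Longrightarrow>
        hfun A b S \<xi> \<gamma> C i u e x \<le> hfun A b S \<xi> \<gamma> C i u' e x'"
      by (rule P.hfun_mono[OF C_pos C1]) auto
  next
    fix i x
    show "0 \<le> x \<Longrightarrow> ((\<lambda>e. hfun A b S \<xi> \<gamma> C i (xs $ i) e x) \<longlongrightarrow>
        (P.c i * xs $ i * (C - 1) - \<xi>) / (P.c i * xs $ i + \<xi>)) (at_right 0)"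
      by (rule P.hfun_tendsto_noise[OF C_pos C1 xs_i])
  next
    fix i e assume "i \<in> S" "(0::real) \<le> e"
    then show "((\<lambda>w. hfun A b S \<xi> \<gamma> C i (w $ i) e (minpos S w)) \<longlongrightarrow> C - 1)
        (inf (filtercomap (minpos S) at_top) (principal {w. 0 \<le> w \<and> supp w = S}))"
      by (rule P.hfun_tendsto_signal[OF C_pos C1])
  qed (use main in \<open>simp_all add: en_def m_def\<close>)
qed

end
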